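(* Let $d$ be a positive integer. The elements $$ e:=\sum_{r=0}^{d-1}\mathbf{v}^{-r}e_r,\qquad f:=\sum_{r=0}^{d-1}\mathbf{v}^{1+r-d}f_r,\qquad k:=\sum_{r=0}^d\mathbf{v}^{2r-d}1_r,\qquad k^{-1}:=\sum_{r=0}^d\mathbf{v}^{d-2r}1_r,$$ $$\ell:=1_0+\sum_{r=1}^d \mathbf{v}^{-2r}(1_r+x_r)$$ generate the $\mathbb{C}(\mathbf{v})$-algebra $MU_{\mathbf{v}}(2,d)$ (the generic mirabolic quantum Schur algebra).
   Context: For a prime power $q$ let $\mathbb{F}_q$ be the field with $q$ elements, $G_d=\mathrm{GL}_d(\mathbb{F}_q)$, and let $\mathcal{F}(2,d)$ be the set of 2-step flags $F=(0=F_0\subseteq F_1\subseteq F_2=\mathbb{F}_q^d)$. $G_d$ acts diagonally on $\mathcal{F}(2,d)\times\mathcal{F}(2,d)\times\mathbb{F}_q^d$. Let $\mathcal{MU}_q(2,d)$ be the $\mathbb{C}$-algebra of $G_d$-invariant complex functions on this set, with convolution product $$(\alpha*\beta)(F,F',v)=\sum_{H\in\mathcal{F}(2,d),\,u\in\mathbb{F}_q^d}\alpha(F,H,u)\,\beta(H,F',v-u).$$ Orbits. Let $\Xi_{2,d}$ be the set of pairs $(A,\Delta)$ where $A=(a_{ij})$ is a $2\times 2$ matrix of nonnegative integers with entries summing to $d$ and $\Delta=\{(i_1,j_1),\dots,(i_k,j_k)\}$ is a (possibly empty) set of positions with $1\le i_1<\dots<i_k\le 2$, $1\le j_k<\dots<j_1\le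 2$ and $a_{ij}>0$ for all $(i,j)\in\Delta$; so $\Delta$ is one of $\emptyset,\{(1,1)\},\{(1,2)\},\{(2,1)\},\{(1,2),(2,1)\},\{(2,2)\}$. The $G_d$-orbits are in bijection with $\Xi_{2,d}$: $(F,F',v)\in\mathcal{O}_{A,\Delta}$ iff there is a basis $\{e_{ijm}: 1\le i,j\le 2,\ 0<m\le a_{ij}\}$ of $\mathbb{F}_q^d$ such that $F_r=\langle e_{ijm}: i\le r\rangle$, $F'_s=\langle e_{ijm}: j\le s\rangle$ and $v=\sum_{(i,j)\in\Delta}e_{ij1}$. Let $T_{A,\Delta}$ be the characteristic function of $\mathcal{O}_{A,\Delta}$; these form a basis of $\mathcal{MU}_q(2,d)$. Generic algebra. The structure constants of $\mathcal{MU}_q(2,d)$ in the basis $T_{A,\Delta}$ are given by polynomials with integer coefficients (independent of $q$) evaluated at $q$. $MU_{\mathbf{v}}(2,d)$ is the $\mathbb{C}(\mathbf{v})$-algebra ($\mathbf{v}$ an indeterminate) with basis $\{T_{A,\Delta}:(A,\Delta)\in\Xi_{2,d}\}$ whose structure constants are these polynomials evaluated at $\mathbf{v}^2$. Elements. Let $E_{i,j}$ be the elementary $2\times2$ matrix with $1$ in position $(i,j)$ and zeros elsewhere, and $D(r,s)=\begin{pmatrix} r&0\\0&s\end{pmatrix}$. Put $e_r=T_{D(r,d-r-1)+E_{1,2},\emptyset}$ and $f_r=T_{D(r,d-r-1)+E_{2,1},\emptyset}$ for $0\le r\le d-1$; $1_r=T_{D(r,d-r),\emptyset}$ for $0\le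 r\le d$; $x_r=T_{D(r,d-r),\{(1,1)\}}$ for $1\le r\le d$. *)

theory Defs
  imports
    "Jordan_Normal_Form.Missing_VectorSpace"
    "HOL-Computational_Algebra.Fraction_Field"
    "HOL-Computational_Algebra.Polynomial"
begin

text \<open>A field is a HOL-Algebra ring record \<open>R\<close>; the space of column vectors is the function
  space \<open>{1..d} \<rightarrow>\<^sub>E carrier R\<close>.\<close>

definition vec_space :: "'a ring \<Rightarrow> nat \<Rightarrow> ('a, nat \<Rightarrow> 'a) module" where
  "vec_space R d = ring.func_space R {1..d}"

definition flags :: "'a ring \<Rightarrow> nat \<Rightarrow> (nat \<Rightarrow> (nat \<Rightarrow> 'a) set) set" where
  "flags R d = {F \<in> {0..2} \<rightarrow>\<^sub>E Pow (carrier (vec_space R d)).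
     (\<forall>r\<in>{0..2}. VectorSpace.subspace R (F r) (vec_space R d)) \<and>
     F 0 = {\<zero>\<^bsub>vec_space R d\<^esub>} \<and> F 0 \<subseteq> F 1 \<and> F 1 \<subseteq> F 2 \<and> F 2 = carrier (vec_space R d)}"

type_synonym 'a config =
  "(nat \<Rightarrow> (nat \<Rightarrow> 'a) set) \<times> (nat \<Rightarrow> (nat \<Rightarrow> 'a) set) \<times> (nat \<Rightarrow> 'a)"

definition configs :: "'a ring \<Rightarrow> nat \<Rightarrow> 'a config set" where
  "configs R d = flags R d \<times> flags R d \<times> carrier (vec_space R d)"

definition conv :: "'a ring \<Rightarrow> nat \<Rightarrow> ('a config \<Rightarrow> complex) \<Rightarrow> ('a config \<Rightarrow> complex)
    \<Rightarrow> 'a config \<Rightarrow> complex" where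
  "conv R d \<alpha> \<beta> = (\<lambda>(F, F', v). \<Sum>(H, u) \<in> flags R d \<times> carrier (vec_space R d).
     \<alpha> (F, H, u) * \<beta> (H, F', v \<ominus>\<^bsub>vec_space R d\<^esub> u))"

text \<open>Positions are numbered from 1. A \<open>2 \<times> 2\<close> matrix is a function vanishing outside the
  positions \<open>{1, 2} \<times> {1, 2}\<close>, so that distinct labels are distinct matrices.\<close>

type_synonym label = "(nat \<Rightarrow> nat \<Rightarrow> nat) \<times> (nat \<times> nat) set"

definition Xi :: "nat \<Rightarrow> label set" where
  "Xi d = {(A, \<Delta>).
     (\<forall>i j. A i j > 0 \<longrightarrow> i \<in> {1..2} \<and> j \<in> {1..2}) \<and>
     (\<Sum>i\<in>{1..2}. \<Sum>j\<in>{1..2}. A i j) = d \<and>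
     \<Delta> \<subseteq> {1..2} \<times> {1..2} \<and>
     (\<exists>ps. \<Delta> = set ps \<and> sorted_wrt (\<lambda>(i, j) (i', j'). i < i' \<and> j' < j) ps) \<and>
     (\<forall>(i, j) \<in> \<Delta>. A i j > 0)}"

definition basis_index :: "(nat \<Rightarrow> nat \<Rightarrow> nat) \<Rightarrow> (nat \<times> nat \<times> nat) set" where
  "basis_index A = {(i, j, m). i \<in> {1..2} \<and> j \<in> {1..2} \<and> 0 < m \<and> m \<le> A i j}"

definition orbit :: "'a ring \<Rightarrow> nat \<Rightarrow> label \<Rightarrow> 'a config set" where
  "orbit R d = (\<lambda>(A, \<Delta>). {(F, F', v) \<in> configs R d. \<exists>b :: nat \<times> nat \<times> nat \<Rightarrow> nat \<Rightarrow> 'a.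
     inj_on b (basis_index A) \<and>
     vectorspace.basis R (vec_space R d) (b ` basis_index A) \<and>
     (\<forall>r\<in>{0..2}. F r =
        LinearCombinations.module.span R (vec_space R d) (b ` {(i, j, m) \<in> basis_index A. i \<le> r})) \<and>
     (\<forall>s\<in>{0..2}. F' s =
        LinearCombinations.module.span R (vec_space R d) (b ` {(i, j, m) \<in> basis_index A. j \<le> s})) \<and>
     v = finsum (vec_space R d) (\<lambda>(i, j). b (i, j, 1)) \<Delta>})"

definition T_fin :: "'a ring \<Rightarrow> nat \<Rightarrow> label \<Rightarrow> 'a config \<Rightarrow> complex" where
  "T_fin R d x t = of_bool (t \<in> orbit R d x)"

text \<open>\<open>struct_poly d x y z\<close> is the integer polynomial whose value at \<open>q\<close> is the coefficient of
  \<open>T_z\<close> in \<open>T_x * T_y\<close> over the field with \<open>q\<close> elements, for all prime powers \<open>q\<close> at once.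
  Every finite field is isomorphic to one whose carrier is a set of natural numbers, so
  quantifying over \<open>R :: nat ring\<close> covers all of them. The orbits partition
  \<open>configs R d\<close> and there are infinitely many \<open>q\<close>, so the polynomials are unique.\<close>

definition struct_poly :: "nat \<Rightarrow> label \<Rightarrow> label \<Rightarrow> label \<Rightarrow> int poly" where
  "struct_poly d x y = (THE c. (\<forall>z. z \<notin> Xi d \<longrightarrow> c z = 0) \<and>
     (\<forall>R :: nat ring. field R \<and> finite (carrier R) \<longrightarrow>
       (\<forall>t \<in> configs R d. conv R d (T_fin R d x) (T_fin R d y) t =
          (\<Sum>z\<in>Xi d. of_int (poly (c z) (int (card (carrier R)))) * T_fin R d z t))))"

type_synonym ratfun = "complex poly fract"

definition vv :: ratfun where
  "vv = Fraction_Field.Fract [:0, 1:] 1"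

definition T :: "label \<Rightarrow> label \<Rightarrow> ratfun" where
  "T x = (\<lambda>z. of_bool (z = x))"

definition diag2 :: "nat \<Rightarrow> nat \<Rightarrow> nat \<Rightarrow> nat \<Rightarrow> nat" where
  "diag2 r s = (\<lambda>i j. if (i, j) = (1, 1) then r else if (i, j) = (2, 2) then s else 0)"

definition elem2 :: "nat \<Rightarrow> nat \<Rightarrow> nat \<Rightarrow> nat \<Rightarrow> nat" where
  "elem2 p q = (\<lambda>i j. of_bool ((i, j) = (p, q)))"

definition e_elt :: "nat \<Rightarrow> nat \<Rightarrow> label \<Rightarrow> ratfun" where
  "e_elt d r = T (\<lambda>i j. diag2 r (d - r - 1) i j + elem2 1 2 i j, {})"

definition f_elt :: "nat \<Rightarrow> nat \<Rightarrow> label \<Rightarrow> ratfun" where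
  "f_elt d r = T (\<lambda>i j. diag2 r (d - r - 1) i j + elem2 2 1 i j, {})"

definition one_elt :: "nat \<Rightarrow> nat \<Rightarrow> label \<Rightarrow> ratfun" where
  "one_elt d r = T (diag2 r (d - r), {})"

definition x_elt :: "nat \<Rightarrow> nat \<Rightarrow> label \<Rightarrow> ratfun" where
  "x_elt d r = T (diag2 r (d - r), {(1, 1)})"

text \<open>An element is its family of coordinates with respect to the basis \<open>T\<close>; all of
  \<open>ratfun\<close> acts by scalars. The identity is the sum of the orthogonal idempotents
  \<open>one_elt d r\<close>.\<close>

definition MU :: "nat \<Rightarrow> (ratfun, label \<Rightarrow> ratfun) module" where
  "MU d = \<lparr>carrier = {a. \<forall>z. z \<notin> Xi d \<longrightarrow> a z = 0},
     monoid.mult = (\<lambda>a b z. \<Sum>x\<in>Xi d. \<Sum>y\<in>Xi d.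
        a x * b y * poly (map_poly of_int (struct_poly d x y z)) (vv ^ 2)),
     one = (\<lambda>z. \<Sum>r\<in>{0..d}. one_elt d r z),
     zero = (\<lambda>z. 0),
     add = (\<lambda>a b z. a z + b z),
     module.smult = (\<lambda>c a z. c * a z)\<rparr>"

inductive_set generated_algebra :: "('k, 'm) module \<Rightarrow> 'm set \<Rightarrow> 'm set" for M X where
  generator: "a \<in> X \<Longrightarrow> a \<in> generated_algebra M X"
| one: "\<one>\<^bsub>M\<^esub> \<in> generated_algebra M X"
| add: "a \<in> generated_algebra M X \<Longrightarrow> b \<in> generated_algebra M X \<Longrightarrow>
    a \<oplus>\<^bsub>M\<^esub> b \<in> generated_algebra M X"
| smult: "a \<in> generated_algebra M X \<Longrightarrow> c \<odot>\<^bsub>M\<^esub> a \<in> generated_algebra M X"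
| mult: "a \<in> generated_algebra M X \<Longrightarrow> b \<in> generated_algebra M X \<Longrightarrow>
    a \<otimes>\<^bsub>M\<^esub> b \<in> generated_algebra M X"

definition e_gen :: "nat \<Rightarrow> label \<Rightarrow> ratfun" where
  "e_gen d z = (\<Sum>r\<in>{0..<d}. vv powi (- int r) * e_elt d r z)"

definition f_gen :: "nat \<Rightarrow> label \<Rightarrow> ratfun" where
  "f_gen d z = (\<Sum>r\<in>{0..<d}. vv powi (1 + int r - int d) * f_elt d r z)"

definition k_gen :: "nat \<Rightarrow> label \<Rightarrow> ratfun" where
  "k_gen d z = (\<Sum>r\<in>{0..d}. vv powi (2 * int r - int d) * one_elt d r z)"

definition k_inv_gen :: "nat \<Rightarrow> label \<Rightarrow> ratfun" where
  "k_inv_gen d z = (\<Sum>r\<in>{0..d}. vv powi (int d - 2 * int r) * one_elt d r z)"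

definition l_gen :: "nat \<Rightarrow> label \<Rightarrow> ratfun" where
  "l_gen d z = one_elt d 0 z +
     (\<Sum>r\<in>{1..d}. vv powi (- 2 * int r) * (one_elt d r z + x_elt d r z))"

end

theory Submission
  imports Defs "HOL-Number_Theory.Residues" "HOL-Algebra.QuotRing"
begin

text \<open>A point of the set on which the convolution algebra lives is a pair of subspaces \<open>U\<close>, \<open>W\<close>
  of \<open>\<F>\<^sub>q\<^sup>d\<close> with a vector \<open>v\<close>. Its label \<open>(A, \<Delta>)\<close> records the dimensions of \<open>U\<close>, \<open>W\<close>
  and \<open>U \<inter> W\<close> and, by \<open>\<Delta>\<close>, in which of the subspaces \<open>0\<close>, \<open>U\<close>, \<open>W\<close>, \<open>U + W\<close> the vector lies.
  Left convolution with \<open>f\<^sub>r\<close> sums over the subspaces that contain \<open>U\<close> as a hyperplane, with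
  \<open>e\<^sub>r\<close> over the hyperplanes of \<open>U\<close>, and with \<open>x\<^sub>r\<close> over the translates of \<open>v\<close> by the nonzero
  vectors of \<open>U\<close>. The coefficients of these products are numbers of subspaces or vectors in
  prescribed position, hence polynomials in \<open>q\<close> (\<open>card_up\<close>, \<open>card_down\<close>, \<open>card_shift\<close>).

  These coefficients show that the labels form a chain. Every \<open>T\<^bsub>z0\<^esub>\<close> that is not itself one of the
  elements \<open>e\<^sub>r\<close>, \<open>f\<^sub>r\<close>, \<open>1\<^sub>r\<close>, \<open>x\<^sub>r\<close> occurs, with a monic coefficient, in a product \<open>T\<^sub>g * T\<^sub>y\<close> of
  such an element \<open>T\<^sub>g\<close> with an earlier \<open>T\<^sub>y\<close>, all other terms of which are earlier as well
  (\<open>reachable_all\<close>). The order is: \<open>\<Delta> = {}\<close>, by induction on \<open>a\<^bsub>21\<^esub>\<close>, and for \<open>a\<^bsub>21\<^esub> = 0\<close> on \<open>a\<^bsub>12\<^esub>\<close>; then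
  \<open>{(1, 1)}\<close>, by induction on \<open>a\<^bsub>12\<^esub>\<close>; then \<open>{(1, 2)}\<close>, \<open>{(2, 1)}\<close>, \<open>{(1, 2), (2, 1)}\<close> and \<open>{(2, 2)}\<close>.

  The chain serves two purposes. The structure constants of \<open>MU d\<close> are defined as the unique
  polynomials that describe the convolution over all finite fields, so nothing can be said about
  products in \<open>MU d\<close> before such polynomials are known to exist for every pair of labels. For the
  left factors \<open>e\<^sub>r\<close>, \<open>f\<^sub>r\<close>, \<open>1\<^sub>r\<close>, \<open>x\<^sub>r\<close> they come from the counting, and associativity of convolution
  carries existence along the chain. Each step divides by the coefficient of the new label, which
  leaves a polynomial because that coefficient is monic and the quotient takes integer values at
  all primes (\<open>left_polynomial_step\<close>, \<open>monic_dvd_of_values\<close>).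
  Secondly, the same products in \<open>MU d\<close> express every \<open>T\<^bsub>z0\<^esub>\<close> through \<open>e\<^sub>r\<close>, \<open>f\<^sub>r\<close>, \<open>1\<^sub>r\<close>, \<open>x\<^sub>r\<close>, since
  the coefficient of the new label does not vanish in the field of rational functions
  (\<open>GA_reachable\<close>).

  It remains to find \<open>e\<^sub>r\<close>, \<open>f\<^sub>r\<close>, \<open>1\<^sub>r\<close>, \<open>x\<^sub>r\<close> in the subalgebra generated by \<open>e\<close>, \<open>f\<close>, \<open>k\<close>, \<open>k\<^sup>-\<^sup>1\<close>,
  \<open>\<ell>\<close>. The scalars by which \<open>k\<close> acts on the idempotents \<open>1\<^sub>r\<close> are distinct, so each \<open>1\<^sub>r\<close> is a
  polynomial in \<open>k\<close> (\<open>GA_idem\<close>), and left multiplication by \<open>1\<^sub>r\<close> cuts \<open>e\<close>, \<open>f\<close> and \<open>\<ell>\<close> into their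
  homogeneous parts (\<open>GA_row\<close>).\<close>

section \<open>Dimension by counting in a finite vector space\<close>

text \<open>All counts of the proof take place in a vector space with finitely many vectors. There the
  dimension of a subspace can be read off from its number of elements, and the dimension formula
  is a statement about cardinalities.\<close>

locale finite_vspace = vectorspace K V
  for K :: "('k, 'x) ring_scheme" and V :: "('k, 'v, 'y) module_scheme" (structure) +
  assumes finite_scalars: "finite (carrier K)"
    and finite_vectors: "finite (carrier V)"
begin

abbreviation q :: nat where "q \<equiv> card (carrier K)"
abbreviation sub :: "'v set \<Rightarrow> bool" where "sub S \<equiv> VectorSpace.subspace K S V"
abbreviation plus_sub :: "'v set \<Rightarrow> 'v set \<Rightarrow> 'v set" (infixl "\<boxplus>" 65)
  where "U \<boxplus> W \<equiv> subspace_sum U W"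

lemma q_ge_2: "2 \<le> q"
proof -
  have "{\<zero>\<^bsub>K\<^esub>, \<one>\<^bsub>K\<^esub>} \<subseteq> carrier K" by auto
  then have "card {\<zero>\<^bsub>K\<^esub>, \<one>\<^bsub>K\<^esub>} \<le> q" using finite_scalars by (rule card_mono[rotated])
  then show ?thesis using zero_not_one by auto
qed

lemma sub_iff: "sub S \<longleftrightarrow> S \<subseteq> carrier V \<and> \<zero> \<in> S \<and> (\<forall>x\<in>S. \<forall>y\<in>S. x \<oplus> y \<in> S)
    \<and> (\<forall>c\<in>carrier K. \<forall>x\<in>S. c \<odot> x \<in> S)"
proof -
  have "vectorspace K V" "Module.module K V" by unfold_locales
  then show ?thesis unfolding VectorSpace.subspace_def submodule_def by blast
qed

lemma sub_carrier: "sub S \<Longrightarrow> S \<subseteq> carrier V" by (simp add: sub_iff)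
lemma sub_mem: "sub S \<Longrightarrow> x \<in> S \<Longrightarrow> x \<in> carrier V" by (auto simp: sub_iff)
lemma sub_zero: "sub S \<Longrightarrow> \<zero> \<in> S" by (simp add: sub_iff)
lemma sub_add: "sub S \<Longrightarrow> x \<in> S \<Longrightarrow> y \<in> S \<Longrightarrow> x \<oplus> y \<in> S" by (simp add: sub_iff)
lemma sub_neg: assumes "sub S" "x \<in> S" shows "\<ominus> x \<in> S"
proof -
  have "\<ominus> x = (\<ominus>\<^bsub>K\<^esub> \<one>\<^bsub>K\<^esub>) \<odot> x" using assms sub_mem smult_minus_1_back by blast
  then show ?thesis using assms by (auto simp: sub_iff)
qed
lemma sub_diff: "sub S \<Longrightarrow> x \<in> S \<Longrightarrow> y \<in> S \<Longrightarrow> x \<ominus> y \<in> S"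
  by (simp add: a_minus_def sub_add sub_neg)

lemma sub_add_iff:
  assumes "sub S" "x \<in> S" "y \<in> carrier V" shows "x \<oplus> y \<in> S \<longleftrightarrow> y \<in> S"
proof
  assume "x \<oplus> y \<in> S"
  then have "\<ominus> x \<oplus> (x \<oplus> y) \<in> S" using assms sub_add sub_neg by metis
  then show "y \<in> S" using assms sub_mem[OF assms(1,2)] by (metis M.r_neg1)
qed (use assms sub_add in auto)

lemma sub_diff_iff:
  assumes "sub S" "y \<in> S" "x \<in> carrier V" shows "x \<ominus> y \<in> S \<longleftrightarrow> x \<in> S"
  using sub_add_iff[OF assms(1) sub_neg[OF assms(1,2)] assms(3)] assms sub_mem
  by (simp add: a_minus_def M.a_comm)

lemma sub_Int: "sub S \<Longrightarrow> sub Y \<Longrightarrow> sub (S \<inter> Y)" by (auto simp: sub_iff)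
lemma sub_sum: "sub S \<Longrightarrow> sub Y \<Longrightarrow> sub (S \<boxplus> Y)" by (rule sum_is_subspace)
lemma sub_top: "sub (carrier V)" by (auto simp: sub_iff)
lemma sub_bot: "sub {\<zero>}" by (auto simp: sub_iff)
lemma sub_span: "S \<subseteq> carrier V \<Longrightarrow> sub (span S)" by (rule span_is_subspace)
lemma sub_finite: "sub S \<Longrightarrow> finite S" using finite_vectors finite_subset sub_carrier by blast
lemma sum_iff: "x \<in> S \<boxplus> Y \<longleftrightarrow> (\<exists>u\<in>S. \<exists>w\<in>Y. x = u \<oplus> w)"
  by (auto simp: submodule_sum_def)
lemma sum_upper1: "sub S \<Longrightarrow> sub Y \<Longrightarrow> S \<subseteq> S \<boxplus> Y" by (rule in_sum_vs)
lemma sum_upper2: "sub S \<Longrightarrow> sub Y \<Longrightarrow> Y \<subseteq> S \<boxplus> Y" using vsum_comm in_sum_vs by metis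
lemma sum_least: "sub S \<Longrightarrow> sub Y \<Longrightarrow> sub X \<Longrightarrow> S \<subseteq> X \<Longrightarrow> Y \<subseteq> X \<Longrightarrow> S \<boxplus> Y \<subseteq> X"
  by (simp add: vsum_is_minimal)
lemma span_least: "S \<subseteq> X \<Longrightarrow> sub X \<Longrightarrow> span S \<subseteq> X"
  by (rule span_is_subset) (auto simp: VectorSpace.subspace_def)

lemma card_span_indpt:
  assumes fin: "finite A" and A: "A \<subseteq> carrier V" and li: "lin_indpt A"
  shows "card (span A) = q ^ card A"
proof -
  have smA: "submodule K (span A) V" using A by (rule span_is_submodule)
  have AS: "A \<subseteq> span A" using A by (rule in_own_span)
  interpret S: vectorspace K "vs (span A)" by (rule subspace_is_vs[OF sub_span[OF A]])
  have sp: "S.span A = span A" and ld: "S.lin_dep A = lin_dep A"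
    by (rule span_li_not_depend[OF AS smA])+
  have "S.basis A"
    unfolding S.basis_def ld sp using li AS by (simp only: carrier_vs_is_self not_False_eq_True simp_thms)
  then have *: "\<exists>!a. a \<in> A \<rightarrow>\<^sub>E carrier K \<and> S.lincomb a A = v" if "v \<in> span A" for v
    using S.basis_criterion[of A] fin AS that by auto
  have "bij_betw (\<lambda>a. S.lincomb a A) (A \<rightarrow>\<^sub>E carrier K) (span A)"
  proof (rule bij_betwI')
    fix x y assume "x \<in> A \<rightarrow>\<^sub>E carrier K" and "y \<in> A \<rightarrow>\<^sub>E carrier K"
    then have xs: "S.lincomb x A \<in> span A" using AS S.lincomb_closed[of A x] by (simp add: PiE_def)
    show "(S.lincomb x A = S.lincomb y A) = (x = y)"
      using *[OF xs] \<open>x \<in> _\<close> \<open>y \<in> _\<close> by metis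
  next
    fix x assume "x \<in> A \<rightarrow>\<^sub>E carrier K"
    then show "S.lincomb x A \<in> span A" using AS S.lincomb_closed[of A x] by (simp add: PiE_def)
  next
    fix v assume "v \<in> span A"
    then show "\<exists>a\<in>A \<rightarrow>\<^sub>E carrier K. v = S.lincomb a A" using * by blast
  qed
  then show ?thesis using fin by (simp add: bij_betw_same_card[symmetric] card_PiE)
qed

text \<open>An independent set that is maximal among those between \<open>A\<close> and \<open>S\<close> spans \<open>S\<close>.\<close>
lemma extend_basis:
  assumes "sub S" "A \<subseteq> S" "lin_indpt A"
  obtains B where "A \<subseteq> B" "B \<subseteq> S" "lin_indpt B" "span B = S"
proof -
  define X where "X = {B. A \<subseteq> B \<and> B \<subseteq> S \<and> lin_indpt B}"
  have "X \<subseteq> Pow S" unfolding X_def by blast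
  then have "finite X" using sub_finite[OF assms(1)] finite_subset finite_Pow_iff by metis
  moreover have "A \<in> X" unfolding X_def using assms by blast
  ultimately obtain B where BX: "B \<in> X" and max: "\<forall>C\<in>X. B \<le> C \<longrightarrow> B = C"
    using finite_has_maximal2 by metis
  have B: "A \<subseteq> B" "B \<subseteq> S" "lin_indpt B" using BX unfolding X_def by blast+
  have BV: "B \<subseteq> carrier V" using B(2) sub_carrier[OF assms(1)] by blast
  have "x \<in> span B" if x: "x \<in> S" for x
  proof (rule ccontr)
    assume n: "x \<notin> span B"
    then have xB: "x \<notin> B" using in_own_span[OF BV] by auto
    have "lin_indpt (B \<union> {x})"
      using lin_dep_iff_in_span[OF BV B(3) sub_mem[OF assms(1) x] xB] n by blast
    then have "B \<union> {x} \<in> X" using B x unfolding X_def by blast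
    then show False using max xB by blast
  qed
  then have "span B = S" using span_least[OF B(2) assms(1)] by blast
  then show ?thesis using that B by blast
qed

lemma card_power: assumes "sub S" shows "\<exists>n. card S = q ^ n"
proof -
  have "lin_indpt {}" by (auto simp: lin_dep_def)
  then obtain B where B: "B \<subseteq> S" "lin_indpt B" "span B = S"
    using extend_basis[OF assms, of "{}"] by auto
  then show ?thesis using card_span_indpt[of B] finite_subset[OF B(1) sub_finite[OF assms]]
      sub_carrier[OF assms] by auto
qed

text \<open>The dimension of a subspace. It is defined for arbitrary sets, so that no ambient module
  record has to be changed when it is applied to different subspaces.\<close>
definition vd :: "'v set \<Rightarrow> nat" where "vd S = (THE n. card S = q ^ n)"

lemma vd_eqI: "card S = q ^ n \<Longrightarrow> vd S = n"
  unfolding vd_def using q_ge_2 by (auto intro!: the_equality simp: power_inject_exp)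

lemma card_vd: "sub S \<Longrightarrow> card S = q ^ vd S"
  using card_power vd_eqI by metis

lemma vd_span: "finite A \<Longrightarrow> A \<subseteq> carrier V \<Longrightarrow> lin_indpt A \<Longrightarrow> vd (span A) = card A"
  by (rule vd_eqI) (rule card_span_indpt)

lemma vd_bot: "vd {\<zero>} = 0" by (rule vd_eqI) simp

lemma vd_mono: assumes "sub S" "sub Y" "S \<subseteq> Y" shows "vd S \<le> vd Y"
  using card_mono[OF sub_finite[OF assms(2)] assms(3)] assms q_ge_2
  by (simp add: card_vd power_increasing_iff)

lemma vd_eq: assumes "sub S" "sub Y" "S \<subseteq> Y" "vd Y \<le> vd S" shows "S = Y"
proof -
  have "vd S = vd Y" using vd_mono assms by (simp add: le_antisym)
  then show ?thesis using card_subset_eq[OF sub_finite[OF assms(2)] assms(3)] assms by (simp add: card_vd)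
qed

lemma vd_less: assumes "sub S" "sub Y" "S \<subseteq> Y" "x \<in> Y" "x \<notin> S" shows "vd S < vd Y"
  using vd_eq[OF assms(1-3)] assms(4,5) leI by blast

lemma add_diff_cancel_left:
  assumes "x \<in> carrier V" "y \<in> carrier V" "z \<in> carrier V"
  shows "(x \<oplus> y) \<ominus> (x \<oplus> z) = y \<ominus> z"
  using assms by (simp add: a_minus_def M.minus_add M.a_comm[of x y] M.a_assoc M.r_neg2)

lemma add_diff_same: "x \<in> carrier V \<Longrightarrow> y \<in> carrier V \<Longrightarrow> x \<oplus> (y \<ominus> x) = y"
  by (simp add: a_minus_def M.a_comm[of y] M.r_neg2)

lemma add_left_cancel_diff: "x \<in> carrier V \<Longrightarrow> y \<in> carrier V \<Longrightarrow> (x \<oplus> y) \<ominus> x = y"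
  by (simp add: a_minus_def M.a_comm[of x y] M.a_assoc M.r_neg)

lemma card_translate: "x \<in> carrier V \<Longrightarrow> S \<subseteq> carrier V \<Longrightarrow> card ((\<lambda>y. x \<oplus> y) ` S) = card S"
  by (rule card_image, rule inj_onI) (metis add_left_cancel_diff subsetD)

text \<open>The fibre of \<open>(u, w) \<mapsto> u + w\<close> over \<open>v\<close> is a coset of \<open>U \<inter> W\<close>. This gives the dimension formula
  \<open>card_sum_Int\<close>, and later it counts the translates of \<open>v\<close> by \<open>U\<close> that fall into \<open>W\<close>.\<close>
lemma card_fibre:
  assumes U: "sub U" and W: "sub W" and v: "v \<in> U \<boxplus> W"
  shows "card {u \<in> U. v \<ominus> u \<in> W} = card (U \<inter> W)"
proof -
  obtain u w where uw: "u \<in> U" "w \<in> W" "v = u \<oplus> w" using v unfolding sum_iff by blast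
  have uV: "u \<in> carrier V" and wV: "w \<in> carrier V" using uw U W sub_mem by auto
  have "{u \<in> U. v \<ominus> u \<in> W} = (\<lambda>x. u \<oplus> x) ` (U \<inter> W)"
  proof (intro equalityI subsetI)
    fix a assume "a \<in> {u \<in> U. v \<ominus> u \<in> W}"
    then have a: "a \<in> U" "v \<ominus> a \<in> W" by auto
    let ?x = "a \<ominus> u"
    have aV: "a \<in> carrier V" using a U sub_mem by auto
    have xU: "?x \<in> U" using a uw U sub_diff by auto
    have ax: "u \<oplus> ?x = a" using uV aV by (rule add_diff_same)
    have xV: "?x \<in> carrier V" using xU U sub_mem by auto
    have "w \<ominus> ?x \<in> W" using a(2) uw add_diff_cancel_left[OF uV wV xV] ax by simp
    then have "\<ominus> ?x \<in> W"
      using sub_add_iff[OF W uw(2), of "\<ominus> ?x"] xV by (simp add: a_minus_def)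
    then have "?x \<in> W" using sub_neg[OF W] xV by (metis M.minus_minus)
    then show "a \<in> (\<lambda>x. u \<oplus> x) ` (U \<inter> W)" using xU ax by (metis IntI imageI)
  next
    fix a assume "a \<in> (\<lambda>x. u \<oplus> x) ` (U \<inter> W)"
    then obtain x where x: "x \<in> U" "x \<in> W" "a = u \<oplus> x" by auto
    then have "x \<in> carrier V" using U sub_mem by auto
    then show "a \<in> {u \<in> U. v \<ominus> u \<in> W}"
      using x uw U W add_diff_cancel_left[OF uV wV] by (auto simp: sub_add sub_diff)
  qed
  moreover have "U \<inter> W \<subseteq> carrier V" using sub_carrier[OF U] by blast
  ultimately show ?thesis using card_translate[OF uV] by metis
qed

lemma card_sum_Int:
  assumes U: "sub U" and W: "sub W"
  shows "card (U \<boxplus> W) * card (U \<inter> W) = card U * card W"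
proof -
  have 1: "card {s \<in> U \<boxplus> W. s \<ominus> a \<in> W} = card W" if a: "a \<in> U" for a
  proof -
    have aV: "a \<in> carrier V" using a U sub_mem by auto
    have "{s \<in> U \<boxplus> W. s \<ominus> a \<in> W} = (\<lambda>w. a \<oplus> w) ` W"
    proof (intro equalityI subsetI)
      fix s assume s: "s \<in> {s \<in> U \<boxplus> W. s \<ominus> a \<in> W}"
      then have "s \<in> carrier V" using sub_mem[OF sub_sum[OF U W]] by auto
      then have "s = a \<oplus> (s \<ominus> a)" using add_diff_same[OF aV] by simp
      moreover have "s \<ominus> a \<in> W" using s by blast
      ultimately show "s \<in> (\<lambda>w. a \<oplus> w) ` W" by (rule image_eqI)
    next
      fix s assume "s \<in> (\<lambda>w. a \<oplus> w) ` W"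
      then obtain w where w: "w \<in> W" "s = a \<oplus> w" by blast
      have "s \<ominus> a = w" using add_left_cancel_diff[OF aV sub_mem[OF W w(1)]] w(2) by simp
      moreover have "s \<in> U \<boxplus> W" using a w unfolding sum_iff by blast
      ultimately show "s \<in> {s \<in> U \<boxplus> W. s \<ominus> a \<in> W}"
        using w(1) by simp
    qed
    then show ?thesis using card_translate[OF aV sub_carrier[OF W]] by simp
  qed
  have "(\<Sum>s\<in>U \<boxplus> W. card {a \<in> U. s \<ominus> a \<in> W}) = (\<Sum>a\<in>U. card {s \<in> U \<boxplus> W. s \<ominus> a \<in> W})"
    using sub_finite[OF U] sub_finite[OF sub_sum[OF U W]] by (intro sum_multicount_gen) auto
  moreover have "(\<Sum>s\<in>U \<boxplus> W. card {a \<in> U. s \<ominus> a \<in> W}) = card (U \<boxplus> W) * card (U \<inter> W)"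
    using card_fibre[OF U W] by simp
  moreover have "(\<Sum>a\<in>U. card {s \<in> U \<boxplus> W. s \<ominus> a \<in> W}) = card U * card W"
    using 1 by simp
  ultimately show ?thesis by simp
qed

lemma vd_sum_Int:
  assumes "sub U" "sub W" shows "vd (U \<boxplus> W) + vd (U \<inter> W) = vd U + vd W"
proof -
  have "q ^ (vd (U \<boxplus> W) + vd (U \<inter> W)) = q ^ (vd U + vd W)"
    using card_sum_Int[OF assms] assms by (simp add: card_vd sub_sum sub_Int power_add)
  then show ?thesis using q_ge_2 by (simp add: power_inject_exp)
qed

lemma sub_line: "x \<in> carrier V \<Longrightarrow> sub (span {x})" by (rule sub_span) simp

lemma line_least: "sub S \<Longrightarrow> x \<in> S \<Longrightarrow> span {x} \<subseteq> S" by (rule span_least) auto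

lemma vd_line: assumes "x \<in> carrier V" "x \<noteq> \<zero>" shows "vd (span {x}) = 1"
proof -
  have "lin_indpt {}" by (auto simp: lin_dep_def)
  then have "lin_indpt ({} \<union> {x})"
    using lin_dep_iff_in_span[of "{}" x] assms span_empty by auto
  then show ?thesis using vd_span[of "{x}"] assms by simp
qed

lemma vd_adjoin:
  assumes "sub U" "x \<in> carrier V" "x \<notin> U" shows "vd (U \<boxplus> span {x}) = vd U + 1"
proof -
  have x0: "x \<noteq> \<zero>" using assms sub_zero by auto
  have "vd (U \<inter> span {x}) < vd (span {x})"
    by (rule vd_less[OF sub_Int sub_line _ span_self]) (use assms sub_line in auto)
  then show ?thesis using vd_sum_Int[of U "span {x}"] assms sub_line vd_line[OF _ x0] by auto
qed

lemma adjoin_mem: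
  assumes "sub U" "x \<in> carrier V" shows "x \<in> U \<boxplus> span {x}"
proof -
  have "span {x} \<subseteq> U \<boxplus> span {x}" using assms(1) sub_line[OF assms(2)] by (rule sum_upper2)
  then show ?thesis using span_self[OF assms(2)] by blast
qed

lemma adjoin_subset_iff:
  assumes "sub U" "x \<in> carrier V" "sub H"
  shows "U \<boxplus> span {x} \<subseteq> H \<longleftrightarrow> U \<subseteq> H \<and> x \<in> H"
proof -
  have l: "sub (span {x})" using assms(2) by (rule sub_line)
  have "span {x} \<subseteq> H \<longleftrightarrow> x \<in> H"
    using line_least[OF assms(3)] span_self[OF assms(2)] by blast
  then show ?thesis using vsum_is_minimal[OF assms(1) l assms(3)] by blast
qed

end

section \<open>Counting lines and hyperplanes\<close>

text \<open>The \<open>q\<close>-number \<open>[n] = 1 + x + \<dots> + x\<^sup>n\<^sup>-\<^sup>1\<close>, over an arbitrary semiring: it is used for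
  natural numbers and integers \<open>x = q\<close> and for the polynomial variable.\<close>
definition qnum :: "'a::comm_semiring_1 \<Rightarrow> nat \<Rightarrow> 'a" where
  "qnum x n = (\<Sum>i<n. x ^ i)"

lemma qnum_0 [simp]: "qnum x 0 = 0" by (simp add: qnum_def)
lemma qnum_Suc: "qnum x (Suc n) = qnum x n + x ^ n" by (simp add: qnum_def)
lemma qnum_geometric:
  "qnum x n * x ^ Suc m + x ^ m = x ^ (m + n) + qnum x n * (x ^ m)"
proof (induction n)
  case (Suc n)
  have "qnum x (Suc n) * x ^ Suc m + x ^ m = (qnum x n * x ^ Suc m + x ^ m) + x ^ n * x ^ Suc m"
    by (simp add: qnum_Suc algebra_simps)
  also have "\<dots> = x ^ (m + Suc n) + qnum x (Suc n) * x ^ m"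
    unfolding Suc by (simp add: qnum_Suc algebra_simps power_add)
  finally show ?case .
qed simp
lemma qnum_pos: "0 < n \<Longrightarrow> 0 < qnum (x::nat) n"
  by (cases n) (auto simp: qnum_def lessThan_Suc_eq_insert_0 sum.insert)
lemma int_qnum: "int (qnum n m) = qnum (int n) m" by (simp add: qnum_def)

lemma int_card_Diff:
  "A \<subseteq> B \<Longrightarrow> finite B \<Longrightarrow> int (card (B - A)) = int (card B) - int (card A)"
  by (simp add: card_Diff_subset card_mono finite_subset of_nat_diff)

context finite_vspace
begin

text \<open>The members of \<open>lines U S\<close> are the lines of the quotient space \<open>S / U\<close>, those of
  \<open>hyps J U\<close> are the hyperplanes of \<open>U\<close> that contain \<open>J\<close>.\<close>
definition lines :: "'v set \<Rightarrow> 'v set \<Rightarrow> 'v set set" where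
  "lines U S = {H. sub H \<and> U \<subseteq> H \<and> H \<subseteq> S \<and> vd H = vd U + 1}"

definition hyps :: "'v set \<Rightarrow> 'v set \<Rightarrow> 'v set set" where
  "hyps J U = {H. sub H \<and> J \<subseteq> H \<and> H \<subseteq> U \<and> vd H + 1 = vd U}"

lemma finite_lines: "sub S \<Longrightarrow> finite (lines U S)"
  by (rule finite_subset[of _ "Pow S"]) (use sub_finite in \<open>auto simp: lines_def\<close>)

lemma finite_hyps: "sub U \<Longrightarrow> finite (hyps J U)"
  by (rule finite_subset[of _ "Pow U"]) (use sub_finite in \<open>auto simp: hyps_def\<close>)

lemma sub_adjoin: "sub U \<Longrightarrow> x \<in> carrier V \<Longrightarrow> sub (U \<boxplus> span {x})"
  by (rule sub_sum[OF _ sub_line])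

lemma adjoin_upper: "sub U \<Longrightarrow> x \<in> carrier V \<Longrightarrow> U \<subseteq> U \<boxplus> span {x}"
  by (rule sum_upper1[OF _ sub_line])

lemma line_unique:
  assumes U: "sub U" and x: "x \<in> carrier V" "x \<notin> U" and H: "sub H" "U \<subseteq> H" "x \<in> H" "vd H = vd U + 1"
  shows "U \<boxplus> span {x} = H"
proof (rule vd_eq[OF sub_adjoin[OF U x(1)] H(1)])
  show "U \<boxplus> span {x} \<subseteq> H" using adjoin_subset_iff[OF U x(1) H(1)] H by blast
  show "vd H \<le> vd (U \<boxplus> span {x})" using vd_adjoin[OF U x] H(4) by simp
qed

lemma lines_through:
  assumes U: "sub U" and S: "sub S" "U \<subseteq> S" and x: "x \<in> S" "x \<notin> U"
  shows "{H \<in> lines U S. x \<in> H} = {U \<boxplus> span {x}}"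
proof -
  have xV: "x \<in> carrier V" using sub_mem[OF S(1) x(1)] .
  have "U \<boxplus> span {x} \<in> {H \<in> lines U S. x \<in> H}"
    unfolding lines_def
    using sub_adjoin[OF U xV] adjoin_upper[OF U xV] adjoin_subset_iff[OF U xV S(1)] S(2) x(1)
      vd_adjoin[OF U xV x(2)] adjoin_mem[OF U xV] by simp
  moreover have "H = U \<boxplus> span {x}" if "H \<in> {H \<in> lines U S. x \<in> H}" for H
    using line_unique[OF U xV x(2), of H] that unfolding lines_def by simp
  ultimately show ?thesis by blast
qed

text \<open>Each vector of \<open>S - U\<close> lies in exactly one line, and each line contributes
  \<open>q\<^sup>m\<^sup>+\<^sup>1 - q\<^sup>m\<close> of them, where \<open>m\<close> is the dimension of \<open>U\<close>.\<close>
lemma card_lines: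
  assumes U: "sub U" and S: "sub S" "U \<subseteq> S"
  shows "card (lines U S) = qnum q (vd S - vd U)"
proof -
  let ?m = "vd U" and ?n = "vd S - vd U"
  have mn: "vd S = ?m + ?n" using vd_mono[OF U S] by simp
  have "(\<Sum>H\<in>lines U S. card {x \<in> S - U. x \<in> H}) = (\<Sum>x\<in>S - U. card {H \<in> lines U S. x \<in> H})"
    using finite_lines[OF S(1)] sub_finite[OF S(1)] by (intro sum_multicount_gen) simp_all
  moreover have "card {x \<in> S - U. x \<in> H} = q ^ Suc ?m - q ^ ?m" if H: "H \<in> lines U S" for H
  proof -
    have sH: "sub H" "U \<subseteq> H" "H \<subseteq> S" "vd H = ?m + 1" using H unfolding lines_def by auto
    have "{x \<in> S - U. x \<in> H} = H - U" using sH(3) by blast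
    then show ?thesis
      using card_Diff_subset[OF sub_finite[OF U] sH(2)] card_vd[OF U] card_vd[OF sH(1)] sH(4) by simp
  qed
  moreover have "card {H \<in> lines U S. x \<in> H} = 1" if "x \<in> S - U" for x
    using lines_through[OF U S] that by simp
  moreover have "card (S - U) = q ^ (?m + ?n) - q ^ ?m"
    using card_Diff_subset[OF sub_finite[OF U] S(2)] card_vd[OF U] card_vd[OF S(1)] mn by simp
  ultimately have e: "card (lines U S) * (q ^ Suc ?m - q ^ ?m) = q ^ (?m + ?n) - q ^ ?m"
    by simp
  have "qnum q ?n * (q ^ Suc ?m - q ^ ?m) = q ^ (?m + ?n) - q ^ ?m"
    using qnum_geometric[of q ?n ?m] by (simp add: diff_mult_distrib2)
  moreover have "q ^ ?m < q ^ Suc ?m" using q_ge_2 by simp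
  then have "q ^ Suc ?m - q ^ ?m \<noteq> 0" by simp
  ultimately show ?thesis using e by (metis mult_cancel2)
qed

lemma card_lines_through:
  assumes U: "sub U" and S: "sub S" "U \<subseteq> S" and x: "x \<in> carrier V"
  shows "card {H \<in> lines U S. x \<in> H} = (if x \<in> U then qnum q (vd S - vd U) else if x \<in> S then 1 else 0)"
proof (cases "x \<in> U")
  case True
  then have "{H \<in> lines U S. x \<in> H} = lines U S" unfolding lines_def by blast
  then show ?thesis using True card_lines[OF U S] by simp
next
  case False
  show ?thesis
  proof (cases "x \<in> S")
    case True
    then show ?thesis using False lines_through[OF U S True False] by simp
  next
    case xS: False
    then have "{H \<in> lines U S. x \<in> H} = {}" unfolding lines_def by blast
    then have "card {H \<in> lines U S. x \<in> H} = 0" by (simp only: card.empty)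
    then show ?thesis using False xS by simp
  qed
qed

text \<open>Induction on the codimension \<open>n + 1\<close> of \<open>J\<close>, by counting pairs of a line \<open>L\<close> over \<open>J\<close> and a
  hyperplane \<open>H\<close> that contains it: each \<open>H\<close> contains \<open>[n]\<close> lines, and each of the \<open>[n + 1]\<close> lines
  lies in \<open>[n]\<close> hyperplanes.\<close>
lemma card_hyps:
  assumes U: "sub U" and J: "sub J" "J \<subseteq> U"
  shows "card (hyps J U) = qnum q (vd U - vd J)"
proof -
  have "\<forall>J. sub J \<longrightarrow> J \<subseteq> U \<longrightarrow> vd U = vd J + n \<longrightarrow> card (hyps J U) = qnum q n" for n
  proof (induction n)
    case 0
    have "hyps J U = {}" if "sub J" "vd U = vd J" for J
      using vd_mono[OF that(1)] that(2) unfolding hyps_def by fastforce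
    then show ?case by simp
  next
    case (Suc n)
    show ?case
    proof (intro allI impI)
      fix J assume J: "sub J" "J \<subseteq> U" "vd U = vd J + Suc n"
      show "card (hyps J U) = qnum q (Suc n)"
      proof (cases "n = 0")
        case True
        have "H = J" if "H \<in> hyps J U" for H
          using vd_eq[OF J(1), of H] that J(3) True unfolding hyps_def by auto
        moreover have "J \<in> hyps J U" using J True unfolding hyps_def by simp
        ultimately have "hyps J U = {J}" by blast
        then show ?thesis using True by (simp add: qnum_Suc)
      next
        case False
        have "(\<Sum>H\<in>hyps J U. card {L \<in> lines J U. L \<subseteq> H}) = (\<Sum>L\<in>lines J U. card {H \<in> hyps J U. L \<subseteq> H})"
          using finite_lines[OF U] finite_hyps[OF U] by (intro sum_multicount_gen) simp_all
        moreover have "card {L \<in> lines J U. L \<subseteq> H} = qnum q n" if H: "H \<in> hyps J U" for H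
        proof -
          have "{L \<in> lines J U. L \<subseteq> H} = lines J H" using H unfolding lines_def hyps_def by blast
          then show ?thesis using card_lines[OF J(1), of H] H J(3) unfolding hyps_def by simp
        qed
        moreover have "card {H \<in> hyps J U. L \<subseteq> H} = qnum q n" if L: "L \<in> lines J U" for L
        proof -
          have "{H \<in> hyps J U. L \<subseteq> H} = hyps L U" using L unfolding lines_def hyps_def by blast
          then show ?thesis using Suc.IH L J(3) unfolding lines_def by simp
        qed
        moreover have "card (lines J U) = qnum q (Suc n)" using card_lines[OF J(1) U J(2)] J(3) by simp
        ultimately have "card (hyps J U) * qnum q n = qnum q (Suc n) * qnum q n" by simp
        then show ?thesis using qnum_pos[of n q] False by simp
      qed
    qed
  qed
  then show ?thesis using J vd_mono[OF J(1) U J(2)] by simp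
qed

lemma card_hyps_through:
  assumes U: "sub U" and J: "sub J" "J \<subseteq> U" and x: "x \<in> carrier V"
  shows "card {H \<in> hyps J U. x \<in> H} = (if x \<notin> U then 0 else if x \<in> J then qnum q (vd U - vd J)
           else qnum q (vd U - vd J - 1))"
proof -
  consider "x \<notin> U" | "x \<in> J" | "x \<in> U" "x \<notin> J" by blast
  then show ?thesis
  proof cases
    case 1
    then have "{H \<in> hyps J U. x \<in> H} = {}" unfolding hyps_def by blast
    then have "card {H \<in> hyps J U. x \<in> H} = 0" by (simp only: card.empty)
    then show ?thesis using 1 by simp
  next
    case 2
    then have "{H \<in> hyps J U. x \<in> H} = hyps J U" unfolding hyps_def by blast
    then show ?thesis using 2 J(2) card_hyps[OF U J] by auto
  next
    case 3
    have "{H \<in> hyps J U. x \<in> H} = hyps (J \<boxplus> span {x}) U"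
      unfolding hyps_def using adjoin_subset_iff[OF J(1) x] by blast
    moreover have "J \<boxplus> span {x} \<subseteq> U" using adjoin_subset_iff[OF J(1) x U] J 3 by blast
    ultimately show ?thesis
      using 3 card_hyps[OF U sub_adjoin[OF J(1) x]] vd_adjoin[OF J(1) x 3(2)] by simp
  qed
qed

text \<open>Convolution with \<open>f\<^sub>r\<close> sums over \<open>ups\<close>, convolution with \<open>e\<^sub>r\<close> over \<open>downs\<close>. The number
  \<open>n\<close> prescribes the dimension of the intersection with the second subspace \<open>W\<close>. Only two
  values of \<open>n\<close> occur in each case; they are told apart by whether \<open>H\<close> lies in \<open>U + W\<close>,
  respectively contains \<open>U \<inter> W\<close>.\<close>
definition ups :: "'v set \<Rightarrow> 'v set \<Rightarrow> nat \<Rightarrow> 'v set set" where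
  "ups U W n = {H. sub H \<and> U \<subseteq> H \<and> vd H = vd U + 1 \<and> vd (H \<inter> W) = n}"

definition downs :: "'v set \<Rightarrow> 'v set \<Rightarrow> nat \<Rightarrow> 'v set set" where
  "downs U W n = {H. sub H \<and> H \<subseteq> U \<and> vd H + 1 = vd U \<and> vd (H \<inter> W) = n}"

lemma line_inside:
  assumes U: "sub U" and W: "sub W" and H: "H \<in> lines U (U \<boxplus> W)"
  shows "vd (H \<inter> W) = vd (U \<inter> W) + 1" "H \<boxplus> W = U \<boxplus> W"
proof -
  have h: "sub H" "U \<subseteq> H" "H \<subseteq> U \<boxplus> W" "vd H = vd U + 1" using H unfolding lines_def by auto
  have "H \<boxplus> W \<subseteq> U \<boxplus> W" using sum_least[OF h(1) W sub_sum[OF U W] h(3) sum_upper2[OF U W]] .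
  moreover have "U \<subseteq> H \<boxplus> W" using sum_upper1[OF h(1) W] h(2) by blast
  then have "U \<boxplus> W \<subseteq> H \<boxplus> W" using sum_least[OF U W sub_sum[OF h(1) W] _ sum_upper2[OF h(1) W]] by blast
  ultimately show e: "H \<boxplus> W = U \<boxplus> W" by blast
  show "vd (H \<inter> W) = vd (U \<inter> W) + 1"
    using vd_sum_Int[OF h(1) W] vd_sum_Int[OF U W] h(4) e by simp
qed

lemma line_outside:
  assumes U: "sub U" and W: "sub W" and H: "H \<in> lines U (carrier V)" "H \<notin> lines U (U \<boxplus> W)"
  shows "vd (H \<inter> W) = vd (U \<inter> W)" "vd (H \<boxplus> W) = vd (U \<boxplus> W) + 1" "U \<boxplus> W \<subseteq> H \<boxplus> W"
proof -
  have h: "sub H" "U \<subseteq> H" "vd H = vd U + 1" "\<not> H \<subseteq> U \<boxplus> W" using H unfolding lines_def by auto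
  obtain x where x: "x \<in> H" "x \<notin> U \<boxplus> W" using h(4) by blast
  have "U \<subseteq> H \<boxplus> W" using sum_upper1[OF h(1) W] h(2) by blast
  then show UW: "U \<boxplus> W \<subseteq> H \<boxplus> W" using sum_least[OF U W sub_sum[OF h(1) W] _ sum_upper2[OF h(1) W]] by blast
  have "x \<in> H \<boxplus> W" using sum_upper1[OF h(1) W] x by blast
  then have "vd (U \<boxplus> W) < vd (H \<boxplus> W)"
    using vd_less[OF sub_sum[OF U W] sub_sum[OF h(1) W] UW _ x(2)] by blast
  moreover have "U \<inter> W \<subseteq> H \<inter> W" using h(2) by blast
  then have "vd (U \<inter> W) \<le> vd (H \<inter> W)" using vd_mono[OF sub_Int[OF U W] sub_Int[OF h(1) W]] by blast
  ultimately show "vd (H \<inter> W) = vd (U \<inter> W)" "vd (H \<boxplus> W) = vd (U \<boxplus> W) + 1"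
    using vd_sum_Int[OF h(1) W] vd_sum_Int[OF U W] h(3) by linarith+
qed

lemma lines_mono: "S \<subseteq> S' \<Longrightarrow> lines U S \<subseteq> lines U S'" unfolding lines_def by blast

lemma ups_inside:
  assumes U: "sub U" and W: "sub W" shows "ups U W (vd (U \<inter> W) + 1) = lines U (U \<boxplus> W)"
proof -
  have "H \<in> lines U (carrier V)" if "H \<in> ups U W n" for H n
    using that sub_carrier unfolding ups_def lines_def by blast
  then have "ups U W (vd (U \<inter> W) + 1) \<subseteq> lines U (U \<boxplus> W)"
    using line_outside(1)[OF U W] unfolding ups_def by fastforce
  moreover have "lines U (U \<boxplus> W) \<subseteq> ups U W (vd (U \<inter> W) + 1)"
    using line_inside(1)[OF U W] unfolding ups_def lines_def by blast
  ultimately show ?thesis by blast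
qed

lemma ups_outside:
  assumes U: "sub U" and W: "sub W"
  shows "ups U W (vd (U \<inter> W)) = lines U (carrier V) - lines U (U \<boxplus> W)"
proof -
  have "H \<in> lines U (carrier V)" if "H \<in> ups U W n" for H n
    using that sub_carrier unfolding ups_def lines_def by blast
  then have "ups U W (vd (U \<inter> W)) \<subseteq> lines U (carrier V) - lines U (U \<boxplus> W)"
    using line_inside(1)[OF U W] unfolding ups_def by fastforce
  moreover have "lines U (carrier V) - lines U (U \<boxplus> W) \<subseteq> ups U W (vd (U \<inter> W))"
    using line_outside(1)[OF U W] unfolding ups_def lines_def by blast
  ultimately show ?thesis by blast
qed

lemma ups_empty:
  assumes U: "sub U" and W: "sub W" and n: "n \<noteq> vd (U \<inter> W)" "n \<noteq> vd (U \<inter> W) + 1"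
  shows "ups U W n = {}"
proof -
  have "False" if H: "H \<in> ups U W n" for H
  proof -
    have "H \<in> lines U (carrier V)" using H sub_carrier unfolding ups_def lines_def by blast
    then show False using line_inside(1)[OF U W, of H] line_outside(1)[OF U W, of H] H n
      unfolding ups_def by (cases "H \<in> lines U (U \<boxplus> W)") simp_all
  qed
  then show ?thesis by blast
qed

lemma vd_sum_minus:
  assumes "sub U" "sub W" shows "vd (U \<boxplus> W) - vd U = vd W - vd (U \<inter> W)"
    using vd_sum_Int[OF assms] vd_mono[OF sub_Int[OF assms] assms(2)] by auto

text \<open>The position of a vector \<open>x\<close> relative to the pair \<open>(H, W)\<close> depends on \<open>H\<close> only through
  \<open>x \<in> H\<close> and \<open>x \<in> H + W\<close>, so these two conditions are counted for every family.\<close>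
lemma card_ups_inside:
  assumes U: "sub U" and W: "sub W" and x: "x \<in> carrier V"
  defines "F \<equiv> ups U W (vd (U \<inter> W) + 1)" and "c \<equiv> vd W - vd (U \<inter> W)"
  shows "card F = qnum q c"
    "card {H \<in> F. x \<in> H} = (if x \<in> U then qnum q c else if x \<in> U \<boxplus> W then 1 else 0)"
    "card {H \<in> F. x \<in> H \<boxplus> W} = (if x \<in> U \<boxplus> W then qnum q c else 0)"
proof -
  note Fe = ups_inside[OF U W, folded F_def]
  note s = sub_sum[OF U W] sum_upper1[OF U W]
  note e = vd_sum_minus[OF U W, folded c_def]
  show 1: "card F = qnum q c"
    unfolding Fe card_lines[OF U s] e ..
  show "card {H \<in> F. x \<in> H} = (if x \<in> U then qnum q c else if x \<in> U \<boxplus> W then 1 else 0)"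
    unfolding Fe card_lines_through[OF U s x] e ..
  have "x \<in> H \<boxplus> W \<longleftrightarrow> x \<in> U \<boxplus> W" if "H \<in> F" for H
    using line_inside(2)[OF U W] that unfolding Fe by simp
  then have "{H \<in> F. x \<in> H \<boxplus> W} = (if x \<in> U \<boxplus> W then F else {})"
    by auto
  then show "card {H \<in> F. x \<in> H \<boxplus> W} = (if x \<in> U \<boxplus> W then qnum q c else 0)"
    using 1 by simp
qed

lemma card_ups_outside:
  assumes U: "sub U" and W: "sub W" and x: "x \<in> carrier V"
  defines "F \<equiv> ups U W (vd (U \<inter> W))" and "c \<equiv> vd W - vd (U \<inter> W)"
    and "m \<equiv> vd (carrier V) - vd U"
  shows "int (card F) = qnum (int q) m - qnum (int q) c"
    "int (card {H \<in> F. x \<in> H}) =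
       (if x \<in> U then qnum (int q) m - qnum (int q) c else if x \<in> U \<boxplus> W then 0 else 1)"
    "int (card {H \<in> F. x \<in> H \<boxplus> W}) =
       (if x \<in> U \<boxplus> W then qnum (int q) m - qnum (int q) c else int q ^ c)"
proof -
  note Fe = ups_outside[OF U W, folded F_def]
  note s = sub_sum[OF U W] sum_upper1[OF U W]
  note e = vd_sum_minus[OF U W, folded c_def]
  note fin = finite_lines[OF sub_top, of U]
  have mono: "lines U (U \<boxplus> W) \<subseteq> lines U (carrier V)" using lines_mono[OF sub_carrier[OF s(1)]] .
  show 1: "int (card F) = qnum (int q) m - qnum (int q) c"
    unfolding Fe int_card_Diff[OF mono fin] card_lines[OF U s] card_lines[OF U sub_top sub_carrier[OF U]] e
    by (simp add: int_qnum m_def)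
  have "{H \<in> F. x \<in> H} = {H \<in> lines U (carrier V). x \<in> H} - {H \<in> lines U (U \<boxplus> W). x \<in> H}"
    unfolding Fe by blast
  moreover have "{H \<in> lines U (U \<boxplus> W). x \<in> H} \<subseteq> {H \<in> lines U (carrier V). x \<in> H}" using mono by blast
  ultimately have "int (card {H \<in> F. x \<in> H}) =
     int (card {H \<in> lines U (carrier V). x \<in> H}) - int (card {H \<in> lines U (U \<boxplus> W). x \<in> H})"
    using fin by (simp add: int_card_Diff)
  also have "\<dots> = (if x \<in> U then qnum (int q) m - qnum (int q) c else if x \<in> U \<boxplus> W then 0 else 1)"
    unfolding card_lines_through[OF U s x] card_lines_through[OF U sub_top sub_carrier[OF U] x] e
    using x by (simp add: int_qnum m_def)
  finally show "int (card {H \<in> F. x \<in> H}) =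
       (if x \<in> U then qnum (int q) m - qnum (int q) c else if x \<in> U \<boxplus> W then 0 else 1)" .
  show "int (card {H \<in> F. x \<in> H \<boxplus> W}) =
       (if x \<in> U \<boxplus> W then qnum (int q) m - qnum (int q) c else int q ^ c)"
  proof (cases "x \<in> U \<boxplus> W")
    case True
    then have "{H \<in> F. x \<in> H \<boxplus> W} = F"
      using line_outside(3)[OF U W] unfolding Fe by blast
    then show ?thesis using 1 True by simp
  next
    case False
    let ?X = "U \<boxplus> W \<boxplus> span {x}"
    have X: "sub ?X" "U \<boxplus> W \<subseteq> ?X" "vd ?X = vd (U \<boxplus> W) + 1"
      using sub_adjoin[OF s(1) x] adjoin_upper[OF s(1) x] vd_adjoin[OF s(1) x False] by blast+
    have "x \<in> H \<boxplus> W \<longleftrightarrow> H \<subseteq> ?X" if H: "H \<in> lines U (carrier V) - lines U (U \<boxplus> W)" for H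
    proof -
      have h: "sub H" "U \<subseteq> H" using H unfolding lines_def by auto
      have o: "vd (H \<boxplus> W) = vd (U \<boxplus> W) + 1" "U \<boxplus> W \<subseteq> H \<boxplus> W" using line_outside[OF U W] H by blast+
      note HW = sub_sum[OF h(1) W]
      show ?thesis
      proof
        assume "x \<in> H \<boxplus> W"
        then have "?X \<subseteq> H \<boxplus> W" using adjoin_subset_iff[OF s(1) x HW] o by blast
        then have "?X = H \<boxplus> W" using vd_eq[OF X(1) HW] o X(3) by simp
        then show "H \<subseteq> ?X" using sum_upper1[OF h(1) W] by blast
      next
        assume "H \<subseteq> ?X"
        moreover have "W \<subseteq> ?X" using sum_upper2[OF U W] X(2) by blast
        ultimately have "H \<boxplus> W \<subseteq> ?X" using sum_least[OF h(1) W X(1)] by blast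
        then have "H \<boxplus> W = ?X" using vd_eq[OF HW X(1)] o X(3) by simp
        then show "x \<in> H \<boxplus> W" using adjoin_mem[OF s(1) x] by blast
      qed
    qed
    then have "{H \<in> F. x \<in> H \<boxplus> W} = lines U ?X - lines U (U \<boxplus> W)"
      unfolding Fe using lines_mono[OF sub_carrier[OF X(1)], of U]
      unfolding lines_def by blast
    moreover have UX: "U \<subseteq> ?X" using s(2) X(2) by blast
    ultimately have "int (card {H \<in> F. x \<in> H \<boxplus> W}) = qnum (int q) (vd ?X - vd U) - qnum (int q) c"
      using int_card_Diff[OF lines_mono[OF X(2)] finite_lines[OF X(1)]] card_lines[OF U s] card_lines[OF U X(1) UX] e
      by (simp add: int_qnum)
    moreover have "vd ?X - vd U = Suc c" using X(3) e vd_mono[OF U s] by simp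
    ultimately show ?thesis using False by (simp add: qnum_Suc)
  qed
qed


lemma hyp_containing:
  assumes U: "sub U" and W: "sub W" and H: "H \<in> hyps (U \<inter> W) U"
  shows "H \<inter> W = U \<inter> W"
    and "x \<in> carrier V \<Longrightarrow> x \<in> H \<boxplus> W \<longleftrightarrow> x \<in> U \<boxplus> W \<and> (x \<in> W \<or> (\<exists>u\<in>H. x \<ominus> u \<in> W))"
proof -
  have h: "sub H" "U \<inter> W \<subseteq> H" "H \<subseteq> U" using H unfolding hyps_def by blast+
  show "H \<inter> W = U \<inter> W" using h by blast
  assume x: "x \<in> carrier V"
  show "x \<in> H \<boxplus> W \<longleftrightarrow> x \<in> U \<boxplus> W \<and> (x \<in> W \<or> (\<exists>u\<in>H. x \<ominus> u \<in> W))"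
  proof
    assume "x \<in> H \<boxplus> W"
    then obtain u w where uw: "u \<in> H" "w \<in> W" "x = u \<oplus> w" unfolding sum_iff by blast
    have "x \<ominus> u = w" using add_left_cancel_diff[OF sub_mem[OF h(1) uw(1)] sub_mem[OF W uw(2)]] uw(3) by simp
    then show "x \<in> U \<boxplus> W \<and> (x \<in> W \<or> (\<exists>u\<in>H. x \<ominus> u \<in> W))"
      using uw h(3) unfolding sum_iff by blast
  next
    assume "x \<in> U \<boxplus> W \<and> (x \<in> W \<or> (\<exists>u\<in>H. x \<ominus> u \<in> W))"
    then consider "x \<in> W" | u where "u \<in> H" "x \<ominus> u \<in> W" by blast
    then show "x \<in> H \<boxplus> W"
    proof cases
      case 1
      then show ?thesis using sum_upper2[OF h(1) W] by blast
    next
      case 2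
      then show ?thesis unfolding sum_iff using add_diff_same[OF sub_mem[OF h(1) 2(1)] x] by metis
    qed
  qed
qed

lemma hyp_not_containing:
  assumes U: "sub U" and W: "sub W" and H: "H \<in> hyps {\<zero>} U" "H \<notin> hyps (U \<inter> W) U"
  shows "vd (H \<inter> W) + 1 = vd (U \<inter> W)" "H \<boxplus> W = U \<boxplus> W"
proof -
  have h: "sub H" "H \<subseteq> U" "vd H + 1 = vd U" "\<not> U \<inter> W \<subseteq> H" using H unfolding hyps_def by auto
  have HW: "H \<boxplus> W \<subseteq> U \<boxplus> W"
    using sum_least[OF h(1) W sub_sum[OF U W] _ sum_upper2[OF U W]] sum_upper1[OF U W] h(2) by blast
  obtain x where x: "x \<in> U" "x \<in> W" "x \<notin> H" using h(4) by blast
  have "H \<inter> W \<subseteq> U \<inter> W" using h(2) by blast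
  then have "vd (H \<inter> W) < vd (U \<inter> W)"
    using vd_less[OF sub_Int[OF h(1) W] sub_Int[OF U W]] x by blast
  moreover have "vd (H \<boxplus> W) \<le> vd (U \<boxplus> W)" using vd_mono[OF sub_sum[OF h(1) W] sub_sum[OF U W] HW] .
  ultimately have *: "vd (H \<inter> W) + 1 = vd (U \<inter> W)" "vd (U \<boxplus> W) \<le> vd (H \<boxplus> W)"
    using vd_sum_Int[OF h(1) W] vd_sum_Int[OF U W] h(3) by linarith+
  then show "vd (H \<inter> W) + 1 = vd (U \<inter> W)" "H \<boxplus> W = U \<boxplus> W"
    using vd_eq[OF sub_sum[OF h(1) W] sub_sum[OF U W] HW] by blast+
qed

lemma hyps_mono: "J \<subseteq> J' \<Longrightarrow> hyps J' U \<subseteq> hyps J U" unfolding hyps_def by blast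

lemma downs_hyps: assumes "H \<in> downs U W n" shows "H \<in> hyps {\<zero>} U"
  using assms sub_zero unfolding downs_def hyps_def by blast

lemma downs_containing:
  assumes U: "sub U" and W: "sub W" shows "downs U W (vd (U \<inter> W)) = hyps (U \<inter> W) U"
proof -
  have "downs U W (vd (U \<inter> W)) \<subseteq> hyps (U \<inter> W) U"
  proof
    fix H assume H: "H \<in> downs U W (vd (U \<inter> W))"
    then have "vd (H \<inter> W) = vd (U \<inter> W)" unfolding downs_def by blast
    then show "H \<in> hyps (U \<inter> W) U"
      using hyp_not_containing(1)[OF U W downs_hyps[OF H]] by linarith
  qed
  moreover have "H \<in> downs U W (vd (U \<inter> W))" if H: "H \<in> hyps (U \<inter> W) U" for H
    using hyp_containing(1)[OF U W H] H unfolding downs_def hyps_def by simp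
  ultimately show ?thesis by blast
qed

lemma downs_not_containing:
  assumes U: "sub U" and W: "sub W" and n: "n + 1 = vd (U \<inter> W)"
  shows "downs U W n = hyps {\<zero>} U - hyps (U \<inter> W) U"
proof -
  have "downs U W n \<subseteq> hyps {\<zero>} U - hyps (U \<inter> W) U"
  proof
    fix H assume H: "H \<in> downs U W n"
    then have "H \<notin> hyps (U \<inter> W) U" using hyp_containing(1)[OF U W, of H] n unfolding downs_def by auto
    then show "H \<in> hyps {\<zero>} U - hyps (U \<inter> W) U" using downs_hyps[OF H] by blast
  qed
  moreover have "H \<in> downs U W n" if H: "H \<in> hyps {\<zero>} U" "H \<notin> hyps (U \<inter> W) U" for H
    using hyp_not_containing(1)[OF U W H] H(1) n unfolding downs_def hyps_def by simp
  ultimately show ?thesis by blast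
qed

lemma downs_empty:
  assumes U: "sub U" and W: "sub W" and n: "n \<noteq> vd (U \<inter> W)" "n + 1 \<noteq> vd (U \<inter> W)"
  shows "downs U W n = {}"
proof -
  have "False" if H: "H \<in> downs U W n" for H
    using hyp_containing(1)[OF U W, of H] hyp_not_containing(1)[OF U W downs_hyps[OF H]] H n
    unfolding downs_def by (cases "H \<in> hyps (U \<inter> W) U") simp_all
  then show ?thesis by blast
qed

lemma card_downs_containing:
  assumes U: "sub U" and W: "sub W" and x: "x \<in> carrier V"
  defines "F \<equiv> downs U W (vd (U \<inter> W))" and "b \<equiv> vd U - vd (U \<inter> W)"
  shows "card F = qnum q b"
    "card {H \<in> F. x \<in> H} = (if x \<notin> U then 0 else if x \<in> W then qnum q b else qnum q (b - 1))"
    "card {H \<in> F. x \<in> H \<boxplus> W} =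
      (if x \<notin> U \<boxplus> W then 0 else if x \<in> W then qnum q b else qnum q (b - 1))"
proof -
  note Fe = downs_containing[OF U W, folded F_def]
  note UW = sub_Int[OF U W]
  show 1: "card F = qnum q b"
    unfolding Fe b_def by (rule card_hyps[OF U UW]) blast
  have thr: "card {H \<in> F. y \<in> H} = (if y \<notin> U then 0 else if y \<in> W then qnum q b else qnum q (b - 1))"
    if "y \<in> carrier V" for y
    unfolding Fe b_def using card_hyps_through[OF U UW Int_lower1 that] by simp
  then show "card {H \<in> F. x \<in> H} = (if x \<notin> U then 0 else if x \<in> W then qnum q b else qnum q (b - 1))"
    using x .
  consider "x \<notin> U \<boxplus> W" | "x \<in> W" | "x \<in> U \<boxplus> W" "x \<notin> W" by blast
  then show "card {H \<in> F. x \<in> H \<boxplus> W} =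
      (if x \<notin> U \<boxplus> W then 0 else if x \<in> W then qnum q b else qnum q (b - 1))"
  proof cases
    case 1
    then have "{H \<in> F. x \<in> H \<boxplus> W} = {}"
      unfolding Fe using hyp_containing(2)[OF U W _ x] by blast
    then have "card {H \<in> F. x \<in> H \<boxplus> W} = 0" by (simp only: card.empty)
    then show ?thesis using 1 by simp
  next
    case 2
    have "x \<in> U \<boxplus> W" using sum_upper2[OF U W] 2 by blast
    then have "{H \<in> F. x \<in> H \<boxplus> W} = F"
      unfolding Fe using hyp_containing(2)[OF U W _ x] 2 by blast
    then show ?thesis using 1 2 \<open>x \<in> U \<boxplus> W\<close> by simp
  next
    case 3
    \<comment> \<open>Only the component \<open>u\<close> of \<open>x\<close> in \<open>U\<close> matters: it is determined up to \<open>U \<inter> W \<subseteq> H\<close>.\<close>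
    obtain u w where uw: "u \<in> U" "w \<in> W" "x = u \<oplus> w" using 3(1) unfolding sum_iff by blast
    have uV: "u \<in> carrier V" and wV: "w \<in> carrier V" using sub_mem[OF U uw(1)] sub_mem[OF W uw(2)] .
    have uW: "u \<notin> W" using 3(2) sub_add[OF W _ uw(2)] uw(3) by blast
    have "x \<in> H \<boxplus> W \<longleftrightarrow> u \<in> H" if H: "H \<in> hyps (U \<inter> W) U" for H
    proof -
      have h: "sub H" "U \<inter> W \<subseteq> H" "H \<subseteq> U" using H unfolding hyps_def by blast+
      show ?thesis
      proof
        assume "u \<in> H"
        then show "x \<in> H \<boxplus> W" using uw unfolding sum_iff by blast
      next
        assume "x \<in> H \<boxplus> W"
        then obtain u' w' where uw': "u' \<in> H" "w' \<in> W" "x = u' \<oplus> w'" unfolding sum_iff by blast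
        have u'V: "u' \<in> carrier V" and w'V: "w' \<in> carrier V" using sub_mem[OF h(1) uw'(1)] sub_mem[OF W uw'(2)] .
        let ?d = "u \<ominus> u'"
        have dV: "?d \<in> carrier V" using uV u'V by simp
        have u: "u = u' \<oplus> ?d" using add_diff_same[OF u'V uV] by simp
        have "u' \<oplus> w' = u' \<oplus> (?d \<oplus> w)"
          using uw(3) uw'(3) u M.a_assoc[OF u'V dV wV] by simp
        then have "w' = w \<oplus> ?d" using u'V w'V dV wV M.a_comm[OF dV wV]
          by (metis M.a_closed add_left_cancel_diff)
        then have "?d \<in> W" using sub_add_iff[OF W uw(2) dV] uw'(2) by simp
        moreover have "?d \<in> U" using sub_diff[OF U uw(1)] uw'(1) h(3) by blast
        ultimately have "?d \<in> H" using h(2) by blast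
        then show "u \<in> H" using sub_add[OF h(1) uw'(1)] u by metis
      qed
    qed
    then have "{H \<in> F. x \<in> H \<boxplus> W} = {H \<in> F. u \<in> H}"
      unfolding Fe by blast
    then show ?thesis using thr[OF uV] uw(1) uW 3 by simp
  qed
qed

lemma card_downs_not_containing:
  assumes U: "sub U" and W: "sub W" and x: "x \<in> carrier V" and n: "n + 1 = vd (U \<inter> W)"
  defines "b \<equiv> vd U - vd (U \<inter> W)" and "m \<equiv> vd U"
  shows "int (card (downs U W n)) = qnum (int q) m - qnum (int q) b"
    "int (card {H \<in> downs U W n. x \<in> H}) = (if x \<notin> U then 0 else if x = \<zero> then qnum (int q) m - qnum (int q) b
      else if x \<in> W then qnum (int q) (m - 1) - qnum (int q) b else qnum (int q) (m - 1) - qnum (int q) (b - 1))"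
    "int (card {H \<in> downs U W n. x \<in> H \<boxplus> W}) = (if x \<in> U \<boxplus> W then qnum (int q) m - qnum (int q) b else 0)"
proof -
  note UW = sub_Int[OF U W]
  have z: "{\<zero>} \<subseteq> U" "{\<zero>} \<subseteq> U \<inter> W" using sub_zero[OF U] sub_zero[OF W] by blast+
  have mono: "hyps (U \<inter> W) U \<subseteq> hyps {\<zero>} U" using hyps_mono[OF z(2)] .
  note fin = finite_hyps[OF U, of "{\<zero>}"]
  show 1: "int (card (downs U W n)) = qnum (int q) m - qnum (int q) b"
    unfolding downs_not_containing[OF U W n] int_card_Diff[OF mono fin] card_hyps[OF U sub_bot z(1)]
      card_hyps[OF U UW Int_lower1] by (simp add: int_qnum m_def b_def vd_bot)
  have "{H \<in> downs U W n. x \<in> H} = {H \<in> hyps {\<zero>} U. x \<in> H} - {H \<in> hyps (U \<inter> W) U. x \<in> H}"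
    unfolding downs_not_containing[OF U W n] by blast
  moreover have "{H \<in> hyps (U \<inter> W) U. x \<in> H} \<subseteq> {H \<in> hyps {\<zero>} U. x \<in> H}" using mono by blast
  ultimately have "int (card {H \<in> downs U W n. x \<in> H}) =
      int (card {H \<in> hyps {\<zero>} U. x \<in> H}) - int (card {H \<in> hyps (U \<inter> W) U. x \<in> H})"
    using fin by (simp add: int_card_Diff)
  then show "int (card {H \<in> downs U W n. x \<in> H}) = (if x \<notin> U then 0 else if x = \<zero> then qnum (int q) m - qnum (int q) b
      else if x \<in> W then qnum (int q) (m - 1) - qnum (int q) b else qnum (int q) (m - 1) - qnum (int q) (b - 1))"
    unfolding card_hyps_through[OF U sub_bot z(1) x] card_hyps_through[OF U UW Int_lower1 x]
    using sub_zero[OF U] sub_zero[OF W] by (simp add: int_qnum m_def b_def vd_bot)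
  have "x \<in> H \<boxplus> W \<longleftrightarrow> x \<in> U \<boxplus> W" if "H \<in> downs U W n" for H
    using hyp_not_containing(2)[OF U W] that unfolding downs_not_containing[OF U W n] by blast
  then have "{H \<in> downs U W n. x \<in> H \<boxplus> W} = (if x \<in> U \<boxplus> W then downs U W n else {})"
    by auto
  then show "int (card {H \<in> downs U W n. x \<in> H \<boxplus> W}) = (if x \<in> U \<boxplus> W then qnum (int q) m - qnum (int q) b else 0)"
    using 1 by simp
qed

end

section \<open>Labels and positions\<close>

definition mat2 :: "nat \<Rightarrow> nat \<Rightarrow> nat \<Rightarrow> nat \<Rightarrow> nat \<Rightarrow> nat \<Rightarrow> nat" where
  "mat2 a b c e = (\<lambda>i j. if (i, j) = (1, 1) then a else if (i, j) = (1, 2) then b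
     else if (i, j) = (2, 1) then c else if (i, j) = (2, 2) then e else 0)"

lemma mat2_simps [simp]:
  "mat2 a b c e 1 1 = a" "mat2 a b c e (Suc 0) (Suc 0) = a"
  "mat2 a b c e 1 2 = b" "mat2 a b c e (Suc 0) 2 = b"
  "mat2 a b c e 2 1 = c" "mat2 a b c e 2 (Suc 0) = c"
  "mat2 a b c e 2 2 = e"
  by (simp_all add: mat2_def)

lemma mat2_eq_iff [simp]: "mat2 a b c e = mat2 a' b' c' e' \<longleftrightarrow> a = a' \<and> b = b' \<and> c = c' \<and> e = e'"
  by (metis mat2_simps(1,3,5,7))

definition deltas :: "(nat \<times> nat) set set" where
  "deltas = {{}, {(1, 1)}, {(1, 2)}, {(2, 1)}, {(1, 2), (2, 1)}, {(2, 2)}}"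

lemma delta_chain_iff:
  "D \<subseteq> {1..2} \<times> {1..2} \<and> (\<exists>ps. D = set ps \<and> sorted_wrt (\<lambda>(i, j) (i', j'). i < i' \<and> j' < j) ps)
     \<longleftrightarrow> D \<in> deltas" (is "?L \<longleftrightarrow> ?R")
proof
  assume L: ?L
  then obtain ps where ps: "D = set ps" "sorted_wrt (\<lambda>(i, j) (i', j'). i < i' \<and> j' < j) ps" by blast
  have chain: "p = p' \<or> (fst p < fst p' \<and> snd p' < snd p) \<or> (fst p' < fst p \<and> snd p < snd p')"
    if p: "p \<in> D" "p' \<in> D" for p p'
  proof -
    obtain k l where kl: "k < length ps" "p = ps ! k" "l < length ps" "p' = ps ! l"
      using p ps(1) by (metis in_set_conv_nth)
    show ?thesis
      using sorted_wrt_nth_less[OF ps(2), of k l] sorted_wrt_nth_less[OF ps(2), of l k] kl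
      by (cases k l rule: linorder_cases) (auto split: prod.splits)
  qed
  have sq: "{1..2} \<times> {1..2} = {(1::nat, 1::nat), (1, 2), (2, 1), (2, 2)}" by auto
  have Dsub: "D \<subseteq> {(1, 1), (1, 2), (2, 1), (2, 2)}" using L sq by simp
  consider "(1, 1) \<in> D" "(1, 2) \<in> D" | "(1, 1) \<in> D" "(2, 1) \<in> D" | "(1, 1) \<in> D" "(2, 2) \<in> D"
    | "(1, 2) \<in> D" "(2, 2) \<in> D" | "(2, 1) \<in> D" "(2, 2) \<in> D"
    | "(1, 1) \<in> D" "(1, 2) \<notin> D" "(2, 1) \<notin> D" "(2, 2) \<notin> D"
    | "(2, 2) \<in> D" "(1, 1) \<notin> D" "(1, 2) \<notin> D" "(2, 1) \<notin> D"
    | "(1, 1) \<notin> D" "(2, 2) \<notin> D" by blast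
  then show ?R
  proof cases
    case 1 then show ?thesis using chain[of "(1, 1)" "(1, 2)"] by simp
  next
    case 2 then show ?thesis using chain[of "(1, 1)" "(2, 1)"] by simp
  next
    case 3 then show ?thesis using chain[of "(1, 1)" "(2, 2)"] by simp
  next
    case 4 then show ?thesis using chain[of "(1, 2)" "(2, 2)"] by simp
  next
    case 5 then show ?thesis using chain[of "(2, 1)" "(2, 2)"] by simp
  next
    case 6 then have "D = {(1, 1)}" using Dsub by blast
    then show ?thesis unfolding deltas_def by simp
  next
    case 7 then have "D = {(2, 2)}" using Dsub by blast
    then show ?thesis unfolding deltas_def by simp
  next
    case 8 then have "D \<subseteq> {(1, 2), (2, 1)}" using Dsub by blast
    then have "D = {} \<or> D = {(1, 2)} \<or> D = {(2, 1)} \<or> D = {(1, 2), (2, 1)}" by (cases "(1, 2) \<in> D"; cases "(2, 1) \<in> D") blast+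
    then show ?thesis unfolding deltas_def by (elim disjE) simp_all
  qed
next
  assume ?R
  moreover have "\<exists>ps. {} = set ps \<and> sorted_wrt (\<lambda>(i, j) (i', j'). i < i' \<and> j' < j) (ps :: (nat \<times> nat) list)"
    by (rule exI[of _ "[]"]) simp
  moreover have "\<exists>ps. {p} = set ps \<and> sorted_wrt (\<lambda>(i, j) (i', j'). i < i' \<and> j' < j) (ps :: (nat \<times> nat) list)" for p
    by (rule exI[of _ "[p]"]) simp
  moreover have "\<exists>ps. {(1,2),(2,1)} = set ps \<and> sorted_wrt (\<lambda>(i, j) (i', j'). i < i' \<and> j' < j) (ps :: (nat \<times> nat) list)"
    by (rule exI[of _ "[(1,2),(2,1)]"]) simp
  ultimately show ?L unfolding deltas_def by (elim insertE emptyE) simp_all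
qed

definition admissible :: "nat \<Rightarrow> nat \<Rightarrow> nat \<Rightarrow> nat \<Rightarrow> (nat \<times> nat) set \<Rightarrow> bool" where
  "admissible a b c e D \<longleftrightarrow> D \<in> deltas \<and> (\<forall>(i, j)\<in>D. mat2 a b c e i j > 0)"

lemma Xi_mat2: "(mat2 a b c e, D) \<in> Xi d \<longleftrightarrow> a + b + c + e = d \<and> admissible a b c e D"
proof -
  have 1: "\<forall>i j. mat2 a b c e i j > 0 \<longrightarrow> i \<in> {1..2} \<and> j \<in> {1..2}" by (auto simp: mat2_def)
  have s: "{1..2} = {1::nat, 2}" by auto
  have 2: "(\<Sum>i\<in>{1..2}. \<Sum>j\<in>{1..2}. mat2 a b c e i j) = a + b + c + e"
    unfolding s by simp
  show ?thesis
    by (simp only: Xi_def admissible_def mem_Collect_eq case_prod_conv 2 delta_chain_iff[symmetric] conj_assoc)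
      (use 1 in blast)
qed

lemma Xi_cases:
  assumes "z \<in> Xi d"
  obtains a b c e D where "z = (mat2 a b c e, D)" "a + b + c + e = d" "admissible a b c e D"
proof -
  obtain A D where z: "z = (A, D)" by (cases z)
  have supp: "A i j > 0 \<longrightarrow> i \<in> {1..2} \<and> j \<in> {1..2}" for i j using assms unfolding z Xi_def by blast
  have "A = mat2 (A 1 1) (A 1 2) (A 2 1) (A 2 2)"
  proof (intro ext)
    fix i j :: nat
    have "i \<in> {1..2} \<Longrightarrow> i = 1 \<or> i = 2" "j \<in> {1..2} \<Longrightarrow> j = 1 \<or> j = 2" by auto
    then show "A i j = mat2 (A 1 1) (A 1 2) (A 2 1) (A 2 2) i j"
      using supp[of i j] by (auto simp: mat2_def)
  qed
  then show ?thesis using that[of "A 1 1" "A 1 2" "A 2 1" "A 2 2" D] z assms Xi_mat2 by metis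
qed

text \<open>The possible \<open>\<Delta>\<close> are told apart by four yes-no questions about the vector
  \<open>v = \<Sum>\<^bsub>(i,j) \<in> \<Delta>\<^esub> e\<^sub>i\<^sub>j\<^sub>1\<close> and the subspaces \<open>U = F\<^sub>1\<close>, \<open>W = F'\<^sub>1\<close>: whether \<open>v = 0\<close>, \<open>v \<in> U\<close>
  (\<open>in_row\<close>: only first-row positions), \<open>v \<in> W\<close> (\<open>in_col\<close>: only first-column positions) and
  \<open>v \<in> U + W\<close> (\<open>in_hook\<close>).\<close>
definition in_row :: "(nat \<times> nat) set \<Rightarrow> bool" where "in_row D \<longleftrightarrow> D = {} \<or> D = {(1, 1)} \<or> D = {(1, 2)}"
definition in_col :: "(nat \<times> nat) set \<Rightarrow> bool" where "in_col D \<longleftrightarrow> D = {} \<or> D = {(1, 1)} \<or> D = {(2, 1)}"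
definition in_hook :: "(nat \<times> nat) set \<Rightarrow> bool" where "in_hook D \<longleftrightarrow> D \<noteq> {(2, 2)}"

lemma admissible_simps [simp]:
  "admissible a b c e {}"
  "admissible a b c e {(1, 1)} \<longleftrightarrow> 0 < a" "admissible a b c e {(Suc 0, Suc 0)} \<longleftrightarrow> 0 < a"
  "admissible a b c e {(1, 2)} \<longleftrightarrow> 0 < b" "admissible a b c e {(Suc 0, 2)} \<longleftrightarrow> 0 < b"
  "admissible a b c e {(2, 1)} \<longleftrightarrow> 0 < c" "admissible a b c e {(2, Suc 0)} \<longleftrightarrow> 0 < c"
  "admissible a b c e {(1, 2), (2, 1)} \<longleftrightarrow> 0 < b \<and> 0 < c"
  "admissible a b c e {(Suc 0, 2), (2, Suc 0)} \<longleftrightarrow> 0 < b \<and> 0 < c"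
  "admissible a b c e {(2, 2)} \<longleftrightarrow> 0 < e"
  by (auto simp: admissible_def deltas_def)

text \<open>Among \<open>N\<close> subspaces \<open>H\<close>, \<open>Nr\<close> of which contain \<open>v\<close> and \<open>Nh\<close> of which satisfy \<open>v \<in> H + W\<close>,
  the number of those for which \<open>v\<close> has position \<open>D\<close> relative to \<open>(H, W)\<close>, given that it has position
  \<open>D'\<close> relative to \<open>(U, W)\<close>. The answers to \<open>v = 0\<close> and \<open>v \<in> W\<close> are the same for all \<open>H\<close>.\<close>
definition pos_count :: "'a::ab_group_add \<Rightarrow> 'a \<Rightarrow> 'a \<Rightarrow> (nat \<times> nat) set \<Rightarrow> (nat \<times> nat) set \<Rightarrow> 'a" where
  "pos_count N Nr Nh D' D = (if (D = {}) \<noteq> (D' = {}) \<or> in_col D \<noteq> in_col D' then 0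
     else if in_row D then Nr else if in_hook D then Nh - Nr else N - Nh)"

text \<open>The coefficient of \<open>T\<^sub>z\<close> in \<open>f\<^sub>r * T\<^sub>y\<close>, in \<open>e\<^sub>r * T\<^sub>y\<close> and in \<open>x\<^sub>r * T\<^sub>y\<close>, for \<open>y = (A, D)\<close> and
  \<open>z = (A', D')\<close>. They are stated over an arbitrary ring, because they are needed both for numbers
  \<open>x = q\<close> and for the polynomial variable.\<close>
definition up_coeff :: "'a::comm_ring_1 \<Rightarrow> label \<Rightarrow> label \<Rightarrow> 'a" where
  "up_coeff x = (\<lambda>(A, D) (A', D').
     if A 1 1 + A 1 2 = A' 1 1 + A' 1 2 + 1 \<and> A 1 1 + A 2 1 = A' 1 1 + A' 2 1 then
       if A 1 1 = A' 1 1 + 1 then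
         let N = qnum x (A' 2 1)
         in pos_count N (if in_row D' then N else if in_hook D' then 1 else 0) (if in_hook D' then N else 0) D' D
       else if A 1 1 = A' 1 1 then
         let N = qnum x (A' 2 1 + A' 2 2) - qnum x (A' 2 1)
         in pos_count N (if in_row D' then N else if in_hook D' then 0 else 1)
             (if in_hook D' then N else x ^ A' 2 1) D' D
       else 0
     else 0)"

definition down_coeff :: "'a::comm_ring_1 \<Rightarrow> label \<Rightarrow> label \<Rightarrow> 'a" where
  "down_coeff x = (\<lambda>(A, D) (A', D').
     if A 1 1 + A 1 2 + 1 = A' 1 1 + A' 1 2 \<and> A 1 1 + A 2 1 = A' 1 1 + A' 2 1 then
       if A 1 1 = A' 1 1 then
         let N = qnum x (A' 1 2); N' = if in_col D' then N else qnum x (A' 1 2 - 1)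
         in pos_count N (if in_row D' then N' else 0) (if in_hook D' then N' else 0) D' D
       else if A 1 1 + 1 = A' 1 1 then
         let N = qnum x (A' 1 1 + A' 1 2) - qnum x (A' 1 2)
         in pos_count N
              (if \<not> in_row D' then 0 else if D' = {} then N
               else qnum x (A' 1 1 + A' 1 2 - 1) - qnum x (if in_col D' then A' 1 2 else A' 1 2 - 1))
              (if in_hook D' then N else 0) D' D
       else 0
     else 0)"

definition shift_coeff :: "'a::comm_ring_1 \<Rightarrow> label \<Rightarrow> label \<Rightarrow> 'a" where
  "shift_coeff x = (\<lambda>(A, D) (A', D').
     if A = A' then
       (if in_row D' then
          if D = {} then 1 else if D = {(1, 1)} then x ^ A 1 1 - 1
          else if D = {(1, 2)} then x ^ (A 1 1 + A 1 2) - x ^ A 1 1 else 0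
        else if in_hook D' then
          if D = {(2, 1)} then x ^ A 1 1
          else if D = {(1, 2), (2, 1)} then x ^ (A 1 1 + A 1 2) - x ^ A 1 1 else 0
        else if D = {(2, 2)} then x ^ (A 1 1 + A 1 2) else 0) - of_bool (D = D')
     else 0)"

context finite_vspace
begin

definition pos :: "'v set \<Rightarrow> 'v set \<Rightarrow> 'v \<Rightarrow> (nat \<times> nat) set" where
  "pos U W x = (if x = \<zero> then {} else if x \<in> U then if x \<in> W then {(1, 1)} else {(1, 2)}
     else if x \<in> W then {(2, 1)} else if x \<in> U \<boxplus> W then {(1, 2), (2, 1)} else {(2, 2)})"

definition lab :: "'v set \<Rightarrow> 'v set \<Rightarrow> 'v \<Rightarrow> label" where
  "lab U W x = (mat2 (vd (U \<inter> W)) (vd U - vd (U \<inter> W)) (vd W - vd (U \<inter> W)) (vd (carrier V) - vd (U \<boxplus> W)), pos U W x)"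

lemma pos_deltas: "pos U W x \<in> deltas"
  unfolding pos_def deltas_def by auto

lemma pos_props:
  assumes "sub U" "sub W"
  shows "pos U W x = {} \<longleftrightarrow> x = \<zero>" "in_row (pos U W x) \<longleftrightarrow> x \<in> U" "in_col (pos U W x) \<longleftrightarrow> x \<in> W"
    "in_hook (pos U W x) \<longleftrightarrow> x \<in> U \<boxplus> W"
proof -
  have "\<zero> \<in> U" "\<zero> \<in> W" "U \<subseteq> U \<boxplus> W" "W \<subseteq> U \<boxplus> W"
    using assms sub_zero sum_upper1[OF assms] sum_upper2[OF assms] by blast+
  then show "pos U W x = {} \<longleftrightarrow> x = \<zero>" "in_row (pos U W x) \<longleftrightarrow> x \<in> U" "in_col (pos U W x) \<longleftrightarrow> x \<in> W"
    "in_hook (pos U W x) \<longleftrightarrow> x \<in> U \<boxplus> W"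
    unfolding pos_def in_row_def in_col_def in_hook_def by (auto simp: doubleton_eq_iff)
qed

lemma delta_determined:
  assumes "D \<in> deltas" "D' \<in> deltas" "D = {} \<longleftrightarrow> D' = {}" "in_row D \<longleftrightarrow> in_row D'"
    "in_col D \<longleftrightarrow> in_col D'" "in_hook D \<longleftrightarrow> in_hook D'"
  shows "D = D'"
  using assms unfolding deltas_def in_row_def in_col_def in_hook_def
  by (elim insertE emptyE) (simp_all add: doubleton_eq_iff)

lemma pos_eq_iff:
  assumes "sub U" "sub W" "D \<in> deltas"
  shows "pos U W x = D \<longleftrightarrow> (x = \<zero> \<longleftrightarrow> D = {}) \<and> (x \<in> U \<longleftrightarrow> in_row D) \<and> (x \<in> W \<longleftrightarrow> in_col D) \<and> (x \<in> U \<boxplus> W \<longleftrightarrow> in_hook D)"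
proof
  assume "pos U W x = D"
  then show "(x = \<zero> \<longleftrightarrow> D = {}) \<and> (x \<in> U \<longleftrightarrow> in_row D) \<and> (x \<in> W \<longleftrightarrow> in_col D) \<and> (x \<in> U \<boxplus> W \<longleftrightarrow> in_hook D)"
    using pos_props[OF assms(1,2), of x] by simp
next
  assume "(x = \<zero> \<longleftrightarrow> D = {}) \<and> (x \<in> U \<longleftrightarrow> in_row D) \<and> (x \<in> W \<longleftrightarrow> in_col D) \<and> (x \<in> U \<boxplus> W \<longleftrightarrow> in_hook D)"
  then show "pos U W x = D"
    by (intro delta_determined[OF pos_deltas assms(3)]) (simp_all add: pos_props[OF assms(1,2)])
qed

lemma dims:
  assumes "sub U" "sub W"
  shows "vd (U \<inter> W) \<le> vd U" "vd (U \<inter> W) \<le> vd W" "vd (U \<boxplus> W) = vd U + vd W - vd (U \<inter> W)"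
    "vd (U \<boxplus> W) \<le> vd (carrier V)"
  using vd_mono[OF sub_Int[OF assms] assms(1)] vd_mono[OF sub_Int[OF assms] assms(2)] vd_sum_Int[OF assms]
    vd_mono[OF sub_sum[OF assms] sub_top sub_carrier[OF sub_sum[OF assms]]] by auto

lemma lab_iff:
  assumes "sub U" "sub W" "a + b + c + e = vd (carrier V)"
  shows "lab U W x = (mat2 a b c e, D) \<longleftrightarrow> vd (U \<inter> W) = a \<and> vd U = a + b \<and> vd W = a + c \<and> pos U W x = D"
proof -
  have "vd U - vd (U \<inter> W) = b \<and> vd (U \<inter> W) = a \<longleftrightarrow> vd (U \<inter> W) = a \<and> vd U = a + b"
    using dims[OF assms(1,2)] by linarith
  moreover have "vd W - vd (U \<inter> W) = c \<and> vd (U \<inter> W) = a \<longleftrightarrow> vd (U \<inter> W) = a \<and> vd W = a + c"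
    using dims[OF assms(1,2)] by linarith
  moreover have "vd (carrier V) - vd (U \<boxplus> W) = e" if "vd (U \<inter> W) = a" "vd U = a + b" "vd W = a + c"
    using dims[OF assms(1,2)] that assms(3) by linarith
  ultimately show ?thesis unfolding lab_def prod.inject mat2_eq_iff by metis
qed

lemma lab_Xi:
  assumes U: "sub U" and W: "sub W" and x: "x \<in> carrier V"
  shows "lab U W x \<in> Xi (vd (carrier V))"
proof -
  let ?a = "vd (U \<inter> W)"
  have lt: "vd X < vd Y" if "sub X" "sub Y" "X \<subseteq> Y" "y \<in> Y" "y \<notin> X" for X Y y by (rule vd_less[OF that])
  have "0 < ?a" if "x \<in> U" "x \<in> W" "x \<noteq> \<zero>"
    using lt[OF sub_bot sub_Int[OF U W]] that sub_zero[OF U] sub_zero[OF W] by fastforce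
  moreover have "?a < vd U" if "x \<in> U" "x \<notin> W" for x
    using lt[OF sub_Int[OF U W] U] that by blast
  moreover have "?a < vd W" if "x \<in> W" "x \<notin> U" for x
    using lt[OF sub_Int[OF U W] W] that by blast
  moreover have "vd (U \<boxplus> W) < vd (carrier V)" if "x \<notin> U \<boxplus> W"
    using lt[OF sub_sum[OF U W] sub_top sub_carrier[OF sub_sum[OF U W]]] that x by blast
  moreover have "\<exists>u w. u \<in> U \<and> u \<notin> W \<and> w \<in> W \<and> w \<notin> U" if n: "x \<notin> U" "x \<notin> W" and s: "x \<in> U \<boxplus> W"
  proof -
    obtain u w where uw: "u \<in> U" "w \<in> W" "x = u \<oplus> w" using s unfolding sum_iff by blast
    then show ?thesis using n sub_add[OF U] sub_add[OF W] by metis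
  qed
  ultimately have "admissible ?a (vd U - ?a) (vd W - ?a) (vd (carrier V) - vd (U \<boxplus> W)) (pos U W x)"
    unfolding pos_def by auto
  then show ?thesis unfolding lab_def Xi_mat2 using dims[OF U W] by simp
qed

text \<open>\<open>x \<in> H\<close> implies \<open>x \<in> H + W\<close>, so the two conditions split the family into three parts.\<close>
lemma card_pos:
  assumes fin: "finite F" and F': "\<forall>H\<in>F. sub H" and U: "sub U" and W: "sub W" and D: "D \<in> deltas"
    and N: "int (card F) = N" "int (card {H \<in> F. x \<in> H}) = Nr" "int (card {H \<in> F. x \<in> H \<boxplus> W}) = Nh"
  shows "int (card {H \<in> F. pos H W x = D}) = pos_count N Nr Nh (pos U W x) D"
proof -
  have F: "\<And>H. H \<in> F \<Longrightarrow> sub H" using F' by blast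
  show ?thesis
  proof (cases "(x = \<zero> \<longleftrightarrow> D = {}) \<and> (x \<in> W \<longleftrightarrow> in_col D)")
  case False
  then have "{H \<in> F. pos H W x = D} = {}" using pos_eq_iff[OF F W D] by blast
  then have "card {H \<in> F. pos H W x = D} = 0" by (simp only: card.empty)
  then show ?thesis using False pos_props[OF U W] unfolding pos_count_def by auto
next
  case True
  have sub': "{H \<in> F. x \<in> H} \<subseteq> {H \<in> F. x \<in> H \<boxplus> W}" using sum_upper1[OF F W] by blast
  have eq: "{H \<in> F. pos H W x = D} = {H \<in> F. (x \<in> H \<longleftrightarrow> in_row D) \<and> (x \<in> H \<boxplus> W \<longleftrightarrow> in_hook D)}"
    using pos_eq_iff[OF F W D] True by blast
  have rh: "in_row D \<Longrightarrow> in_hook D" unfolding in_row_def in_hook_def by auto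
  consider "in_row D" | "\<not> in_row D" "in_hook D" | "\<not> in_hook D" by blast
  then have "int (card {H \<in> F. pos H W x = D}) = (if in_row D then Nr else if in_hook D then Nh - Nr else N - Nh)"
  proof cases
    case 1
    then have "{H \<in> F. pos H W x = D} = {H \<in> F. x \<in> H}" unfolding eq using rh sub' by blast
    then show ?thesis using 1 N by simp
  next
    case 2
    then have "{H \<in> F. pos H W x = D} = {H \<in> F. x \<in> H \<boxplus> W} - {H \<in> F. x \<in> H}" unfolding eq by blast
    then show ?thesis using 2 N int_card_Diff[OF sub'] fin by simp
  next
    case 3
    then have "{H \<in> F. pos H W x = D} = F - {H \<in> F. x \<in> H \<boxplus> W}" unfolding eq using rh sub' by blast
    then show ?thesis using 3 rh N int_card_Diff[of "{H \<in> F. x \<in> H \<boxplus> W}" F] fin by auto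
  qed
  then show ?thesis using True pos_props[OF U W] unfolding pos_count_def by auto
qed
qed

lemma finite_ups: "finite (ups U W n)"
  by (rule finite_subset[of _ "Pow (carrier V)"]) (use finite_vectors sub_carrier in \<open>auto simp: ups_def\<close>)

lemma finite_downs: "finite (downs U W n)"
  by (rule finite_subset[of _ "Pow (carrier V)"]) (use finite_vectors sub_carrier in \<open>auto simp: downs_def\<close>)

text \<open>The counts behind \<open>f\<^sub>r * T\<^sub>y\<close> and \<open>e\<^sub>r * T\<^sub>y\<close>.\<close>
lemma card_up:
  assumes U: "sub U" and W: "sub W" and x: "x \<in> carrier V" and y: "y \<in> Xi (vd (carrier V))"
  shows "int (card {H. sub H \<and> U \<subseteq> H \<and> vd H = vd U + 1 \<and> lab H W x = y}) = up_coeff (int q) y (lab U W x)"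
proof -
  obtain a b c e D where y': "y = (mat2 a b c e, D)" "a + b + c + e = vd (carrier V)" "admissible a b c e D"
    using y by (rule Xi_cases)
  have D: "D \<in> deltas" using y'(3) unfolding admissible_def by blast
  note dm = dims[OF U W]
  let ?a = "vd (U \<inter> W)" and ?c = "vd W - vd (U \<inter> W)"
  show ?thesis
  proof (cases "a + b = vd U + 1 \<and> a + c = vd W")
    case False
    then have "{H. sub H \<and> U \<subseteq> H \<and> vd H = vd U + 1 \<and> lab H W x = y} = {}"
      unfolding y'(1) using lab_iff[OF _ W y'(2), of _ x D] by auto
    then have "card {H. sub H \<and> U \<subseteq> H \<and> vd H = vd U + 1 \<and> lab H W x = y} = 0" by (simp only: card.empty)
    then show ?thesis using False dm unfolding y'(1) lab_def up_coeff_def by auto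
  next
    case True
    have eq: "{H. sub H \<and> U \<subseteq> H \<and> vd H = vd U + 1 \<and> lab H W x = y} = {H \<in> ups U W a. pos H W x = D}"
      unfolding y'(1) ups_def using lab_iff[OF _ W y'(2), of _ x D] True by auto
    have F: "\<forall>H\<in>ups U W a. sub H" unfolding ups_def by blast
    note cp = card_pos[OF finite_ups F U W D]
    consider "a = ?a + 1" | "a = ?a" | "a \<noteq> ?a + 1" "a \<noteq> ?a" by blast
    then show ?thesis
    proof cases
      case 1
      note k = card_ups_inside[OF U W x, folded 1]
      show ?thesis unfolding eq cp[OF refl refl refl] k
        using True 1 dm pos_props[OF U W] unfolding y'(1) lab_def up_coeff_def Let_def
        by (simp add: int_qnum)
    next
      case 2
      note k = card_ups_outside[OF U W x, folded 2]
      have m: "vd (carrier V) - vd U = ?c + (vd (carrier V) - vd (U \<boxplus> W))" using dm by simp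
      show ?thesis unfolding eq cp[OF refl refl refl] k m
        using True 2 dm(1,2) pos_props[OF U W] unfolding y'(1) lab_def up_coeff_def Let_def
        by simp
    next
      case 3
      then have "ups U W a = {}" using ups_empty[OF U W] by blast
      then have "{H \<in> ups U W a. pos H W x = D} = {}" by blast
      then have "card {H \<in> ups U W a. pos H W x = D} = 0" by (simp only: card.empty)
      then show ?thesis unfolding eq using 3 unfolding y'(1) lab_def up_coeff_def by simp
    qed
  qed
qed

lemma card_down:
  assumes U: "sub U" and W: "sub W" and x: "x \<in> carrier V" and y: "y \<in> Xi (vd (carrier V))"
  shows "int (card {H. sub H \<and> H \<subseteq> U \<and> vd H + 1 = vd U \<and> lab H W x = y}) = down_coeff (int q) y (lab U W x)"
proof -
  obtain a b c e D where y': "y = (mat2 a b c e, D)" "a + b + c + e = vd (carrier V)" "admissible a b c e D"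
    using y by (rule Xi_cases)
  have D: "D \<in> deltas" using y'(3) unfolding admissible_def by blast
  note dm = dims[OF U W]
  let ?a = "vd (U \<inter> W)"
  have UUW: "x \<in> U \<Longrightarrow> x \<in> U \<boxplus> W" using sum_upper1[OF U W] by blast
  show ?thesis
  proof (cases "a + b + 1 = vd U \<and> a + c = vd W")
    case False
    then have "{H. sub H \<and> H \<subseteq> U \<and> vd H + 1 = vd U \<and> lab H W x = y} = {}"
      unfolding y'(1) using lab_iff[OF _ W y'(2), of _ x D] by auto
    then have "card {H. sub H \<and> H \<subseteq> U \<and> vd H + 1 = vd U \<and> lab H W x = y} = 0" by (simp only: card.empty)
    then show ?thesis using False dm unfolding y'(1) lab_def down_coeff_def by auto
  next
    case True
    have eq: "{H. sub H \<and> H \<subseteq> U \<and> vd H + 1 = vd U \<and> lab H W x = y} = {H \<in> downs U W a. pos H W x = D}"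
      unfolding y'(1) downs_def using lab_iff[OF _ W y'(2), of _ x D] True by auto
    have F: "\<forall>H\<in>downs U W a. sub H" unfolding downs_def by blast
    note cp = card_pos[OF finite_downs F U W D]
    consider "a = ?a" | "a + 1 = ?a" | "a \<noteq> ?a" "a + 1 \<noteq> ?a" by blast
    then show ?thesis
    proof cases
      case 1
      note k = card_downs_containing[OF U W x, folded 1]
      show ?thesis unfolding eq cp[OF refl refl refl] k
        using True 1 dm pos_props[OF U W] unfolding y'(1) lab_def down_coeff_def Let_def
        by (simp add: int_qnum)
    next
      case 2
      note k = card_downs_not_containing[OF U W x 2]
      show ?thesis unfolding eq cp[OF refl refl refl] k
        using True 2 dm pos_props[OF U W] unfolding y'(1) lab_def down_coeff_def Let_def
        by simp
    next
      case 3
      then have "downs U W a = {}" using downs_empty[OF U W] by blast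
      then have "{H \<in> downs U W a. pos H W x = D} = {}" by blast
      then have "card {H \<in> downs U W a. pos H W x = D} = 0" by (simp only: card.empty)
      then show ?thesis unfolding eq using 3 unfolding y'(1) lab_def down_coeff_def by simp
    qed
  qed
qed

end

section \<open>Orbits are determined by their labels\<close>

definition block :: "nat \<Rightarrow> nat \<Rightarrow> nat \<Rightarrow> (nat \<times> nat \<times> nat) set" where
  "block i j n = (\<lambda>m. (i, j, m)) ` {1..n}"

lemma card_block: "card (block i j n) = n"
  unfolding block_def by (subst card_image) (auto intro: inj_onI)

lemma basis_index_blocks:
  "basis_index (mat2 a b c e) = block 1 1 a \<union> block 1 2 b \<union> block 2 1 c \<union> block 2 2 e" (is "?I = ?B")
  "{(i, j, m) \<in> basis_index (mat2 a b c e). i \<le> 1} = block 1 1 a \<union> block 1 2 b" (is "?I1 = ?B1")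
  "{(i, j, m) \<in> basis_index (mat2 a b c e). j \<le> 1} = block 1 1 a \<union> block 2 1 c" (is "?I2 = ?B2")
proof -
  have mem: "(i, j, m) \<in> ?I \<longleftrightarrow> (i = 1 \<or> i = 2) \<and> (j = 1 \<or> j = 2) \<and> 0 < m \<and> m \<le> mat2 a b c e i j" for i j m
    unfolding basis_index_def by auto
  have blk: "(i, j, m) \<in> block k l n \<longleftrightarrow> i = k \<and> j = l \<and> 0 < m \<and> m \<le> n" for i j m k l n
    unfolding block_def by auto
  have mem': "(i, j, m) \<in> ?I \<longleftrightarrow> (i, j, m) \<in> ?B" for i j m
    unfolding mem Un_iff blk by auto
  show I: "?I = ?B" using mem' by (auto simp only: set_eq_iff split_paired_all)
  have "(i, j, m) \<in> ?I1 \<longleftrightarrow> (i, j, m) \<in> ?B1" for i j m unfolding I by (auto simp: blk)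
  then show "?I1 = ?B1" by (auto simp only: set_eq_iff split_paired_all)
  have "(i, j, m) \<in> ?I2 \<longleftrightarrow> (i, j, m) \<in> ?B2" for i j m unfolding I by (auto simp: blk)
  then show "?I2 = ?B2" by (auto simp only: set_eq_iff split_paired_all)
qed

lemma block_disjoint: "(i, j) \<noteq> (k, l) \<Longrightarrow> block i j m \<inter> block k l n = {}"
  unfolding block_def by auto

lemma enumerate_marked:
  assumes "finite B" "M \<subseteq> B" "M = {} \<or> (\<exists>x. M = {x})"
  shows "\<exists>h. bij_betw h {1..card B} B \<and> (\<forall>x\<in>M. h 1 = x)"
proof -
  obtain h where h: "bij_betw h {1..card B} B" using ex_bij_betw_nat_finite_1[OF assms(1)] by blast
  show ?thesis
  proof (cases "M = {}")
    case False
    then obtain x where x: "M = {x}" "x \<in> B" using assms by blast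
    then obtain k where k: "k \<in> {1..card B}" "h k = x" using h unfolding bij_betw_def by (metis imageE)
    have "bij_betw (Transposition.transpose 1 k) {1..card B} {1..card B}"
      using k(1) by (intro permutes_imp_bij permutes_swap_id) auto
    then have "bij_betw (h \<circ> Transposition.transpose 1 k) {1..card B} B" using h by (rule bij_betw_trans)
    then show ?thesis using x(1) k(2) by (intro exI[of _ "h \<circ> Transposition.transpose 1 k"]) simp
  qed (use h in blast)
qed

lemma shift_coeff_other: "A \<noteq> A' \<Longrightarrow> shift_coeff x (A, D) (A', D') = 0"
  by (simp add: shift_coeff_def)

context finite_vspace
begin

lemma span_union:
  assumes A: "A \<subseteq> carrier V" and B: "B \<subseteq> carrier V"
  shows "span (A \<union> B) = span A \<boxplus> span B"
proof
  note s = sub_span[OF A] sub_span[OF B]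
  have AB: "A \<union> B \<subseteq> carrier V" using A B by blast
  have "A \<subseteq> span A \<boxplus> span B" using in_own_span[OF A] sum_upper1[OF s] by (rule order_trans)
  moreover have "B \<subseteq> span A \<boxplus> span B" using in_own_span[OF B] sum_upper2[OF s] by (rule order_trans)
  ultimately have "A \<union> B \<subseteq> span A \<boxplus> span B" by (rule Un_least)
  then show "span (A \<union> B) \<subseteq> span A \<boxplus> span B" using sub_sum[OF s] by (rule span_least)
  show "span A \<boxplus> span B \<subseteq> span (A \<union> B)"
    by (rule sum_least[OF s sub_span[OF AB] span_is_monotone[OF Un_upper1] span_is_monotone[OF Un_upper2]])
qed

lemma vd_span_le: "finite A \<Longrightarrow> A \<subseteq> carrier V \<Longrightarrow> vd (span A) \<le> card A"
proof (induction A rule: finite_induct)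
  case empty
  show ?case using span_empty vd_bot by simp
next
  case (insert x A)
  have x: "x \<in> carrier V" and A: "A \<subseteq> carrier V" using insert.prems by blast+
  have "vd (span {x}) \<le> 1"
  proof (cases "x = \<zero>")
    case True
    then have "vd (span {x}) \<le> 0"
      using vd_mono[OF sub_line[OF x] sub_bot] line_least[OF sub_bot] vd_bot by simp
    then show ?thesis by simp
  qed (use vd_line[OF x] in simp)
  moreover have "span (insert x A) = span A \<boxplus> span {x}" using span_union[OF A, of "{x}"] x by simp
  ultimately show ?case
    using vd_sum_Int[OF sub_span[OF A] sub_line[OF x]] insert.IH[OF A] insert.hyps by simp
qed

text \<open>A spanning set with at most as many elements as the dimension has no superfluous vector.\<close>
lemma indpt_of_card:
  assumes X: "finite X" "X \<subseteq> carrier V" and c: "card X \<le> vd (span X)" shows "lin_indpt X"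
proof
  assume "lin_dep X"
  then obtain x where x: "x \<in> X" "x \<in> span (X - {x})" using lindep_span[OF X(2,1)] by blast
  have s: "X - {x} \<subseteq> carrier V" "finite (X - {x})" using X by blast+
  have "X - {x} \<union> {x} = X" using x(1) by blast
  then have "span (X - {x}) = span X" using already_in_span[OF s(1) x(2)] by simp
  then have "vd (span X) \<le> card (X - {x})" using vd_span_le[OF s(2,1)] by simp
  then show False using c x(1) X(1) card_Diff1_less[OF X(1) x(1)] by linarith
qed

lemma indpt_span_mem:
  assumes X: "X \<subseteq> carrier V" "lin_indpt X" and Y: "Y \<subseteq> X" and x: "x \<in> X"
  shows "x \<in> span Y \<longleftrightarrow> x \<in> Y"
proof
  have YV: "Y \<subseteq> carrier V" using X Y by blast
  show "x \<in> span Y" if "x \<in> Y" using in_own_span[OF YV] that by blast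
  show "x \<in> Y" if s: "x \<in> span Y"
  proof (rule ccontr)
    assume n: "x \<notin> Y"
    have "lin_indpt Y" using subset_li_is_li[OF X(2) Y] .
    moreover have "x \<in> carrier V" using X x by blast
    ultimately have "lin_dep (Y \<union> {x})" using lin_dep_iff_in_span[of Y x] YV n s by metis
    moreover have "Y \<union> {x} \<subseteq> X" using Y x by blast
    ultimately have "lin_dep X" by (rule supset_ld_is_ld)
    then show False using X(2) by contradiction
  qed
qed

lemma extend_marked:
  assumes S: "sub S" and A: "A \<subseteq> S" "lin_indpt A" and M: "P \<Longrightarrow> x \<in> S" "P \<Longrightarrow> x \<notin> span A"
  obtains B where "A \<subseteq> B" "P \<longrightarrow> x \<in> B" "B \<subseteq> S" "lin_indpt B" "span B = S"
proof -
  have AV: "A \<subseteq> carrier V" using A sub_carrier[OF S] by blast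
  let ?A = "if P then A \<union> {x} else A"
  have "?A \<subseteq> S \<and> lin_indpt ?A"
  proof (cases P)
    case True
    have "x \<notin> A" using in_own_span[OF AV] M(2)[OF True] by blast
    then have "lin_indpt (A \<union> {x})" using lin_dep_iff_in_span[OF AV A(2) sub_mem[OF S M(1)[OF True]]] M(2)[OF True] by metis
    then show ?thesis using M(1)[OF True] A True by simp
  qed (use A in simp)
  then have m: "?A \<subseteq> S" "lin_indpt ?A" by blast+
  obtain B where B: "?A \<subseteq> B" "B \<subseteq> S" "lin_indpt B" "span B = S"
    by (rule extend_basis[OF S m])
  have "A \<subseteq> ?A" by auto
  then have "A \<subseteq> B" using B(1) by (rule order_trans)
  moreover have "P \<longrightarrow> x \<in> B" using B(1) by (cases P) simp_all
  ultimately show ?thesis using that B(2-4) by metis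
qed

text \<open>The four parts of an adapted basis without their enumeration.\<close>
definition split_basis :: "'v set \<Rightarrow> 'v set \<Rightarrow> 'v set \<Rightarrow> 'v set \<Rightarrow> bool" where
  "split_basis X11 X12 X21 X22 \<longleftrightarrow> basis (X11 \<union> X12 \<union> X21 \<union> X22) \<and> finite (X11 \<union> X12 \<union> X21 \<union> X22)
     \<and> X11 \<inter> X12 = {} \<and> X11 \<inter> X21 = {} \<and> X11 \<inter> X22 = {} \<and> X12 \<inter> X21 = {} \<and> X12 \<inter> X22 = {} \<and> X21 \<inter> X22 = {}"

lemma split_basis_dims:
  assumes sb: "split_basis X11 X12 X21 X22"
  defines "X \<equiv> X11 \<union> X12 \<union> X21 \<union> X22" and "U \<equiv> span (X11 \<union> X12)" and "W \<equiv> span (X11 \<union> X21)"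
  shows "sub U" "sub W" "U \<boxplus> W = span (X11 \<union> X12 \<union> X21)"
    "vd (U \<inter> W) = card X11" "vd U = card X11 + card X12" "vd W = card X11 + card X21"
    "vd (carrier V) = card X11 + card X12 + card X21 + card X22"
proof -
  have b: "lin_indpt X" "span X = carrier V" "X \<subseteq> carrier V" "finite X"
    using sb unfolding split_basis_def basis_def X_def by blast+
  have dis: "X11 \<inter> X12 = {}" "X11 \<inter> X21 = {}" "(X11 \<union> X12) \<inter> X21 = {}" "(X11 \<union> X12 \<union> X21) \<inter> X22 = {}"
    using sb unfolding split_basis_def by blast+
  have fin: "finite X11" "finite X12" "finite X21" "finite X22" using b(4) unfolding X_def by simp_all
  have c: "vd (span Y) = card Y" if Y: "Y \<subseteq> X" for Y
    using vd_span[OF finite_subset[OF Y b(4)] _ subset_li_is_li[OF b(1) Y]] Y b(3) by blast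
  have s: "X11 \<union> X12 \<subseteq> carrier V" "X11 \<union> X21 \<subseteq> carrier V" using b(3) unfolding X_def by blast+
  show U: "sub U" and W: "sub W" unfolding U_def W_def using sub_span s by blast+
  have "(X11 \<union> X12) \<union> (X11 \<union> X21) = X11 \<union> X12 \<union> X21" by blast
  then show UW: "U \<boxplus> W = span (X11 \<union> X12 \<union> X21)" unfolding U_def W_def using span_union[OF s] by simp
  have "vd U = card (X11 \<union> X12)" unfolding U_def by (rule c) (auto simp: X_def)
  then show 1: "vd U = card X11 + card X12" using card_Un_disjoint[OF fin(1,2) dis(1)] by simp
  have "vd W = card (X11 \<union> X21)" unfolding W_def by (rule c) (auto simp: X_def)
  then show 2: "vd W = card X11 + card X21" using card_Un_disjoint[OF fin(1,3) dis(2)] by simp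
  have 4: "card (X11 \<union> X12 \<union> X21) = card X11 + card X12 + card X21"
    using card_Un_disjoint[OF _ fin(3) dis(3)] card_Un_disjoint[OF fin(1,2) dis(1)] fin by simp
  have "vd (U \<boxplus> W) = card (X11 \<union> X12 \<union> X21)" unfolding UW by (rule c) (auto simp: X_def)
  then have 3: "vd (U \<boxplus> W) = card X11 + card X12 + card X21" using 4 by simp
  show "vd (U \<inter> W) = card X11" using vd_sum_Int[OF U W] 1 2 3 by simp
  have "vd (carrier V) = card X" using c[of X] b(2) by simp
  then show "vd (carrier V) = card X11 + card X12 + card X21 + card X22"
    using card_Un_disjoint[OF _ fin(4) dis(4)] fin 4 unfolding X_def by simp
qed

definition marked_vector :: "'v \<Rightarrow> (nat \<times> nat) set \<Rightarrow> (nat \<Rightarrow> nat \<Rightarrow> 'v) \<Rightarrow> bool" where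
  "marked_vector v D t \<longleftrightarrow> v = (if D = {(1, 2), (2, 1)} then t 1 2 \<oplus> t 2 1 else
     if D = {} then \<zero> else if D = {(1, 1)} then t 1 1 else if D = {(1, 2)} then t 1 2
     else if D = {(2, 1)} then t 2 1 else t 2 2)"

text \<open>A basis vector lies in the span of a part of the basis only if it belongs to that part; this
  answers the questions that define the position.\<close>
lemma split_basis_pos:
  assumes sb: "split_basis X11 X12 X21 X22" and D: "D \<in> deltas" and v: "marked_vector v D t"
    and t: "(1, 1) \<in> D \<Longrightarrow> t 1 1 \<in> X11" "(1, 2) \<in> D \<Longrightarrow> t 1 2 \<in> X12"
      "(2, 1) \<in> D \<Longrightarrow> t 2 1 \<in> X21" "(2, 2) \<in> D \<Longrightarrow> t 2 2 \<in> X22"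
  shows "pos (span (X11 \<union> X12)) (span (X11 \<union> X21)) v = D"
proof -
  let ?X = "X11 \<union> X12 \<union> X21 \<union> X22" and ?U = "span (X11 \<union> X12)" and ?W = "span (X11 \<union> X21)"
  have b: "lin_indpt ?X" "?X \<subseteq> carrier V" using sb unfolding split_basis_def basis_def by blast+
  note dm = split_basis_dims[OF sb]
  have nz: "\<zero> \<notin> ?X" using vs_zero_lin_dep[OF b(2,1)] .
  have dis: "X11 \<inter> X12 = {}" "X11 \<inter> X21 = {}" "X11 \<inter> X22 = {}" "X12 \<inter> X21 = {}" "X12 \<inter> X22 = {}" "X21 \<inter> X22 = {}"
    using sb unfolding split_basis_def by blast+
  have mU: "x \<in> ?U \<longleftrightarrow> x \<in> X11 \<union> X12" and mW: "x \<in> ?W \<longleftrightarrow> x \<in> X11 \<union> X21"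
    and mS: "x \<in> ?U \<boxplus> ?W \<longleftrightarrow> x \<in> X11 \<union> X12 \<union> X21" if "x \<in> ?X" for x
    unfolding dm(3) by (rule indpt_span_mem[OF b(2,1) _ that]; blast)+
  consider "D = {}" | "D = {(1, 1)}" | "D = {(1, 2)}" | "D = {(2, 1)}" | "D = {(1, 2), (2, 1)}" | "D = {(2, 2)}"
    using D unfolding deltas_def by blast
  then show ?thesis
  proof cases
    case 1
    then show ?thesis using v unfolding marked_vector_def pos_def by simp
  next
    case 2
    have "t 1 1 \<in> X11" "v = t 1 1" using t(1) v 2 unfolding marked_vector_def by (simp_all add: doubleton_eq_iff)
    then have "v \<in> X11" by simp
    then have "v \<noteq> \<zero>" "v \<in> ?U" "v \<in> ?W" using mU[of v] mW[of v] nz by blast+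
    then show ?thesis using 2 unfolding pos_def by simp
  next
    case 3
    have "t 1 2 \<in> X12" "v = t 1 2" using t(2) v 3 unfolding marked_vector_def by (simp_all add: doubleton_eq_iff)
    then have "v \<in> X12" by simp
    then have "v \<noteq> \<zero>" "v \<in> ?U" "v \<notin> ?W" using mU[of v] mW[of v] nz dis by blast+
    then show ?thesis using 3 unfolding pos_def by simp
  next
    case 4
    have "t 2 1 \<in> X21" "v = t 2 1" using t(3) v 4 unfolding marked_vector_def by (simp_all add: doubleton_eq_iff)
    then have "v \<in> X21" by simp
    then have "v \<noteq> \<zero>" "v \<notin> ?U" "v \<in> ?W" using mU[of v] mW[of v] nz dis by blast+
    then show ?thesis using 4 unfolding pos_def by simp
  next
    case 5
    let ?u = "t 1 2" and ?w = "t 2 1"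
    have u: "?u \<in> X12" and w: "?w \<in> X21" and vuw: "v = ?u \<oplus> ?w"
      using t(2,3) v 5 unfolding marked_vector_def by simp_all
    have uU: "?u \<in> ?U" "?u \<notin> ?W" "?w \<in> ?W" "?w \<notin> ?U"
      using mU[of ?u] mW[of ?u] mU[of ?w] mW[of ?w] u w dis by blast+
    have uwV: "?u \<in> carrier V" "?w \<in> carrier V" using u w b(2) by blast+
    have 1: "v \<notin> ?U" unfolding vuw using sub_add_iff[OF dm(1) uU(1) uwV(2)] uU by blast
    have 2: "v \<notin> ?W" unfolding vuw M.a_comm[OF uwV] using sub_add_iff[OF dm(2) uU(3) uwV(1)] uU by blast
    have 3: "v \<in> ?U \<boxplus> ?W" unfolding sum_iff using vuw uU by blast
    have "v \<noteq> \<zero>" using 1 sub_zero[OF dm(1)] by blast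
    then show ?thesis using 5 1 2 3 unfolding pos_def by simp
  next
    case 6
    have "t 2 2 \<in> X22" "v = t 2 2" using t(4) v 6 unfolding marked_vector_def by (simp_all add: doubleton_eq_iff)
    then have "v \<in> X22" by simp
    then have "v \<noteq> \<zero>" "v \<notin> ?U" "v \<notin> ?W" "v \<notin> ?U \<boxplus> ?W"
      using mU[of v] mW[of v] mS[of v] nz dis by blast+
    then show ?thesis using 6 unfolding pos_def by simp
  qed
qed

text \<open>A basis of \<open>U \<inter> W\<close> is extended to one of \<open>U\<close> and to one of \<open>W\<close>; by the dimension formula
  their union is a basis of \<open>U + W\<close>, which is extended to the whole space. At the step that belongs to a
  position in \<open>\<Delta>\<close> the extension starts with the vector prescribed there. For
  \<open>\<Delta> = {(1, 2), (2, 1)}\<close> these are the two components of \<open>x \<in> U + W\<close>.\<close>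
lemma split_basis_exists:
  assumes U: "sub U" and W: "sub W" and x: "x \<in> carrier V"
  obtains X11 X12 X21 X22 t where "split_basis X11 X12 X21 X22" "U = span (X11 \<union> X12)" "W = span (X11 \<union> X21)"
    "marked_vector x (pos U W x) t"
    "(1, 1) \<in> pos U W x \<Longrightarrow> t 1 1 \<in> X11" "(1, 2) \<in> pos U W x \<Longrightarrow> t 1 2 \<in> X12"
    "(2, 1) \<in> pos U W x \<Longrightarrow> t 2 1 \<in> X21" "(2, 2) \<in> pos U W x \<Longrightarrow> t 2 2 \<in> X22"
proof -
  let ?D = "pos U W x"
  have "\<exists>t. marked_vector x ?D t \<and> ((1, 1) \<in> ?D \<longrightarrow> t 1 1 \<in> U \<inter> W \<and> t 1 1 \<noteq> \<zero>)
    \<and> ((1, 2) \<in> ?D \<longrightarrow> t 1 2 \<in> U \<and> t 1 2 \<notin> U \<inter> W) \<and> ((2, 1) \<in> ?D \<longrightarrow> t 2 1 \<in> W \<and> t 2 1 \<notin> U \<inter> W)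
    \<and> ((2, 2) \<in> ?D \<longrightarrow> t 2 2 \<in> carrier V \<and> t 2 2 \<notin> U \<boxplus> W)"
  proof (cases "?D = {(1, 2), (2, 1)}")
    case True
    then have n: "x \<notin> U" "x \<notin> W" and s: "x \<in> U \<boxplus> W" unfolding pos_def by (auto split: if_splits simp: doubleton_eq_iff)
    obtain u w where uw: "u \<in> U" "w \<in> W" "x = u \<oplus> w" using s unfolding sum_iff by blast
    have "u \<notin> W" "w \<notin> U" using n sub_add[OF U uw(1)] sub_add[OF W _ uw(2)] uw(3) by blast+
    then show ?thesis using True uw unfolding marked_vector_def
      by (intro exI[of _ "\<lambda>i j. if i = 1 then u else w"]) simp
  next
    case False
    then show ?thesis using x unfolding marked_vector_def
      by (intro exI[of _ "\<lambda>i j. x"]) (auto simp: pos_def doubleton_eq_iff split: if_splits)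
  qed
  then obtain t where t: "marked_vector x ?D t"
     "(1, 1) \<in> ?D \<Longrightarrow> t 1 1 \<in> U \<inter> W" "(1, 1) \<in> ?D \<Longrightarrow> t 1 1 \<noteq> \<zero>"
     "(1, 2) \<in> ?D \<Longrightarrow> t 1 2 \<in> U" "(1, 2) \<in> ?D \<Longrightarrow> t 1 2 \<notin> U \<inter> W"
     "(2, 1) \<in> ?D \<Longrightarrow> t 2 1 \<in> W" "(2, 1) \<in> ?D \<Longrightarrow> t 2 1 \<notin> U \<inter> W"
     "(2, 2) \<in> ?D \<Longrightarrow> t 2 2 \<in> carrier V" "(2, 2) \<in> ?D \<Longrightarrow> t 2 2 \<notin> U \<boxplus> W" by blast
  note UW = sub_Int[OF U W]
  have "lin_indpt {}" by (auto simp: lin_dep_def)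
  have sp0: "(1, 1) \<in> ?D \<Longrightarrow> t 1 1 \<notin> span {}" using t(3) span_empty by simp
  obtain B0 where "{} \<subseteq> B0" and B0: "(1, 1) \<in> ?D \<longrightarrow> t 1 1 \<in> B0" "B0 \<subseteq> U \<inter> W" "lin_indpt B0" "span B0 = U \<inter> W"
    by (rule extend_marked[OF UW empty_subsetI \<open>lin_indpt {}\<close> t(2) sp0])
  have B0s: "B0 \<subseteq> U" "B0 \<subseteq> W" using B0(2) by blast+
  obtain B1 where B1: "B0 \<subseteq> B1" "(1, 2) \<in> ?D \<longrightarrow> t 1 2 \<in> B1" "B1 \<subseteq> U" "lin_indpt B1" "span B1 = U"
    by (rule extend_marked[OF U B0s(1) B0(3) t(4) t(5)[folded B0(4)]])
  obtain B2 where B2: "B0 \<subseteq> B2" "(2, 1) \<in> ?D \<longrightarrow> t 2 1 \<in> B2" "B2 \<subseteq> W" "lin_indpt B2" "span B2 = W"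
    by (rule extend_marked[OF W B0s(2) B0(3) t(6) t(7)[folded B0(4)]])
  have B1V: "B1 \<subseteq> carrier V" and B2V: "B2 \<subseteq> carrier V" using B1(3) B2(3) sub_carrier[OF U] sub_carrier[OF W] by blast+
  have B12V: "B1 \<union> B2 \<subseteq> carrier V" using B1V B2V by blast
  have f1: "finite B1" "finite B2" using finite_subset[OF B1V] finite_subset[OF B2V] finite_vectors by blast+
  have "B1 \<inter> B2 \<subseteq> B0"
  proof
    fix y assume y: "y \<in> B1 \<inter> B2"
    then have "y \<in> span B0" using B0(4) B1(3) B2(3) by blast
    then show "y \<in> B0" using indpt_span_mem[OF B1V B1(4) B1(1)] y by blast
  qed
  then have B12: "B1 \<inter> B2 = B0" using B1(1) B2(1) by blast
  have sp: "span (B1 \<union> B2) = U \<boxplus> W" using span_union[OF B1V B2V] B1(5) B2(5) by simp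
  have "lin_indpt (B1 \<union> B2)"
  proof (rule indpt_of_card[OF _ B12V])
    show "finite (B1 \<union> B2)" using f1 by simp
    have "card B1 = vd U" "card B2 = vd W" "card B0 = vd (U \<inter> W)"
      using vd_span[OF f1(1) B1V B1(4)] vd_span[OF f1(2) B2V B2(4)] B1(5) B2(5)
        vd_span[OF finite_subset[OF B1(1) f1(1)] _ B0(3)] B0(4) B1(1) B1V by auto
    then show "card (B1 \<union> B2) \<le> vd (span (B1 \<union> B2))"
      using card_Un_Int[OF f1] B12 vd_sum_Int[OF U W] unfolding sp by simp
  qed
  then obtain B3 where B3: "B1 \<union> B2 \<subseteq> B3" "(2, 2) \<in> ?D \<longrightarrow> t 2 2 \<in> B3" "B3 \<subseteq> carrier V" "lin_indpt B3" "span B3 = carrier V"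
    by (rule extend_marked[OF sub_top B12V _ t(8) t(9)[folded sp]])
  have un: "B0 \<union> (B1 - B0) \<union> (B2 - B0) \<union> (B3 - (B1 \<union> B2)) = B3" using B1(1) B2(1) B3(1) by blast
  have "split_basis B0 (B1 - B0) (B2 - B0) (B3 - (B1 \<union> B2))"
    unfolding split_basis_def un basis_def using B3 B12 B1(1) finite_subset[OF B3(3) finite_vectors] by blast
  moreover have "B0 \<union> (B1 - B0) = B1" "B0 \<union> (B2 - B0) = B2" using B1(1) B2(1) by blast+
  moreover have "t 1 2 \<in> B1 - B0" if "(1, 2) \<in> ?D" using mp[OF B1(2) that] t(5)[OF that] B0(2) by blast
  moreover have "t 2 1 \<in> B2 - B0" if "(2, 1) \<in> ?D" using mp[OF B2(2) that] t(7)[OF that] B0(2) by blast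
  moreover have "t 2 2 \<in> B3 - (B1 \<union> B2)" if "(2, 2) \<in> ?D"
    using mp[OF B3(2) that] t(9)[OF that] in_own_span[OF B12V] sp by blast
  ultimately show ?thesis
    using that[of B0 "B1 - B0" "B2 - B0" "B3 - (B1 \<union> B2)" t] t(1) B0(1) B1(5) B2(5) by metis
qed


lemma finsum_marked:
  assumes D: "D \<in> deltas" and t: "\<And>i j. (i, j) \<in> D \<Longrightarrow> t i j \<in> carrier V"
  shows "marked_vector v D t \<longleftrightarrow> v = finsum V (\<lambda>(i, j). t i j) D"
proof -
  have one: "finsum V (\<lambda>(i, j). t i j) {(k, l)} = t k l" if "t k l \<in> carrier V" for k l
    using that by (simp add: M.finsum_insert[of "{}"])
  consider "D = {}" | "D = {(1, 1)}" | "D = {(1, 2)}" | "D = {(2, 1)}" | "D = {(1, 2), (2, 1)}" | "D = {(2, 2)}"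
    using D unfolding deltas_def by blast
  then show ?thesis
  proof cases
    case 5
    have c: "t 1 2 \<in> carrier V" "t 2 1 \<in> carrier V" using t 5 by simp_all
    have "finsum V (\<lambda>(i, j). t i j) D = t 1 2 \<oplus> finsum V (\<lambda>(i, j). t i j) {(2, 1)}"
      unfolding 5 using c by (subst M.finsum_insert) auto
    then show ?thesis using one[OF c(2)] 5 unfolding marked_vector_def by simp
  next
    case 1 then show ?thesis unfolding marked_vector_def by simp
  next
    case 2 then show ?thesis using one[of 1 1] t[of 1 1] unfolding marked_vector_def by (simp add: doubleton_eq_iff)
  next
    case 3 then show ?thesis using one[of 1 2] t[of 1 2] unfolding marked_vector_def by (simp add: doubleton_eq_iff)
  next
    case 4 then show ?thesis using one[of 2 1] t[of 2 1] unfolding marked_vector_def by (simp add: doubleton_eq_iff)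
  next
    case 6 then show ?thesis using one[of 2 2] t[of 2 2] unfolding marked_vector_def by (simp add: doubleton_eq_iff)
  qed
qed

text \<open>The condition on a basis in the description of an orbit, for the pair of subspaces
  \<open>F\<^sub>1 = U\<close>, \<open>F'\<^sub>1 = W\<close> instead of the flags.\<close>
definition adapted :: "(nat \<Rightarrow> nat \<Rightarrow> nat) \<Rightarrow> (nat \<times> nat) set \<Rightarrow> 'v set \<Rightarrow> 'v set \<Rightarrow> 'v \<Rightarrow> (nat \<times> nat \<times> nat \<Rightarrow> 'v) \<Rightarrow> bool" where
  "adapted A D U W v \<beta> \<longleftrightarrow> inj_on \<beta> (basis_index A) \<and> basis (\<beta> ` basis_index A)
     \<and> U = span (\<beta> ` {(i, j, m) \<in> basis_index A. i \<le> 1}) \<and> W = span (\<beta> ` {(i, j, m) \<in> basis_index A. j \<le> 1})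
     \<and> v = finsum V (\<lambda>(i, j). \<beta> (i, j, 1)) D"

lemma adapted_imp_lab:
  assumes ad: "adapted (mat2 a b c e) D U W v \<beta>" and adm: "admissible a b c e D"
  shows "sub U" "sub W" "v \<in> carrier V" "lab U W v = (mat2 a b c e, D)"
proof -
  let ?I = "basis_index (mat2 a b c e)"
  let ?X11 = "\<beta> ` block 1 1 a" and ?X12 = "\<beta> ` block 1 2 b" and ?X21 = "\<beta> ` block 2 1 c" and ?X22 = "\<beta> ` block 2 2 e"
  have inj: "inj_on \<beta> ?I" and ba: "basis (\<beta> ` ?I)"
    and U: "U = span (?X11 \<union> ?X12)" and W: "W = span (?X11 \<union> ?X21)"
    and v: "v = finsum V (\<lambda>(i, j). \<beta> (i, j, 1)) D"
    using ad unfolding adapted_def basis_index_blocks(2,3) by (simp_all add: image_Un)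
  have I: "?I = block 1 1 a \<union> block 1 2 b \<union> block 2 1 c \<union> block 2 2 e" by (rule basis_index_blocks)
  have img: "\<beta> ` ?I = ?X11 \<union> ?X12 \<union> ?X21 \<union> ?X22" unfolding I by (simp add: image_Un)
  have bs: "block 1 1 a \<subseteq> ?I" "block 1 2 b \<subseteq> ?I" "block 2 1 c \<subseteq> ?I" "block 2 2 e \<subseteq> ?I" unfolding I by blast+
  have dis: "\<beta> ` A \<inter> \<beta> ` B = {}" if "A \<subseteq> ?I" "B \<subseteq> ?I" "A \<inter> B = {}" for A B
    using inj_on_image_Int[OF inj that(1,2)] that(3) by simp
  have "finite (block i j n)" for i j n unfolding block_def by simp
  then have sb: "split_basis ?X11 ?X12 ?X21 ?X22"
    unfolding split_basis_def using ba unfolding img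
    using dis[OF bs(1,2)] dis[OF bs(1,3)] dis[OF bs(1,4)] dis[OF bs(2,3)] dis[OF bs(2,4)] dis[OF bs(3,4)]
    by (simp add: block_disjoint)
  have cX: "card ?X11 = a" "card ?X12 = b" "card ?X21 = c" "card ?X22 = e"
    using card_image[OF inj_on_subset[OF inj]] bs by (simp_all add: card_block)
  note dm = split_basis_dims[OF sb, folded U W, unfolded cX]
  show sU: "sub U" and sW: "sub W" using dm by blast+
  have bV: "\<beta> ` ?I \<subseteq> carrier V" using ba unfolding basis_def by blast
  have DI: "(i, j, 1) \<in> block i j (mat2 a b c e i j)" if "(i, j) \<in> D" for i j
    using adm that unfolding admissible_def block_def by fastforce
  have D: "D \<in> deltas" using adm unfolding admissible_def by blast
  have Dsub: "(i, j) = (1, 1) \<or> (i, j) = (1, 2) \<or> (i, j) = (2, 1) \<or> (i, j) = (2, 2)" if "(i, j) \<in> D" for i j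
    using D that unfolding deltas_def by auto
  have tV: "\<beta> (i, j, 1) \<in> carrier V" if "(i, j) \<in> D" for i j
    proof -
    have "(i, j, 1) \<in> ?I" using adm that Dsub[OF that] unfolding admissible_def basis_index_def by auto
    then show ?thesis using bV by blast
  qed
  have mv: "marked_vector v D (\<lambda>i j. \<beta> (i, j, 1))"
    using finsum_marked[OF D, of "\<lambda>i j. \<beta> (i, j, 1)" v] tV v by blast
  have "pos U W v = D" unfolding U W
    by (rule split_basis_pos[OF sb D mv]) (use DI in \<open>force+\<close>)
  then show "lab U W v = (mat2 a b c e, D)"
    by (simp add: lab_iff[OF sU sW dm(7)[symmetric]] dm)
  show "v \<in> carrier V" unfolding v by (rule M.finsum_closed) (use tV in auto)
qed

lemma adapted_exists:
  assumes U: "sub U" and W: "sub W" and v: "v \<in> carrier V"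
  shows "\<exists>\<beta>. adapted (fst (lab U W v)) (snd (lab U W v)) U W v \<beta>"
proof -
  let ?D = "pos U W v"
  obtain X11 X12 X21 X22 t where sb: "split_basis X11 X12 X21 X22" and UX: "U = span (X11 \<union> X12)" and WX: "W = span (X11 \<union> X21)"
    and mv: "marked_vector v ?D t"
    and t: "(1, 1) \<in> ?D \<Longrightarrow> t 1 1 \<in> X11" "(1, 2) \<in> ?D \<Longrightarrow> t 1 2 \<in> X12"
    "(2, 1) \<in> ?D \<Longrightarrow> t 2 1 \<in> X21" "(2, 2) \<in> ?D \<Longrightarrow> t 2 2 \<in> X22"
    using split_basis_exists[OF U W v] by metis
  note dm = split_basis_dims[OF sb, folded UX WX]
  let ?a = "card X11" and ?b = "card X12" and ?c = "card X21" and ?e = "card X22"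
  have lab: "lab U W v = (mat2 ?a ?b ?c ?e, ?D)" by (simp add: lab_iff[OF U W dm(7)[symmetric]] dm)
  have fin: "finite X11" "finite X12" "finite X21" "finite X22"
    and ba: "basis (X11 \<union> X12 \<union> X21 \<union> X22)"
    and dis: "X11 \<inter> X12 = {}" "X11 \<inter> X21 = {}" "X11 \<inter> X22 = {}" "X12 \<inter> X21 = {}" "X12 \<inter> X22 = {}" "X21 \<inter> X22 = {}"
    using sb unfolding split_basis_def by simp_all
  have ex: "\<exists>h. bij_betw h {1..card X} X \<and> (P \<longrightarrow> h 1 = x)" if "finite X" "P \<Longrightarrow> x \<in> X" for X P and x :: 'v
    using enumerate_marked[OF that(1), of "if P then {x} else {}"] that(2) by (cases P) simp_all
  obtain h11 where h11: "bij_betw h11 {1..?a} X11" "(1, 1) \<in> ?D \<longrightarrow> h11 1 = t 1 1"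
    using ex[OF fin(1) t(1)] by blast
  obtain h12 where h12: "bij_betw h12 {1..?b} X12" "(1, 2) \<in> ?D \<longrightarrow> h12 1 = t 1 2"
    using ex[OF fin(2) t(2)] by blast
  obtain h21 where h21: "bij_betw h21 {1..?c} X21" "(2, 1) \<in> ?D \<longrightarrow> h21 1 = t 2 1"
    using ex[OF fin(3) t(3)] by blast
  obtain h22 where h22: "bij_betw h22 {1..?e} X22" "(2, 2) \<in> ?D \<longrightarrow> h22 1 = t 2 2"
    using ex[OF fin(4) t(4)] by blast
  note h = h11 h12 h21 h22
  define \<beta> :: "nat \<times> nat \<times> nat \<Rightarrow> 'v" where "\<beta> = (\<lambda>(i, j, m). if (i, j) = (1, 1) then h11 m else if (i, j) = (1, 2) then h12 m
    else if (i, j) = (2, 1) then h21 m else h22 m)"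
  have b: "\<beta> (1, 1, m) = h11 m" "\<beta> (1, 2, m) = h12 m" "\<beta> (2, 1, m) = h21 m" "\<beta> (2, 2, m) = h22 m" for m
    by (simp_all add: \<beta>_def)
  have img: "\<beta> ` block 1 1 ?a = X11" "\<beta> ` block 1 2 ?b = X12" "\<beta> ` block 2 1 ?c = X21" "\<beta> ` block 2 2 ?e = X22"
    unfolding block_def image_image b
    by (rule bij_betw_imp_surj_on[OF h(1)] bij_betw_imp_surj_on[OF h(3)] bij_betw_imp_surj_on[OF h(5)]
        bij_betw_imp_surj_on[OF h(7)])+
  have bi: "inj_on \<beta> (block 1 1 ?a)" "inj_on \<beta> (block 1 2 ?b)" "inj_on \<beta> (block 2 1 ?c)" "inj_on \<beta> (block 2 2 ?e)"
    unfolding block_def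
    by (rule inj_on_imageI, unfold o_def b, rule bij_betw_imp_inj_on, rule h(1) h(3) h(5) h(7))+
  let ?A = "mat2 ?a ?b ?c ?e"
  have I: "basis_index ?A = block 1 1 ?a \<union> block 1 2 ?b \<union> block 2 1 ?c \<union> block 2 2 ?e" by (rule basis_index_blocks)
  have inj: "inj_on \<beta> (basis_index ?A)"
  proof -
    have inj_Un: "inj_on \<beta> (A \<union> B)" if "inj_on \<beta> A" "inj_on \<beta> B" "\<beta> ` A \<inter> \<beta> ` B = {}" for A B
      unfolding inj_on_Un using that by blast
    show ?thesis unfolding I
      by (intro inj_Un bi; simp only: image_Un img Int_Un_distrib2 dis Un_empty_left)
  qed
  have Dc: "(i, j) = (1, 1) \<or> (i, j) = (1, 2) \<or> (i, j) = (2, 1) \<or> (i, j) = (2, 2)" if "(i, j) \<in> ?D" for i j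
    using that pos_deltas[of U W v] unfolding deltas_def by auto
  have XV: "X11 \<union> X12 \<union> X21 \<union> X22 \<subseteq> carrier V" using ba unfolding basis_def by blast
  have tV: "t i j \<in> carrier V" if "(i, j) \<in> ?D" for i j
    using Dc[OF that] t that XV by blast
  have bt: "\<beta> (i, j, 1) = t i j" if "(i, j) \<in> ?D" for i j
    using Dc[OF that] that h(2,4,6,8) b(1)[of 1] b(2)[of 1] b(3)[of 1] b(4)[of 1] by auto
  have "v = finsum V (\<lambda>(i, j). t i j) ?D" using finsum_marked[OF pos_deltas, of U W v t v] tV mv by blast
  also have "\<dots> = finsum V (\<lambda>(i, j). \<beta> (i, j, 1)) ?D"
    by (rule M.finsum_cong'[OF refl]) (use tV bt in auto)
  finally have v': "v = finsum V (\<lambda>(i, j). \<beta> (i, j, 1)) ?D" .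
  have i0: "\<beta> ` basis_index ?A = X11 \<union> X12 \<union> X21 \<union> X22" unfolding I image_Un img ..
  have i1: "\<beta> ` {(i, j, m) \<in> basis_index ?A. i \<le> 1} = X11 \<union> X12" unfolding basis_index_blocks(2) image_Un img ..
  have i2: "\<beta> ` {(i, j, m) \<in> basis_index ?A. j \<le> 1} = X11 \<union> X21" unfolding basis_index_blocks(3) image_Un img ..
  have "adapted ?A ?D U W v \<beta>"
    unfolding adapted_def i0 i1 i2 by (intro conjI inj ba UX WX v')
  then show ?thesis unfolding lab fst_conv snd_conv by blast
qed

text \<open>The count behind \<open>x\<^sub>r * T\<^sub>y\<close>. Translating by \<open>u \<in> U\<close> changes neither the membership of \<open>x\<close> in
  \<open>U\<close> nor that in \<open>U + W\<close>, and \<open>card_fibre\<close> tells how often the translate lies in \<open>W\<close>. The vector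
  \<open>u = 0\<close>, which is excluded here, accounts for the last term of \<open>shift_coeff\<close>.\<close>
lemma card_shift:
  assumes U: "sub U" and W: "sub W" and x: "x \<in> carrier V" and y: "y \<in> Xi (vd (carrier V))"
  shows "int (card {u \<in> U. u \<noteq> \<zero> \<and> lab U W (x \<ominus> u) = y}) = shift_coeff (int q) y (lab U W x)"
proof -
  obtain a b c e D where y': "y = (mat2 a b c e, D)" "a + b + c + e = vd (carrier V)" "admissible a b c e D"
    using y by (rule Xi_cases)
  have D: "D \<in> deltas" using y'(3) unfolding admissible_def by blast
  have fl: "fst (lab U W z) = fst (lab U W x)" for z by (simp add: lab_def)
  have sl: "snd (lab U W z) = pos U W z" for z by (simp add: lab_def)
  show ?thesis
  proof (cases "fst (lab U W x) = mat2 a b c e")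
    case False
    then have "{u \<in> U. u \<noteq> \<zero> \<and> lab U W (x \<ominus> u) = y} = {}"
      unfolding y'(1) using fl by (metis (mono_tags, lifting) Collect_empty_eq fst_conv)
    then have "card {u \<in> U. u \<noteq> \<zero> \<and> lab U W (x \<ominus> u) = y} = 0" by (simp only: card.empty)
    moreover have "shift_coeff (int q) y (lab U W x) = 0"
      using shift_coeff_other[OF False[symmetric], of "int q" D "snd (lab U W x)"] y'(1) by simp
    ultimately show ?thesis by simp
  next
    case True
    let ?P = "{u \<in> U. pos U W (x \<ominus> u) = D}"
    have labeq: "lab U W z = y \<longleftrightarrow> pos U W z = D" for z 
      unfolding y'(1) prod_eq_iff fst_conv snd_conv fl[of z] sl[of z] using True by simp
    have "vd (U \<inter> W) = a" "vd U - vd (U \<inter> W) = b" using True unfolding lab_def fst_conv mat2_eq_iff by blast+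
    then have dm: "vd (U \<inter> W) = a" "vd U = a + b" using dims(1)[OF U W] by linarith+
    have x0: "x \<ominus> \<zero> = x" using x by (simp add: a_minus_def)
    have finU: "finite ?P" using sub_finite[OF U] by simp
    have "{u \<in> U. u \<noteq> \<zero> \<and> lab U W (x \<ominus> u) = y} = ?P - {\<zero>}" unfolding labeq by blast
    moreover have "\<zero> \<in> ?P \<longleftrightarrow> D = pos U W x" using sub_zero[OF U] x0 by auto
    moreover have "card ?P \<noteq> 0" if "\<zero> \<in> ?P" using that finU by (metis card_0_eq empty_iff)
    ultimately have L: "int (card {u \<in> U. u \<noteq> \<zero> \<and> lab U W (x \<ominus> u) = y})
        = int (card ?P) - of_bool (D = pos U W x)"
      using card_Diff_singleton_if[of ?P "\<zero>"] by (auto simp: of_nat_diff)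
    let ?F = "{u \<in> U. x \<ominus> u \<in> W}"
    have zx: "x \<ominus> u = \<zero> \<longleftrightarrow> u = x" if "u \<in> U" for u
      using add_diff_same[OF sub_mem[OF U that] x] sub_mem[OF U that] x by (metis M.r_zero M.minus_eq M.r_neg)
    have P: "?P = {u \<in> U. (u = x \<longleftrightarrow> D = {}) \<and> (x \<in> U \<longleftrightarrow> in_row D) \<and> (u \<in> ?F \<longleftrightarrow> in_col D) \<and> (x \<in> U \<boxplus> W \<longleftrightarrow> in_hook D)}"
    proof -
      have "pos U W (x \<ominus> u) = D \<longleftrightarrow> (u = x \<longleftrightarrow> D = {}) \<and> (x \<in> U \<longleftrightarrow> in_row D) \<and> (u \<in> ?F \<longleftrightarrow> in_col D) \<and> (x \<in> U \<boxplus> W \<longleftrightarrow> in_hook D)"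
        if u: "u \<in> U" for u
      proof -
        have uS: "u \<in> U \<boxplus> W" using sum_upper1[OF U W] u by blast
        show ?thesis
          unfolding pos_eq_iff[OF U W D] sub_diff_iff[OF U u x] sub_diff_iff[OF sub_sum[OF U W] uS x] zx[OF u]
          using u by simp
      qed
      then show ?thesis by blast
    qed
    have F: "card ?F = q ^ a" if "x \<in> U \<boxplus> W"
      using card_fibre[OF U W that] card_vd[OF sub_Int[OF U W]] dm by simp
    have cU: "card U = q ^ (a + b)" using card_vd[OF U] dm by simp
    have FU: "?F \<subseteq> U" by blast
    have UF: "int (card (U - ?F)) = int q ^ (a + b) - int q ^ a" if "x \<in> U \<boxplus> W"
      using card_Diff_subset[OF finite_subset[OF FU sub_finite[OF U]] FU] card_mono[OF sub_finite[OF U] FU] F[OF that] cU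
      by (simp add: of_nat_diff)
    have xF: "x \<in> ?F" if "x \<in> U" using that zx[OF that] sub_zero[OF W] by simp
    have Fx: "int (card (?F - {x})) = int q ^ a - 1" if "x \<in> U"
    proof -
      have "x \<in> U \<boxplus> W" using sum_upper1[OF U W] that by blast
      then show ?thesis using card_Diff_singleton[OF xF[OF that]] F q_ge_2 by (simp add: of_nat_diff)
    qed
    have in1: "x \<in> U \<Longrightarrow> x \<in> U \<boxplus> W" using sum_upper1[OF U W] by blast
    note pp = pos_props[OF U W, of x]
    have cP: "int (card ?P) = (if in_row (pos U W x) then
          if D = {} then 1 else if D = {(1, 1)} then int q ^ a - 1
          else if D = {(1, 2)} then int q ^ (a + b) - int q ^ a else 0
        else if in_hook (pos U W x) then
          if D = {(2, 1)} then int q ^ a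
          else if D = {(1, 2), (2, 1)} then int q ^ (a + b) - int q ^ a else 0
        else if D = {(2, 2)} then int q ^ (a + b) else 0)"
    proof -
      consider "D = {}" | "D = {(1, 1)}" | "D = {(1, 2)}" | "D = {(2, 1)}" | "D = {(1, 2), (2, 1)}" | "D = {(2, 2)}"
        using D unfolding deltas_def by blast
      then show ?thesis
      proof cases
        case 1
        then have "in_row D" "in_col D" "in_hook D" by (simp_all add: in_row_def in_col_def in_hook_def)
        then have "?P = (if x \<in> U then {x} else {})" unfolding P using 1 xF in1 by auto
        then show ?thesis using 1 pp by simp
      next
        case 2
        then have "in_row D" "in_col D" "in_hook D" by (simp_all add: in_row_def in_col_def in_hook_def)
        then have "?P = (if x \<in> U then ?F - {x} else {})" unfolding P using 2 in1 by auto
        then show ?thesis using 2 pp Fx by simp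
      next
        case 3
        then have "in_row D" "\<not> in_col D" "in_hook D" by (simp_all add: in_row_def in_col_def in_hook_def)
        then have "?P = (if x \<in> U then U - ?F else {})" unfolding P using 3 in1 xF by auto
        then show ?thesis using 3 pp UF in1 by simp
      next
        case 4
        then have "\<not> in_row D" "in_col D" "in_hook D" by (simp_all add: in_row_def in_col_def in_hook_def)
        then have "?P = (if x \<in> U \<boxplus> W \<and> x \<notin> U then ?F else {})" unfolding P using 4 in1 by auto
        then show ?thesis using 4 pp F in1 by auto
      next
        case 5
        then have "\<not> in_row D" "\<not> in_col D" "in_hook D" by (simp_all add: in_row_def in_col_def in_hook_def doubleton_eq_iff)
        then have "?P = (if x \<in> U \<boxplus> W \<and> x \<notin> U then U - ?F else {})" unfolding P using 5 in1 by auto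
        then show ?thesis using 5 pp UF in1 by (auto simp: doubleton_eq_iff)
      next
        case 6
        then have "\<not> in_row D" "\<not> in_col D" "\<not> in_hook D" by (simp_all add: in_row_def in_col_def in_hook_def)
        moreover have "u \<in> ?F \<Longrightarrow> x \<in> U \<boxplus> W" if "u \<in> U" for u
          unfolding sum_iff using add_diff_same[OF sub_mem[OF U that] x] that by force
        ultimately have "?P = (if x \<in> U \<boxplus> W then {} else U)" unfolding P using 6 in1 by auto
        then show ?thesis using 6 pp cU in1 by auto
      qed
    qed
    then show ?thesis 
    proof -
      have lx: "lab U W x = (mat2 a b c e, pos U W x)" using True sl[of x] by (metis prod.collapse)
      have "shift_coeff (int q) y (lab U W x) = int (card ?P) - of_bool (D = pos U W x)"
        unfolding lx cP unfolding y'(1) shift_coeff_def case_prod_conv mat2_simps if_P[OF refl] ..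
      then show ?thesis using L by simp
    qed
  qed
qed

end

section \<open>Convolution with the generators\<close>

definition row_size :: "label \<Rightarrow> nat" where "row_size z = fst z 1 1 + fst z 1 2"

locale coordinate_space = field R for R :: "'a ring" (structure) +
  fixes d :: nat
  assumes finite_field: "finite (carrier R)"
begin

abbreviation "VV \<equiv> vec_space R d"

lemma carrier_VV: "carrier VV = {1..d} \<rightarrow>\<^sub>E carrier R"
  unfolding vec_space_def func_space_def by simp

end

sublocale coordinate_space \<subseteq> finite_vspace R "vec_space R d"
proof -
  have "Module.module R (vec_space R d)" unfolding vec_space_def by (rule func_space_is_module)
  moreover have "finite (carrier (vec_space R d))" unfolding carrier_VV using finite_field by (simp add: finite_PiE)
  ultimately show "finite_vspace R (vec_space R d)"
    unfolding finite_vspace_def finite_vspace_axioms_def vectorspace_def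
    using finite_field field_axioms by blast
qed

context coordinate_space
begin

lemma vd_VV: "vd (carrier VV) = d"
  by (rule vd_eqI) (simp add: carrier_VV card_PiE)

text \<open>A two-step flag is the same as its middle subspace.\<close>
definition flag_of :: "(nat \<Rightarrow> 'a) set \<Rightarrow> nat \<Rightarrow> (nat \<Rightarrow> 'a) set" where
  "flag_of S = (\<lambda>r\<in>{0..2}. if r = 0 then {\<zero>\<^bsub>VV\<^esub>} else if r = 1 then S else carrier VV)"

lemma three: "{0..2} = {0, 1, 2::nat}" by auto

lemma flag_of_1 [simp]: "flag_of S 1 = S" "flag_of S (Suc 0) = S" by (simp_all add: flag_of_def)

lemma flag_of_flags: assumes "sub S" shows "flag_of S \<in> flags R d"
proof -
  have "flag_of S \<in> {0..2} \<rightarrow>\<^sub>E Pow (carrier VV)"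
    unfolding flag_of_def using sub_carrier[OF assms] sub_carrier[OF sub_bot] by (intro restrict_PiE_iff[THEN iffD2]) auto
  moreover have "flag_of S 0 = {\<zero>\<^bsub>VV\<^esub>}" "flag_of S 2 = carrier VV" by (simp_all add: flag_of_def)
  ultimately show ?thesis
    unfolding flags_def three using assms sub_bot sub_top sub_zero[OF assms] sub_carrier[OF assms] by simp
qed

lemma flagsD:
  assumes "F \<in> flags R d"
  shows "sub (F 1)" "F 0 = {\<zero>\<^bsub>VV\<^esub>}" "F 2 = carrier VV" "F = flag_of (F 1)"
proof -
  show 1: "sub (F 1)" "F 0 = {\<zero>\<^bsub>VV\<^esub>}" "F 2 = carrier VV"
    using assms unfolding flags_def by auto
  show "F = flag_of (F 1)"
  proof
    fix r
    have "F \<in> extensional {0..2}" using assms unfolding flags_def PiE_def by blast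
    then have "r \<notin> {0..2} \<Longrightarrow> F r = undefined" by (rule extensional_arb)
    moreover have "r \<in> {0..2} \<Longrightarrow> r = 0 \<or> r = 1 \<or> r = 2" by auto
    ultimately show "F r = flag_of (F 1) r" using 1 unfolding flag_of_def by auto
  qed
qed

lemma flags_eq: "flags R d = flag_of ` {S. sub S}"
  using flag_of_flags flagsD(1,4) by blast

lemma finite_flags: "finite (flags R d)"
proof -
  have "{S. sub S} \<subseteq> Pow (carrier VV)" using sub_carrier by blast
  then have "finite {S. sub S}" using finite_vectors finite_subset finite_Pow_iff by metis
  then show ?thesis unfolding flags_eq by (rule finite_imageI)
qed

definition config_lab :: "'a config \<Rightarrow> label" where
  "config_lab = (\<lambda>(F, F', v). lab (F 1) (F' 1) v)"

lemma orbit_adapted: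
  assumes F: "F \<in> flags R d" and F': "F' \<in> flags R d" and v: "v \<in> carrier VV"
  shows "(F, F', v) \<in> orbit R d (A, D) \<longleftrightarrow> (\<exists>\<beta>. adapted A D (F 1) (F' 1) v \<beta>)"
proof -
  have c: "(F, F', v) \<in> configs R d" using assms unfolding configs_def by blast
  have 0: "{(i, j, m) \<in> basis_index A. i \<le> 0} = {}" "{(i, j, m) \<in> basis_index A. j \<le> 0} = {}"
    unfolding basis_index_def by auto
  have 2: "{(i, j, m) \<in> basis_index A. i \<le> 2} = basis_index A" "{(i, j, m) \<in> basis_index A. j \<le> 2} = basis_index A"
    unfolding basis_index_def by auto
  have "inj_on b (basis_index A) \<and> basis (b ` basis_index A) \<and>
     (\<forall>r\<in>{0..2}. F r = span (b ` {(i, j, m) \<in> basis_index A. i \<le> r})) \<and>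
     (\<forall>s\<in>{0..2}. F' s = span (b ` {(i, j, m) \<in> basis_index A. j \<le> s})) \<and>
     v = finsum VV (\<lambda>(i, j). b (i, j, 1)) D \<longleftrightarrow> adapted A D (F 1) (F' 1) v b" for b
  proof -
    have "span (b ` basis_index A) = carrier VV" if "basis (b ` basis_index A)" using that unfolding basis_def by blast
    then show ?thesis
      unfolding adapted_def three ball_simps 0 2 image_empty span_empty flagsD(2,3)[OF F] flagsD(2,3)[OF F'] by auto
  qed
  then show ?thesis unfolding orbit_def using c by simp
qed

lemma orbit_iff:
  assumes t: "t \<in> configs R d" and z: "z \<in> Xi d"
  shows "t \<in> orbit R d z \<longleftrightarrow> config_lab t = z"
proof -
  obtain F F' v where tt: "t = (F, F', v)" by (cases t)
  have c: "F \<in> flags R d" "F' \<in> flags R d" "v \<in> carrier VV" using t unfolding tt configs_def by auto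
  obtain a b c' e D where zz: "z = (mat2 a b c' e, D)" "admissible a b c' e D" using z by (rule Xi_cases)
  note s = flagsD(1)[OF c(1)] flagsD(1)[OF c(2)]
  show ?thesis
  proof
    assume "t \<in> orbit R d z"
    then obtain \<beta> where "adapted (mat2 a b c' e) D (F 1) (F' 1) v \<beta>" unfolding tt zz(1) orbit_adapted[OF c] by blast
    then show "config_lab t = z" using adapted_imp_lab(4)[OF _ zz(2)] unfolding config_lab_def tt zz(1) by simp
  next
    assume "config_lab t = z"
    then show "t \<in> orbit R d z" using adapted_exists[OF s c(3)]
      unfolding tt zz(1) orbit_adapted[OF c] config_lab_def by simp
  qed
qed

lemma config_lab_Xi: assumes t: "t \<in> configs R d" shows "config_lab t \<in> Xi d"
proof -
  obtain F F' v where tt: "t = (F, F', v)" by (cases t)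
  have c: "F \<in> flags R d" "F' \<in> flags R d" "v \<in> carrier VV" using t unfolding tt configs_def by auto
  show ?thesis using lab_Xi[OF flagsD(1)[OF c(1)] flagsD(1)[OF c(2)] c(3)] unfolding tt config_lab_def vd_VV by simp
qed

lemma T_fin_lab: "t \<in> configs R d \<Longrightarrow> z \<in> Xi d \<Longrightarrow> T_fin R d z t = of_bool (config_lab t = z)"
  unfolding T_fin_def by (simp add: orbit_iff)

text \<open>Every label occurs over every finite field: this makes the structure polynomials unique, and
  lets statements about values be tested at each label separately.\<close>
lemma label_realized: assumes z: "z \<in> Xi d" shows "\<exists>t\<in>configs R d. config_lab t = z"
proof -
  obtain a b c e D where zz: "z = (mat2 a b c e, D)" "a + b + c + e = d" "admissible a b c e D" using z by (rule Xi_cases)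
  have "lin_indpt {}" by (auto simp: lin_dep_def)
  then obtain B where B: "{} \<subseteq> B" "B \<subseteq> carrier VV" "lin_indpt B" "span B = carrier VV"
    by (rule extend_basis[OF sub_top empty_subsetI])
  have fB: "finite B" using B(2) finite_vectors finite_subset by blast
  have cB: "card B = d" using vd_span[OF fB B(2,3)] B(4) vd_VV by simp
  let ?I = "basis_index (mat2 a b c e)"
  have fin: "finite (block i j n)" for i j n by (simp add: block_def)
  have "card ?I = d"
    unfolding basis_index_blocks zz(2)[symmetric]
    by (subst card_Un_disjoint; (simp add: fin card_block block_disjoint Int_Un_distrib2)?)+
  moreover have "finite ?I" unfolding basis_index_blocks using fin by simp
  ultimately obtain \<beta> where \<beta>: "bij_betw \<beta> ?I B" using finite_same_card_bij[OF _ fB] cB by metis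
  let ?U = "span (\<beta> ` {(i, j, m) \<in> ?I. i \<le> 1})" and ?W = "span (\<beta> ` {(i, j, m) \<in> ?I. j \<le> 1})"
    and ?v = "finsum VV (\<lambda>(i, j). \<beta> (i, j, 1)) D"
  have ad: "adapted (mat2 a b c e) D ?U ?W ?v \<beta>"
    using \<beta> B unfolding adapted_def bij_betw_def basis_def by blast
  note l = adapted_imp_lab[OF ad zz(3)]
  have "(flag_of ?U, flag_of ?W, ?v) \<in> configs R d"
    unfolding configs_def using flag_of_flags l(1-3) by blast
  moreover have "config_lab (flag_of ?U, flag_of ?W, ?v) = z" unfolding config_lab_def zz(1) using l(4) by simp
  ultimately show ?thesis by blast
qed

lemma configsE:
  assumes "t \<in> configs R d"
  obtains F F' v where "t = (F, F', v)" "F \<in> flags R d" "F' \<in> flags R d" "sub (F 1)" "sub (F' 1)" "v \<in> carrier VV"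
  using assms flagsD(1) unfolding configs_def by auto

definition conv_pairs where
  "conv_pairs U W v x y =
    {(S, u). sub S \<and> u \<in> carrier VV \<and> lab U S u = x \<and> lab S W (v \<ominus>\<^bsub>VV\<^esub> u) = y}"

lemma conv_card:
  assumes t: "(F, F', v) \<in> configs R d" and x: "x \<in> Xi d" and y: "y \<in> Xi d"
  shows "conv R d (T_fin R d x) (T_fin R d y) (F, F', v) =
    of_nat (card (conv_pairs (F 1) (F' 1) v x y))"
proof -
  have c: "F \<in> flags R d" "F' \<in> flags R d" "v \<in> carrier VV" using t unfolding configs_def by auto
  let ?P = "\<lambda>(H, u). lab (F 1) (H 1) u = x \<and> lab (H 1) (F' 1) (v \<ominus>\<^bsub>VV\<^esub> u) = y"
  let ?S = "flags R d \<times> carrier VV"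
  have "conv R d (T_fin R d x) (T_fin R d y) (F, F', v) =
     (\<Sum>p\<in>?S. of_bool (?P p))"
  proof -
    have "T_fin R d x (F, H, u) * T_fin R d y (H, F', v \<ominus>\<^bsub>VV\<^esub> u) = of_bool (?P (H, u))"
      if "H \<in> flags R d" "u \<in> carrier VV" for H u
    proof -
      have "v \<ominus>\<^bsub>VV\<^esub> u \<in> carrier VV" using c(3) that(2) by simp
      then have "(F, H, u) \<in> configs R d" "(H, F', v \<ominus>\<^bsub>VV\<^esub> u) \<in> configs R d"
        using c that unfolding configs_def by blast+
      then show ?thesis using x y by (simp add: T_fin_lab config_lab_def)
    qed
    then show ?thesis unfolding conv_def by (auto intro!: sum.cong)
  qed
  also have "\<dots> = of_nat (card {p \<in> ?S. ?P p})"
    using finite_flags finite_vectors by (simp add: sum_of_bool_eq Int_def)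
  also have "card {p \<in> ?S. ?P p} = card (conv_pairs (F 1) (F' 1) v x y)"
  proof (rule bij_betw_same_card)
    show "bij_betw (\<lambda>(H, u). (H 1, u)) {p \<in> ?S. ?P p} (conv_pairs (F 1) (F' 1) v x y)"
    proof (rule bij_betwI[where g = "\<lambda>(S, u). (flag_of S, u)"])
      show "(\<lambda>(H, u). (H 1, u)) \<in> {p \<in> ?S. ?P p} \<rightarrow>
        conv_pairs (F 1) (F' 1) v x y"
        unfolding conv_pairs_def using flagsD(1) by (intro Pi_I) auto
      show "(\<lambda>(S, u). (flag_of S, u)) \<in>
        conv_pairs (F 1) (F' 1) v x y \<rightarrow> {p \<in> ?S. ?P p}"
        unfolding conv_pairs_def using flag_of_flags by (intro Pi_I) auto
      show "(\<lambda>(S, u). (flag_of S, u)) ((\<lambda>(H, u). (H 1, u)) p) = p" if "p \<in> {p \<in> ?S. ?P p}" for p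
        using that flagsD(4) by (cases p) auto
      show "(\<lambda>(H, u). (H 1, u)) ((\<lambda>(S, u). (flag_of S, u)) p) = p" for p by (cases p) simp
    qed
  qed
  finally show ?thesis .
qed

lemma lab_same_row_iff:
  assumes U: "sub U" and S: "sub S" and rs: "r + s = d"
  shows "lab U S u = (mat2 r 0 0 s, D) \<longleftrightarrow> S = U \<and> vd U = r \<and> pos U U u = D"
proof
  assume "lab U S u = (mat2 r 0 0 s, D)"
  then have l: "vd (U \<inter> S) = r" "vd U = r" "vd S = r" "pos U S u = D"
    using lab_iff[OF U S, of r 0 0 s u D] rs vd_VV by simp_all
  have "U \<inter> S = U" using vd_eq[OF sub_Int[OF U S] U] l by simp
  moreover have "U \<inter> S = S" using vd_eq[OF sub_Int[OF U S] S] l by simp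
  ultimately show "S = U \<and> vd U = r \<and> pos U U u = D" using l by simp
next
  assume "S = U \<and> vd U = r \<and> pos U U u = D"
  then show "lab U S u = (mat2 r 0 0 s, D)" using lab_iff[OF U U, of r 0 0 s u D] rs vd_VV by simp
qed

lemma lab_above_iff:
  assumes U: "sub U" and S: "sub S" and rs: "r + 1 + s = d"
  shows "lab U S u = (mat2 r 0 1 s, {}) \<longleftrightarrow> u = \<zero>\<^bsub>VV\<^esub> \<and> vd U = r \<and> U \<subseteq> S \<and> vd S = vd U + 1"
proof -
  have "pos U S u = {} \<longleftrightarrow> u = \<zero>\<^bsub>VV\<^esub>" using pos_props(1)[OF U S] .
  moreover have "vd (U \<inter> S) = vd U \<longleftrightarrow> U \<subseteq> S"
    using vd_eq[OF sub_Int[OF U S] U] by (metis Int_lower1 inf.orderE inf.orderI order_refl)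
  moreover have "r + 0 + 1 + s = vd (carrier VV)" using rs vd_VV by simp
  moreover have "(m = r \<and> n = r + 0 \<and> k = r + 1 \<and> P) \<longleftrightarrow> (P \<and> n = r \<and> m = n \<and> k = n + 1)" for m n k P
    by auto
  ultimately show ?thesis by (simp only: lab_iff[OF U S])
qed

lemma lab_below_iff:
  assumes U: "sub U" and S: "sub S" and rs: "r + 1 + s = d"
  shows "lab U S u = (mat2 r 1 0 s, {}) \<longleftrightarrow> u = \<zero>\<^bsub>VV\<^esub> \<and> vd U = r + 1 \<and> S \<subseteq> U \<and> vd S + 1 = vd U"
proof -
  have "pos U S u = {} \<longleftrightarrow> u = \<zero>\<^bsub>VV\<^esub>" using pos_props(1)[OF U S] .
  moreover have "vd (U \<inter> S) = vd S \<longleftrightarrow> S \<subseteq> U"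
    using vd_eq[OF sub_Int[OF U S] S] by (metis Int_lower2 inf.absorb2 inf.cobounded1 order_refl)
  moreover have "r + 1 + 0 + s = vd (carrier VV)" using rs vd_VV by simp
  moreover have "(m = r \<and> n = r + 1 \<and> k = r + 0 \<and> P) \<longleftrightarrow> (P \<and> n = r + 1 \<and> m = k \<and> k + 1 = n)" for m n k P
    by auto
  ultimately show ?thesis by (simp only: lab_iff[OF U S])
qed

lemma row_size_lab: "sub U \<Longrightarrow> sub W \<Longrightarrow> row_size (lab U W v) = vd U"
  using dims(1)[of U W] by (simp add: row_size_def lab_def)

lemma minus_zero_right: "v \<in> carrier VV \<Longrightarrow> v \<ominus>\<^bsub>VV\<^esub> \<zero>\<^bsub>VV\<^esub> = v"
  by (simp add: a_minus_def)

text \<open>If the first factor of a convolution is supported at the zero vector, only the middle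
  subspace is summed over.\<close>
lemma card_pairs_zero:
  assumes "\<And>S u. sub S \<Longrightarrow> lab U S u = x \<longleftrightarrow> u = \<zero>\<^bsub>VV\<^esub> \<and> c \<and> Q S" and v: "v \<in> carrier VV"
  shows "card (conv_pairs U W v x y) = (if c then card {S. sub S \<and> Q S \<and> lab S W v = y} else 0)"
proof -
  have "(S, u) \<in> conv_pairs U W v x y \<longleftrightarrow> c \<and> u = \<zero>\<^bsub>VV\<^esub> \<and> sub S \<and> Q S \<and> lab S W v = y" for S u
    unfolding conv_pairs_def mem_Collect_eq case_prod_conv
    using assms(1)[of S u] minus_zero_right[OF v] M.zero_closed by metis
  then have "conv_pairs U W v x y = (if c then (\<lambda>S. (S, \<zero>\<^bsub>VV\<^esub>)) ` {S. sub S \<and> Q S \<and> lab S W v = y} else {})"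
    by auto
  moreover have "inj_on (\<lambda>S. (S, \<zero>\<^bsub>VV\<^esub>)) X" for X :: "(nat \<Rightarrow> 'a) set set" by (rule inj_onI) simp
  ultimately show ?thesis by (simp add: card_image)
qed

lemma conv_up:
  assumes t: "t \<in> configs R d" and y: "y \<in> Xi d" and rs: "r + 1 + s = d"
  shows "conv R d (T_fin R d (mat2 r 0 1 s, {})) (T_fin R d y) t =
    of_int (if row_size (config_lab t) = r then up_coeff (int q) y (config_lab t) else 0)"
proof -
  obtain F F' v where tt: "t = (F, F', v)" and U: "sub (F 1)" and W: "sub (F' 1)" and v: "v \<in> carrier VV"
    using t by (rule configsE)
  have x: "(mat2 r 0 1 s, {}) \<in> Xi d" unfolding Xi_mat2 using rs by simp
  have k: "card (conv_pairs (F 1) (F' 1) v (mat2 r 0 1 s, {}) y)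
    = (if vd (F 1) = r then card {S. sub S \<and> (F 1 \<subseteq> S \<and> vd S = vd (F 1) + 1) \<and> lab S (F' 1) v = y} else 0)"
    using lab_above_iff[OF U _ rs] by (intro card_pairs_zero v) blast
  note cu = card_up[OF U W v, unfolded vd_VV, OF y]
  show ?thesis
    unfolding tt config_lab_def case_prod_conv row_size_lab[OF U W] conv_card[OF t[unfolded tt] x y] k conj_assoc cu[symmetric]
    by (cases "vd (F 1) = r") (simp_all only: if_True if_False refl of_int_of_nat_eq of_nat_0 of_int_0)
qed

lemma conv_down:
  assumes t: "t \<in> configs R d" and y: "y \<in> Xi d" and rs: "r + 1 + s = d"
  shows "conv R d (T_fin R d (mat2 r 1 0 s, {})) (T_fin R d y) t =
    of_int (if row_size (config_lab t) = r + 1 then down_coeff (int q) y (config_lab t) else 0)"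
proof -
  obtain F F' v where tt: "t = (F, F', v)" and U: "sub (F 1)" and W: "sub (F' 1)" and v: "v \<in> carrier VV"
    using t by (rule configsE)
  have x: "(mat2 r 1 0 s, {}) \<in> Xi d" unfolding Xi_mat2 using rs by simp
  have k: "card (conv_pairs (F 1) (F' 1) v (mat2 r 1 0 s, {}) y)
    = (if vd (F 1) = r + 1 then card {S. sub S \<and> (S \<subseteq> F 1 \<and> vd S + 1 = vd (F 1)) \<and> lab S (F' 1) v = y} else 0)"
    using lab_below_iff[OF U _ rs] by (intro card_pairs_zero v) blast
  note cu = card_down[OF U W v, unfolded vd_VV, OF y]
  show ?thesis
    unfolding tt config_lab_def case_prod_conv row_size_lab[OF U W] conv_card[OF t[unfolded tt] x y] k conj_assoc cu[symmetric]
    by (cases "vd (F 1) = r + 1") (simp_all only: if_True if_False refl of_int_of_nat_eq of_nat_0 of_int_0)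
qed

lemma conv_idem:
  assumes t: "t \<in> configs R d" and y: "y \<in> Xi d" and rs: "r + s = d"
  shows "conv R d (T_fin R d (mat2 r 0 0 s, {})) (T_fin R d y) t =
    of_int (if row_size (config_lab t) = r then of_bool (config_lab t = y) else 0)"
proof -
  obtain F F' v where tt: "t = (F, F', v)" and U: "sub (F 1)" and W: "sub (F' 1)" and v: "v \<in> carrier VV"
    using t by (rule configsE)
  have x: "(mat2 r 0 0 s, {}) \<in> Xi d" unfolding Xi_mat2 using rs by simp
  have k: "card (conv_pairs (F 1) (F' 1) v (mat2 r 0 0 s, {}) y)
    = (if vd (F 1) = r then card {S. sub S \<and> S = F 1 \<and> lab S (F' 1) v = y} else 0)"
  proof (rule card_pairs_zero[OF _ v])
    fix S u assume S: "sub S"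
    show "lab (F 1) S u = (mat2 r 0 0 s, {}) \<longleftrightarrow> u = \<zero>\<^bsub>VV\<^esub> \<and> vd (F 1) = r \<and> S = F 1"
      unfolding lab_same_row_iff[OF U S rs] pos_props(1)[OF U U] by blast
  qed
  have "{S. sub S \<and> S = F 1 \<and> lab S (F' 1) v = y} = (if lab (F 1) (F' 1) v = y then {F 1} else {})"
    using U by auto
  then show ?thesis
    unfolding tt config_lab_def case_prod_conv row_size_lab[OF U W] conv_card[OF t[unfolded tt] x y] k
    by simp
qed

lemma conv_shift:
  assumes t: "t \<in> configs R d" and y: "y \<in> Xi d" and rs: "r + s = d" "0 < r"
  shows "conv R d (T_fin R d (mat2 r 0 0 s, {(1, 1)})) (T_fin R d y) t =
    of_int (if row_size (config_lab t) = r then shift_coeff (int q) y (config_lab t) else 0)"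
proof -
  obtain F F' v where tt: "t = (F, F', v)" and U: "sub (F 1)" and W: "sub (F' 1)" and v: "v \<in> carrier VV"
    using t by (rule configsE)
  have x: "(mat2 r 0 0 s, {(1, 1)}) \<in> Xi d" unfolding Xi_mat2 using rs by simp
  let ?C = "{u \<in> F 1. u \<noteq> \<zero>\<^bsub>VV\<^esub> \<and> lab (F 1) (F' 1) (v \<ominus>\<^bsub>VV\<^esub> u) = y}"
  have p: "pos (F 1) (F 1) u = {(1, 1)} \<longleftrightarrow> u \<in> F 1 \<and> u \<noteq> \<zero>\<^bsub>VV\<^esub>" for u
    unfolding pos_def by (auto simp: doubleton_eq_iff)
  have "conv_pairs (F 1) (F' 1) v (mat2 r 0 0 s, {(1, 1)}) y
    = (if vd (F 1) = r then (\<lambda>u. (F 1, u)) ` ?C else {})"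
    unfolding conv_pairs_def using lab_same_row_iff[OF U _ rs(1)] p U sub_mem[OF U] by (auto simp: image_iff)
  moreover have "inj_on (\<lambda>u. (F 1, u)) ?C" by (rule inj_onI) simp
  ultimately have k: "card (conv_pairs (F 1) (F' 1) v (mat2 r 0 0 s, {(1, 1)}) y)
    = (if vd (F 1) = r then card ?C else 0)" by (simp add: card_image)
  note cu = card_shift[OF U W v, unfolded vd_VV, OF y]
  show ?thesis
    unfolding tt config_lab_def case_prod_conv row_size_lab[OF U W] conv_card[OF t[unfolded tt] x y] k cu[symmetric]
    by (cases "vd (F 1) = r") (simp_all only: if_True if_False refl of_int_of_nat_eq of_nat_0 of_int_0)
qed

lemma minus_minus_comm:
  "v \<in> carrier VV \<Longrightarrow> u \<in> carrier VV \<Longrightarrow> w \<in> carrier VV \<Longrightarrow>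
    v \<ominus>\<^bsub>VV\<^esub> w \<ominus>\<^bsub>VV\<^esub> u = v \<ominus>\<^bsub>VV\<^esub> (w \<oplus>\<^bsub>VV\<^esub> u)"
  by (simp add: a_minus_def M.minus_add M.a_assoc)

text \<open>In the sum over both middle vectors, \<open>u\<close> is replaced by \<open>w + u\<close>.\<close>
lemma conv_assoc:
  assumes t: "t \<in> configs R d"
  shows "conv R d (conv R d \<alpha> \<beta>) \<gamma> t = conv R d \<alpha> (conv R d \<beta> \<gamma>) t"
proof -
  obtain F F' v where tt: "t = (F, F', v)" by (cases t)
  have v: "v \<in> carrier VV" using t unfolding tt configs_def by auto
  let ?L = "flags R d" and ?V = "carrier VV"
  have inner: "(\<Sum>u\<in>?V. \<alpha> (F, G, w) * \<beta> (G, H, u \<ominus>\<^bsub>VV\<^esub> w) * \<gamma> (H, F', v \<ominus>\<^bsub>VV\<^esub> u))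
     = (\<Sum>u\<in>?V. \<alpha> (F, G, w) * (\<beta> (G, H, u) * \<gamma> (H, F', v \<ominus>\<^bsub>VV\<^esub> w \<ominus>\<^bsub>VV\<^esub> u)))" if w: "w \<in> ?V" for G H w
  proof (rule sum.reindex_bij_witness[where i = "\<lambda>u. w \<oplus>\<^bsub>VV\<^esub> u" and j = "\<lambda>u. u \<ominus>\<^bsub>VV\<^esub> w"])
    fix u assume u: "u \<in> ?V"
    show "w \<oplus>\<^bsub>VV\<^esub> (u \<ominus>\<^bsub>VV\<^esub> w) = u" "w \<oplus>\<^bsub>VV\<^esub> u \<ominus>\<^bsub>VV\<^esub> w = u"
      using add_diff_same[OF w u] add_left_cancel_diff[OF w u] by simp_all
    show "u \<ominus>\<^bsub>VV\<^esub> w \<in> ?V" "w \<oplus>\<^bsub>VV\<^esub> u \<in> ?V" using u w by simp_all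
    show "\<alpha> (F, G, w) * (\<beta> (G, H, u \<ominus>\<^bsub>VV\<^esub> w) * \<gamma> (H, F', v \<ominus>\<^bsub>VV\<^esub> w \<ominus>\<^bsub>VV\<^esub> (u \<ominus>\<^bsub>VV\<^esub> w)))
      = \<alpha> (F, G, w) * \<beta> (G, H, u \<ominus>\<^bsub>VV\<^esub> w) * \<gamma> (H, F', v \<ominus>\<^bsub>VV\<^esub> u)"
      using minus_minus_comm[OF v _ w, of "u \<ominus>\<^bsub>VV\<^esub> w"] add_diff_same[OF w u] u w by simp
  qed
  have "conv R d (conv R d \<alpha> \<beta>) \<gamma> t =
    (\<Sum>H\<in>?L. \<Sum>u\<in>?V. \<Sum>G\<in>?L. \<Sum>w\<in>?V. \<alpha> (F, G, w) * \<beta> (G, H, u \<ominus>\<^bsub>VV\<^esub> w) * \<gamma> (H, F', v \<ominus>\<^bsub>VV\<^esub> u))"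
    unfolding conv_def tt by (simp add: sum.cartesian_product[symmetric] sum_distrib_right)
  also have "\<dots> = (\<Sum>H\<in>?L. \<Sum>G\<in>?L. \<Sum>w\<in>?V. \<Sum>u\<in>?V. \<alpha> (F, G, w) * \<beta> (G, H, u \<ominus>\<^bsub>VV\<^esub> w) * \<gamma> (H, F', v \<ominus>\<^bsub>VV\<^esub> u))"
    by (rule sum.cong[OF refl], subst sum.swap, rule sum.cong[OF refl], rule sum.swap)
  also have "\<dots> = (\<Sum>H\<in>?L. \<Sum>G\<in>?L. \<Sum>w\<in>?V. \<Sum>u\<in>?V. \<alpha> (F, G, w) * (\<beta> (G, H, u) * \<gamma> (H, F', v \<ominus>\<^bsub>VV\<^esub> w \<ominus>\<^bsub>VV\<^esub> u)))"
    by (intro sum.cong refl inner)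
  also have "\<dots> = (\<Sum>G\<in>?L. \<Sum>w\<in>?V. \<Sum>H\<in>?L. \<Sum>u\<in>?V. \<alpha> (F, G, w) * (\<beta> (G, H, u) * \<gamma> (H, F', v \<ominus>\<^bsub>VV\<^esub> w \<ominus>\<^bsub>VV\<^esub> u)))"
    by (subst sum.swap, rule sum.cong[OF refl], rule sum.swap)
  also have "\<dots> = conv R d \<alpha> (conv R d \<beta> \<gamma>) t"
    unfolding conv_def tt by (simp add: sum.cartesian_product[symmetric] sum_distrib_left)
  finally show ?thesis .
qed

end

section \<open>Structure polynomials\<close>

lemma monic_division:
  fixes P g :: "int poly"
  assumes "lead_coeff g = 1"
  obtains S r where "P = g * S + r" "r = 0 \<or> degree r < degree g"
proof -
  have g0: "g \<noteq> 0" using assms by auto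
  obtain S r where Sr: "pseudo_divmod P g = (S, r)" by (cases "pseudo_divmod P g")
  show ?thesis using that[of S r] pseudo_divmod[OF g0 Sr] assms by simp
qed

lemma poly_abs_le:
  fixes r :: "int poly"
  assumes "degree r \<le> k" and that: "0 < n"
  shows "\<bar>poly r (int n)\<bar> \<le> (\<Sum>i\<le>k. \<bar>Polynomial.coeff r i\<bar>) * int n ^ k"
proof -
  have "poly r (int n) = (\<Sum>i\<le>k. Polynomial.coeff r i * int n ^ i)"
    unfolding poly_altdef using assms(1) by (intro sum.mono_neutral_left) (auto simp: coeff_eq_0)
  also have "\<bar>\<dots>\<bar> \<le> (\<Sum>i\<le>k. \<bar>Polynomial.coeff r i * int n ^ i\<bar>)" by (rule sum_abs)
  also have "\<dots> \<le> (\<Sum>i\<le>k. \<bar>Polynomial.coeff r i\<bar> * int n ^ k)"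
    using that by (intro sum_mono) (auto simp: abs_mult intro!: mult_left_mono power_increasing)
  finally show ?thesis by (simp add: sum_distrib_right)
qed

text \<open>The remainder \<open>r\<close> of the division of \<open>P\<close> by \<open>g\<close> has smaller degree than \<open>g\<close>, so
  \<open>\<bar>r(n)\<bar> < \<bar>g(n)\<bar>\<close> for large \<open>n\<close>; as \<open>g(n)\<close> divides \<open>r(n)\<close> for infinitely many of them, \<open>r = 0\<close>.
  That \<open>g\<close> is monic is essential: \<open>2\<close> divides all values of \<open>n\<^sup>2 + n\<close>, but not this polynomial.\<close>
lemma monic_dvd_of_values:
  fixes P g :: "int poly"
  assumes g: "lead_coeff g = 1" and inf: "infinite N" and dvd: "\<And>n. n \<in> N \<Longrightarrow> poly g (int n) dvd poly P (int n)"
  shows "g dvd P"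
proof -
  obtain S r where Sr: "P = g * S + r" "r = 0 \<or> degree r < degree g" using monic_division[OF g] .
  have "r = 0"
  proof (rule ccontr)
    assume r0: "r \<noteq> 0"
    then obtain k where k: "degree g = Suc k" "degree r \<le> k" using Sr(2) by (cases "degree g") auto
    define C where "C = (\<Sum>i\<le>k. \<bar>Polynomial.coeff r i\<bar>)"
    define h where "h = g - Polynomial.monom 1 (Suc k)"
    define D where "D = (\<Sum>i\<le>k. \<bar>Polynomial.coeff h i\<bar>)"
    have "degree h \<le> k"
    proof (rule degree_le, intro allI impI)
      fix i assume "k < i"
      then show "Polynomial.coeff h i = 0" using k(1) g unfolding h_def by (cases "i = Suc k") (auto simp: coeff_eq_0)
    qed
    have zero: "poly r (int n) = 0" if n: "n \<in> N" "C + D < int n" for n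
    proof (rule ccontr)
      assume nz: "poly r (int n) \<noteq> 0"
      have CD: "0 \<le> C" "0 \<le> D" unfolding C_def D_def by (simp_all add: sum_nonneg)
      then have n0: "0 < n" using n(2) by linarith
      have "poly g (int n) dvd poly r (int n)"
        using dvd[OF n(1)] unfolding Sr(1) by (simp add: dvd_add_right_iff)
      then have "\<bar>poly g (int n)\<bar> \<le> \<bar>poly r (int n)\<bar>" using nz by (simp add: dvd_imp_le_int)
      also have "\<dots> \<le> C * int n ^ k" using poly_abs_le[OF k(2) n0] unfolding C_def .
      finally have 1: "\<bar>poly g (int n)\<bar> \<le> C * int n ^ k" .
      have "g = Polynomial.monom 1 (Suc k) + h" unfolding h_def by simp
      then have "poly g (int n) = int n ^ Suc k + poly h (int n)" by (simp add: poly_monom)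
      moreover have "\<bar>poly h (int n)\<bar> \<le> D * int n ^ k"
        using poly_abs_le[OF \<open>degree h \<le> k\<close> n0] unfolding D_def .
      ultimately have "int n ^ Suc k \<le> (C + D) * int n ^ k" using 1 by (simp add: distrib_right)
      moreover have "(C + D) * int n ^ k < int n * int n ^ k" using n(2) n0 by (intro mult_strict_right_mono) auto
      ultimately show False by simp
    qed
    have "infinite (N - {n. int n \<le> C + D})"
    proof -
      have "{n. int n \<le> C + D} \<subseteq> {..nat (C + D)}" by auto
      then have "finite {n. int n \<le> C + D}" using finite_subset by blast
      then show ?thesis using inf by (simp add: Diff_infinite_finite)
    qed
    then have "infinite (int ` (N - {n. int n \<le> C + D}))" by (simp add: finite_image_iff)
    moreover have "int ` (N - {n. int n \<le> C + D}) \<subseteq> {x. poly r x = 0}" using zero by auto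
    ultimately show False using poly_roots_finite[OF r0] finite_subset by blast
  qed
  then show ?thesis using Sr(1) by simp
qed

lemma prime_field_nat:
  assumes p: "prime (p :: nat)"
  obtains R :: "nat ring" where "field R" "finite (carrier R)" "card (carrier R) = p"
proof -
  let ?Z = "residue_ring (int p)"
  interpret Z: residues_prime p ?Z using p by unfold_locales simp_all
  define S :: "nat ring" where "S = \<lparr>carrier = {0..<p}, monoid.mult = (\<lambda>x y. x * y mod p), one = 1, zero = 0, add = (\<lambda>x y. (x + y) mod p)\<rparr>"
  have p1: "1 < p" using prime_gt_1_nat[OF p] .
  have "nat \<in> ring_iso ?Z S"
  proof (rule ring_iso_memI)
    fix x y assume xy: "x \<in> carrier ?Z" "y \<in> carrier ?Z"
    then have 0: "0 \<le> x" "0 \<le> y" "x < int p" "y < int p" by (auto simp: residue_ring_def)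
    show "nat x \<in> carrier S" using 0 by (auto simp: S_def)
    show "nat (x \<otimes>\<^bsub>?Z\<^esub> y) = nat x \<otimes>\<^bsub>S\<^esub> nat y"
      using 0 by (simp add: S_def residue_ring_def nat_mod_distrib nat_mult_distrib)
    show "nat (x \<oplus>\<^bsub>?Z\<^esub> y) = nat x \<oplus>\<^bsub>S\<^esub> nat y"
      using 0 by (simp add: S_def residue_ring_def nat_mod_distrib nat_add_distrib)
  next
    show "nat \<one>\<^bsub>?Z\<^esub> = \<one>\<^bsub>S\<^esub>" by (simp add: S_def residue_ring_def)
    show "bij_betw nat (carrier ?Z) (carrier S)"
      by (rule bij_betw_byWitness[where f' = int]) (auto simp: S_def residue_ring_def)
  qed
  then have "field (S \<lparr> zero := nat \<zero>\<^bsub>?Z\<^esub> \<rparr>)"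
    by (rule field.ring_iso_imp_img_field[OF Z.is_field])
  moreover have "S \<lparr> zero := nat \<zero>\<^bsub>?Z\<^esub> \<rparr> = S" by (simp add: S_def residue_ring_def)
  ultimately show ?thesis using that[of S] by (simp add: S_def)
qed

lemma poly_qnum: "poly (qnum c n) x = qnum (poly c x) n"
  by (simp add: qnum_def poly_sum poly_power)

abbreviation qvar :: "int poly" where "qvar \<equiv> [:0, 1:]"

lemma poly_pos_count: "poly (pos_count N Nr Nh D' D) x = pos_count (poly N x) (poly Nr x) (poly Nh x) D' D"
  for N :: "int poly"
  by (simp add: pos_count_def)

lemma poly_if: "poly (if b then f else g) x = (if b then poly f x else poly g x)" by simp

lemma poly_up_coeff: "poly (up_coeff qvar y z) x = up_coeff x y z"
  by (simp only: up_coeff_def Let_def case_prod_unfold poly_if poly_pos_count poly_qnum poly_diff poly_power poly_0 poly_1)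
    (simp add: qnum_def)

lemma poly_down_coeff: "poly (down_coeff qvar y z) x = down_coeff x y z"
  by (simp only: down_coeff_def Let_def case_prod_unfold poly_if poly_pos_count poly_qnum poly_diff poly_power poly_0 poly_1)
    (simp add: qnum_def)

lemma poly_shift_coeff: "poly (shift_coeff qvar y z) x = shift_coeff x y z"
  by (simp only: shift_coeff_def case_prod_unfold poly_if poly_diff poly_power poly_0 poly_1)
    simp

text \<open>The property that describes the family \<open>struct_poly d x y\<close>.\<close>
definition expands :: "nat \<Rightarrow> label \<Rightarrow> label \<Rightarrow> (label \<Rightarrow> int poly) \<Rightarrow> bool" where
  "expands d x y c \<longleftrightarrow> (\<forall>z. z \<notin> Xi d \<longrightarrow> c z = 0) \<and>
     (\<forall>R :: nat ring. field R \<and> finite (carrier R) \<longrightarrow>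
       (\<forall>t \<in> configs R d. conv R d (T_fin R d x) (T_fin R d y) t =
          (\<Sum>z\<in>Xi d. of_int (poly (c z) (int (card (carrier R)))) * T_fin R d z t)))"

lemma struct_poly_expands: "struct_poly d x y = (THE c. expands d x y c)"
  unfolding struct_poly_def expands_def ..

lemma finite_Xi: "finite (Xi d)"
proof -
  have "Xi d \<subseteq> (\<lambda>(a, b, c, e, D). (mat2 a b c e, D)) ` ({..d} \<times> {..d} \<times> {..d} \<times> {..d} \<times> deltas)"
  proof
    fix z assume "z \<in> Xi d"
    then obtain a b c e D where z: "z = (mat2 a b c e, D)" "a + b + c + e = d" "admissible a b c e D" by (rule Xi_cases)
    then have "(a, b, c, e, D) \<in> {..d} \<times> {..d} \<times> {..d} \<times> {..d} \<times> deltas" unfolding admissible_def by auto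
    then show "z \<in> (\<lambda>(a, b, c, e, D). (mat2 a b c e, D)) ` ({..d} \<times> {..d} \<times> {..d} \<times> {..d} \<times> deltas)"
      unfolding z(1) by (intro image_eqI[where x = "(a, b, c, e, D)"]) simp_all
  qed
  moreover have "finite deltas" unfolding deltas_def by simp
  ultimately show ?thesis by (meson finite_SigmaI finite_atMost finite_imageI finite_subset)
qed

lemma coordinate_space_iff: "coordinate_space R \<longleftrightarrow> field R \<and> finite (carrier R)"
  unfolding coordinate_space_def coordinate_space_axioms_def ..

context coordinate_space
begin

lemma sum_T_fin:
  assumes "t \<in> configs R d"
  shows "(\<Sum>z\<in>Xi d. k z * T_fin R d z t) = k (config_lab t)"
proof -
  have "(\<Sum>z\<in>Xi d. k z * T_fin R d z t) = (\<Sum>z\<in>Xi d. if config_lab t = z then k z else 0)"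
    by (rule sum.cong[OF refl]) (simp add: T_fin_lab[OF assms])
  then show ?thesis using config_lab_Xi[OF assms] finite_Xi by (simp add: sum.delta)
qed

lemma conv_cong:
  assumes "t \<in> configs R d" "\<And>s. s \<in> configs R d \<Longrightarrow> \<alpha> s = \<alpha>' s" "\<And>s. s \<in> configs R d \<Longrightarrow> \<beta> s = \<beta>' s"
  shows "conv R d \<alpha> \<beta> t = conv R d \<alpha>' \<beta>' t"
proof -
  obtain F F' v where tt: "t = (F, F', v)" by (cases t)
  have c: "F \<in> flags R d" "F' \<in> flags R d" "v \<in> carrier VV" using assms(1) unfolding tt configs_def by auto
  show ?thesis unfolding tt conv_def case_prod_conv
  proof (rule sum.cong[OF refl])
    fix p assume p: "p \<in> flags R d \<times> carrier VV"
    obtain H u where hu: "p = (H, u)" by (cases p)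
    have "v \<ominus>\<^bsub>VV\<^esub> u \<in> carrier VV" using c(3) p hu by simp
    then have "(F, H, u) \<in> configs R d" "(H, F', v \<ominus>\<^bsub>VV\<^esub> u) \<in> configs R d"
      using c p hu unfolding configs_def by simp_all
    then show "(case p of (H, u) \<Rightarrow> \<alpha> (F, H, u) * \<beta> (H, F', v \<ominus>\<^bsub>VV\<^esub> u)) =
      (case p of (H, u) \<Rightarrow> \<alpha>' (F, H, u) * \<beta>' (H, F', v \<ominus>\<^bsub>VV\<^esub> u))"
      using assms(2,3) hu by simp
  qed
qed

lemma conv_sum_left: "conv R d (\<lambda>s. \<Sum>z\<in>A. k z * f z s) \<gamma> t = (\<Sum>z\<in>A. k z * conv R d (f z) \<gamma> t)"
  unfolding conv_def case_prod_unfold sum_distrib_left sum_distrib_right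
  by (subst sum.swap) (simp add: mult.assoc)

lemma conv_sum_right: "conv R d \<gamma> (\<lambda>s. \<Sum>z\<in>A. k z * f z s) t = (\<Sum>z\<in>A. k z * conv R d \<gamma> (f z) t)"
  unfolding conv_def case_prod_unfold sum_distrib_left sum_distrib_right
  by (subst sum.swap) (simp add: mult.left_commute)

end

lemma expandsI:
  assumes "\<And>z. z \<notin> Xi d \<Longrightarrow> c z = 0"
    and "\<And>R t. coordinate_space R \<Longrightarrow> t \<in> configs (R :: nat ring) d \<Longrightarrow> conv R d (T_fin R d x) (T_fin R d y) t =
       of_int (poly (c (coordinate_space.config_lab R d t)) (int (card (carrier R))))"
  shows "expands d x y c"
  unfolding expands_def
proof (intro conjI allI impI ballI)
  show "\<And>z. z \<notin> Xi d \<Longrightarrow> c z = 0" by (rule assms(1))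
  fix R :: "nat ring" and t assume "field R \<and> finite (carrier R)" and t: "t \<in> configs R d"
  then have R: "coordinate_space R" unfolding coordinate_space_iff by simp
  show "conv R d (T_fin R d x) (T_fin R d y) t =
      (\<Sum>z\<in>Xi d. of_int (poly (c z) (int (card (carrier R)))) * T_fin R d z t)"
    unfolding coordinate_space.sum_T_fin[OF R t] by (rule assms(2)[OF R t])
qed

lemma expandsD:
  assumes "expands d x y c"
  shows "z \<notin> Xi d \<Longrightarrow> c z = 0"
    and "coordinate_space R \<Longrightarrow> t \<in> configs (R :: nat ring) d \<Longrightarrow> conv R d (T_fin R d x) (T_fin R d y) t =
       of_int (poly (c (coordinate_space.config_lab R d t)) (int (card (carrier R))))"
proof -
  show "z \<notin> Xi d \<Longrightarrow> c z = 0" using assms unfolding expands_def by blast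
  assume R: "coordinate_space R" and t: "t \<in> configs R d"
  have "conv R d (T_fin R d x) (T_fin R d y) t =
      (\<Sum>z\<in>Xi d. of_int (poly (c z) (int (card (carrier R)))) * T_fin R d z t)"
    using assms R t unfolding expands_def coordinate_space_iff by blast
  then show "conv R d (T_fin R d x) (T_fin R d y) t =
       of_int (poly (c (coordinate_space.config_lab R d t)) (int (card (carrier R))))"
    unfolding coordinate_space.sum_T_fin[OF R t] .
qed

text \<open>The values of both polynomials at a prime \<open>p\<close> are the convolution over the prime field at
  a configuration labelled \<open>z\<close>.\<close>
lemma expands_unique:
  assumes c: "expands d x y c" and c': "expands d x y c'"
  shows "c = c'"
proof
  fix z
  show "c z = c' z"
  proof (cases "z \<in> Xi d")
    case False then show ?thesis using expandsD(1)[OF c] expandsD(1)[OF c'] by simp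
  next
    case z: True
    have "int p \<in> {n. poly (c z - c' z) n = 0}" if p: "prime p" for p
    proof -
      obtain R :: "nat ring" where R: "field R" "finite (carrier R)" "card (carrier R) = p" using prime_field_nat[OF p] .
      then have cs: "coordinate_space R" unfolding coordinate_space_iff by simp
      obtain t where t: "t \<in> configs R d" "coordinate_space.config_lab R d t = z"
        using coordinate_space.label_realized[OF cs z] by blast
      have "(of_int (poly (c z) (int p)) :: complex) = of_int (poly (c' z) (int p))"
        using expandsD(2)[OF c cs t(1)] expandsD(2)[OF c' cs t(1)] unfolding t(2) R(3) by simp
      then show ?thesis by simp
    qed
    then have "int ` {p. prime p} \<subseteq> {n. poly (c z - c' z) n = 0}" by blast
    moreover have "infinite (int ` {p::nat. prime p})" using primes_infinite by (simp add: finite_image_iff)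
    ultimately have "c z - c' z = 0" using poly_roots_finite finite_subset by metis
    then show ?thesis by simp
  qed
qed

lemma struct_poly_eq: "expands d x y c \<Longrightarrow> struct_poly d x y = c"
  unfolding struct_poly_expands using expands_unique by (blast intro: the_equality)

text \<open>All products with left factor \<open>T\<^sub>x\<close> have polynomial structure constants.\<close>
definition left_polynomial :: "nat \<Rightarrow> label \<Rightarrow> bool" where
  "left_polynomial d x \<longleftrightarrow> (\<forall>y\<in>Xi d. \<exists>c. expands d x y c)"

text \<open>Write \<open>T\<^sub>g * T\<^sub>y = \<Sum>\<^bsub>z\<^esub> c\<^sub>z T\<^sub>z\<close>. By associativity
  \<open>c\<^bsub>z0\<^esub> (T\<^bsub>z0\<^esub> * T\<^sub>w) = T\<^sub>g * (T\<^sub>y * T\<^sub>w) - \<Sum>\<^bsub>z \<noteq> z0\<^esub> c\<^sub>z (T\<^sub>z * T\<^sub>w)\<close>, and all products on the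
  right-hand side have polynomial coefficients \<open>P\<close>. The coefficients of \<open>T\<^bsub>z0\<^esub> * T\<^sub>w\<close> count
  something, so they are integers and \<open>c\<^bsub>z0\<^esub>(p)\<close> divides \<open>P(p)\<close> for every prime \<open>p\<close>. Hence \<open>c\<^bsub>z0\<^esub>\<close>
  divides \<open>P\<close> as a polynomial. Since \<open>c\<^bsub>z0\<^esub>\<close> has no zero at a prime power, it can be cancelled.\<close>
lemma left_polynomial_step:
  assumes g: "left_polynomial d g" and y: "left_polynomial d y" "y \<in> Xi d"
    and c: "expands d g y c" and z0: "z0 \<in> Xi d" "lead_coeff (c z0) = 1" "\<And>n. 2 \<le> n \<Longrightarrow> poly (c z0) (int n) \<noteq> 0"
    and others: "\<And>z. z \<noteq> z0 \<Longrightarrow> c z \<noteq> 0 \<Longrightarrow> left_polynomial d z"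
  shows "left_polynomial d z0"
  unfolding left_polynomial_def
proof
  fix w assume w: "w \<in> Xi d"
  obtain c1 where c1: "expands d y w c1" using y(1) w unfolding left_polynomial_def by blast
  have "\<exists>c2. \<forall>z\<in>Xi d. expands d g z (c2 z)" using g unfolding left_polynomial_def by (intro bchoice) blast
  then obtain c2 where c2: "\<And>z. z \<in> Xi d \<Longrightarrow> expands d g z (c2 z)" by blast
  have "\<exists>c3. \<forall>z\<in>{z. z \<noteq> z0 \<and> c z \<noteq> 0}. expands d z w (c3 z)"
    using others w unfolding left_polynomial_def by (intro bchoice) blast
  then obtain c3 where c3: "\<And>z. z \<noteq> z0 \<Longrightarrow> c z \<noteq> 0 \<Longrightarrow> expands d z w (c3 z)" by blast
  define P where "P = (\<lambda>l. (\<Sum>z\<in>Xi d. c1 z * c2 z l) - (\<Sum>z\<in>Xi d - {z0}. c z * c3 z l))"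
  have key: "of_int (poly (c z0) (int (card (carrier R)))) * conv R d (T_fin R d z0) (T_fin R d w) t =
      of_int (poly (P (coordinate_space.config_lab R d t)) (int (card (carrier R))))"
    if R: "coordinate_space R" and t: "t \<in> configs R d" for R :: "nat ring" and t
  proof -
    interpret coordinate_space R d using R .
    let ?q = "int (card (carrier R))" and ?l = "config_lab t"
    let ?Tw = "T_fin R d w"
    have "(\<Sum>z\<in>Xi d. of_int (poly (c z) ?q) * conv R d (T_fin R d z) ?Tw t)
        = conv R d (\<lambda>s. \<Sum>z\<in>Xi d. of_int (poly (c z) ?q) * T_fin R d z s) ?Tw t"
      by (rule conv_sum_left[symmetric])
    also have "\<dots> = conv R d (conv R d (T_fin R d g) (T_fin R d y)) ?Tw t"
      using t by (rule conv_cong) (simp_all add: sum_T_fin expandsD(2)[OF c R])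
    also have "\<dots> = conv R d (T_fin R d g) (conv R d (T_fin R d y) ?Tw) t"
      by (rule conv_assoc[OF t])
    also have "\<dots> = conv R d (T_fin R d g) (\<lambda>s. \<Sum>z\<in>Xi d. of_int (poly (c1 z) ?q) * T_fin R d z s) t"
      using t by (rule conv_cong) (simp_all add: sum_T_fin expandsD(2)[OF c1 R])
    also have "\<dots> = (\<Sum>z\<in>Xi d. of_int (poly (c1 z) ?q) * conv R d (T_fin R d g) (T_fin R d z) t)"
      by (rule conv_sum_right)
    also have "\<dots> = (\<Sum>z\<in>Xi d. of_int (poly (c1 z) ?q) * of_int (poly (c2 z ?l) ?q))"
      by (rule sum.cong[OF refl]) (simp add: expandsD(2)[OF c2 R t])
    finally have e: "(\<Sum>z\<in>Xi d. of_int (poly (c z) ?q) * conv R d (T_fin R d z) ?Tw t) = of_int (poly (\<Sum>z\<in>Xi d. c1 z * c2 z ?l) ?q)"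
      by (simp add: poly_sum)
    have o: "of_int (poly (c z) ?q) * conv R d (T_fin R d z) ?Tw t = of_int (poly (c z * c3 z ?l) ?q)"
      if "z \<in> Xi d - {z0}" for z
      using that expandsD(2)[OF c3 R t, of z] by (cases "c z = 0") simp_all
    have "(\<Sum>z\<in>Xi d. of_int (poly (c z) ?q) * conv R d (T_fin R d z) ?Tw t)
       = of_int (poly (c z0) ?q) * conv R d (T_fin R d z0) ?Tw t
         + (\<Sum>z\<in>Xi d - {z0}. of_int (poly (c z) ?q) * conv R d (T_fin R d z) ?Tw t)"
      by (rule sum.remove[OF finite_Xi z0(1)])
    also have "(\<Sum>z\<in>Xi d - {z0}. of_int (poly (c z) ?q) * conv R d (T_fin R d z) ?Tw t)
       = of_int (poly (\<Sum>z\<in>Xi d - {z0}. c z * c3 z ?l) ?q)"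
      by (simp only: poly_sum of_int_sum) (rule sum.cong[OF refl o])
    finally show ?thesis unfolding e P_def by (simp add: algebra_simps)
  qed
  have nat: "\<exists>N::nat. conv R d (T_fin R d z0) (T_fin R d w) t = of_nat N"
    if R: "coordinate_space R" and t: "t \<in> configs R d" for R :: "nat ring" and t
    using coordinate_space.conv_card[OF R _ z0(1) w] t by (cases t) blast
  have "c z0 dvd P l" if l: "l \<in> Xi d" for l
  proof (rule monic_dvd_of_values[OF z0(2) primes_infinite])
    fix p :: nat assume "p \<in> {p. prime p}"
    then have p: "prime p" by simp
    obtain R :: "nat ring" where R: "field R" "finite (carrier R)" "card (carrier R) = p" using prime_field_nat[OF p] .
    then have cs: "coordinate_space R" unfolding coordinate_space_iff by simp
    obtain t where t: "t \<in> configs R d" "coordinate_space.config_lab R d t = l"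
      using coordinate_space.label_realized[OF cs l] by blast
    obtain N :: nat where "conv R d (T_fin R d z0) (T_fin R d w) t = of_nat N" using nat[OF cs t(1)] by blast
    then have "(of_int (poly (c z0) (int p) * int N) :: complex) = of_int (poly (P l) (int p))"
      using key[OF cs t(1)] unfolding t(2) R(3) by simp
    then have "poly (c z0) (int p) * int N = poly (P l) (int p)" by (simp only: of_int_eq_iff)
    then show "poly (c z0) (int p) dvd poly (P l) (int p)" by (metis dvd_triv_left)
  qed
  then have "\<exists>S. \<forall>l\<in>Xi d. P l = c z0 * S l" by (intro bchoice) (auto simp: dvd_def)
  then obtain S where S: "\<And>l. l \<in> Xi d \<Longrightarrow> P l = c z0 * S l" by blast
  have "expands d z0 w (\<lambda>l. if l \<in> Xi d then S l else 0)"
  proof (rule expandsI)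
    fix R :: "nat ring" and t assume R: "coordinate_space R" and t: "t \<in> configs R d"
    let ?q = "int (card (carrier R))" and ?l = "coordinate_space.config_lab R d t"
    interpret coordinate_space R d using R .
    have l: "?l \<in> Xi d" using config_lab_Xi[OF t] .
    have "poly (c z0) ?q \<noteq> 0" using z0(3) q_ge_2 by blast
    then have "(of_int (poly (c z0) ?q) :: complex) \<noteq> 0" by simp
    moreover have "of_int (poly (c z0) ?q) * conv R d (T_fin R d z0) (T_fin R d w) t = of_int (poly (c z0) ?q) * of_int (poly (S ?l) ?q)"
      using key[OF R t] S[OF l] by simp
    ultimately show "conv R d (T_fin R d z0) (T_fin R d w) t = of_int (poly (if ?l \<in> Xi d then S ?l else 0) ?q)"
      using l by simp
  qed simp
  then show "\<exists>c. expands d z0 w c" by blast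
qed

section \<open>Every label is reached from the generators\<close>

definition monic_nonzero :: "int poly \<Rightarrow> bool" where
  "monic_nonzero p \<longleftrightarrow> lead_coeff p = 1 \<and> (\<forall>n\<ge>2. poly p (int n) \<noteq> 0)"

lemma monic_nonzero_1: "monic_nonzero 1" by (simp add: monic_nonzero_def)

lemma monic_nonzero_power: "monic_nonzero (qvar ^ n)"
  unfolding monic_nonzero_def by (simp add: lead_coeff_power poly_power)

lemma monic_nonzero_qnum: "monic_nonzero (qnum qvar (Suc n))"
proof -
  have deg: "degree (qvar ^ n) = n" for n by (simp add: degree_power_eq)
  have "qnum qvar n = 0 \<or> degree (qnum qvar n) < n"
  proof (induction n)
    case (Suc n)
    have "degree (qnum qvar (Suc n)) \<le> n"
      unfolding qnum_Suc using Suc deg[of n] by (intro degree_add_le) auto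
    then show ?case by simp
  qed simp
  then have "lead_coeff (qnum qvar (Suc n)) = 1"
  proof
    assume "degree (qnum qvar n) < n"
    then have "lead_coeff (qnum qvar n + qvar ^ n) = lead_coeff (qvar ^ n)"
      using deg[of n] by (intro lead_coeff_add_le) (simp only:)
    then show ?thesis by (simp add: qnum_Suc lead_coeff_power)
  qed (simp add: qnum_Suc lead_coeff_power)
  moreover have "poly (qnum qvar (Suc n)) (int m) \<noteq> 0" if "2 \<le> m" for m
  proof -
    have "poly (qnum qvar (Suc n)) (int m) = int (qnum m (Suc n))" unfolding poly_qnum by (simp add: qnum_def)
    then show ?thesis using qnum_pos[of "Suc n" m] by simp
  qed
  ultimately show ?thesis unfolding monic_nonzero_def by blast
qed

text \<open>The labels of the elements \<open>e\<^sub>r\<close>, \<open>f\<^sub>r\<close>, \<open>1\<^sub>r\<close> and \<open>x\<^sub>r\<close>, in this order.\<close>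
definition gens :: "nat \<Rightarrow> label set" where
  "gens d = {(mat2 r 1 0 s, {}) | r s. r + 1 + s = d} \<union> {(mat2 r 0 1 s, {}) | r s. r + 1 + s = d}
     \<union> {(mat2 r 0 0 s, {}) | r s. r + s = d} \<union> {(mat2 r 0 0 s, {(1, 1)}) | r s. r + s = d \<and> 0 < r}"

lemma gens_Xi: "gens d \<subseteq> Xi d"
  unfolding gens_def by (auto simp: Xi_mat2 simp del: One_nat_def)

lemma expands_row:
  assumes poly: "\<And>z x. poly (c z) x = k x z"
    and conv: "\<And>R t. coordinate_space R \<Longrightarrow> t \<in> configs (R :: nat ring) d \<Longrightarrow>
      conv R d (T_fin R d g) (T_fin R d y) t = of_int (if row_size (coordinate_space.config_lab R d t) = r
        then k (int (card (carrier R))) (coordinate_space.config_lab R d t) else 0)"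
  shows "expands d g y (\<lambda>z. if z \<in> Xi d \<and> row_size z = r then c z else 0)"
proof (rule expandsI)
  fix R :: "nat ring" and t assume R: "coordinate_space R" and t: "t \<in> configs R d"
  let ?l = "coordinate_space.config_lab R d t"
  show "conv R d (T_fin R d g) (T_fin R d y) t =
      of_int (poly (if ?l \<in> Xi d \<and> row_size ?l = r then c ?l else 0) (int (card (carrier R))))"
    unfolding conv[OF R t] using coordinate_space.config_lab_Xi[OF R t] by (simp add: poly)
qed simp

lemma expands_up:
  assumes y: "y \<in> Xi d" and rs: "r + 1 + s = d"
  shows "expands d (mat2 r 0 1 s, {}) y (\<lambda>z. if z \<in> Xi d \<and> row_size z = r then up_coeff qvar y z else 0)"
  by (rule expands_row[where k = "\<lambda>x. up_coeff x y", OF poly_up_coeff coordinate_space.conv_up[OF _ _ y rs]])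

lemma expands_down:
  assumes y: "y \<in> Xi d" and rs: "r + 1 + s = d"
  shows "expands d (mat2 r 1 0 s, {}) y (\<lambda>z. if z \<in> Xi d \<and> row_size z = r + 1 then down_coeff qvar y z else 0)"
  by (rule expands_row[where k = "\<lambda>x. down_coeff x y", OF poly_down_coeff coordinate_space.conv_down[OF _ _ y rs]])

lemma expands_idem:
  assumes y: "y \<in> Xi d" and rs: "r + s = d"
  shows "expands d (mat2 r 0 0 s, {}) y (\<lambda>z. if z = y \<and> row_size y = r then 1 else 0)"
proof (rule expandsI)
  fix R :: "nat ring" and t assume R: "coordinate_space R" and t: "t \<in> configs R d"
  show "conv R d (T_fin R d (mat2 r 0 0 s, {})) (T_fin R d y) t = of_int (poly (if coordinate_space.config_lab R d t = y
      \<and> row_size y = r then 1 else 0) (int (card (carrier R))))"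
    unfolding coordinate_space.conv_idem[OF R t y rs] by auto
qed (use y in auto)

lemma expands_shift:
  assumes y: "y \<in> Xi d" and rs: "r + s = d" "0 < r"
  shows "expands d (mat2 r 0 0 s, {(1, 1)}) y (\<lambda>z. if z \<in> Xi d \<and> row_size z = r then shift_coeff qvar y z else 0)"
  by (rule expands_row[where k = "\<lambda>x. shift_coeff x y", OF poly_shift_coeff coordinate_space.conv_shift[OF _ _ y rs]])

lemma gens_left_polynomial: "g \<in> gens d \<Longrightarrow> left_polynomial d g"
  unfolding gens_def left_polynomial_def using expands_up expands_down expands_idem expands_shift by blast

text \<open>The label \<open>z0\<close> is reached if \<open>T\<^bsub>z0\<^esub>\<close> is the only new basis element in a product of a
  generator with a basis element reached before. The condition on its coefficient serves two purposes:
  a monic integer polynomial without zeros at prime powers can be cancelled in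
  \<open>left_polynomial_step\<close>, and a nonzero one is invertible in the field of rational functions.\<close>
inductive_set reachable :: "nat \<Rightarrow> label set" for d where
  gen: "g \<in> gens d \<Longrightarrow> g \<in> reachable d"
| step: "g \<in> gens d \<Longrightarrow> y \<in> reachable d \<Longrightarrow> expands d g y c \<Longrightarrow> z0 \<in> Xi d \<Longrightarrow> monic_nonzero (c z0) \<Longrightarrow>
    (\<And>z. z \<noteq> z0 \<Longrightarrow> c z \<noteq> 0 \<Longrightarrow> z \<in> reachable d) \<Longrightarrow> z0 \<in> reachable d"

lemma reachable_Xi: "z \<in> reachable d \<Longrightarrow> z \<in> Xi d"
  by (induction rule: reachable.induct) (use gens_Xi in auto)

lemma reachable_left_polynomial: "z \<in> reachable d \<Longrightarrow> left_polynomial d z"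
proof (induction rule: reachable.induct)
  case (gen g) then show ?case by (rule gens_left_polynomial)
next
  case (step g y c z0)
  show ?case
    by (rule left_polynomial_step[OF gens_left_polynomial[OF step(1)] _ reachable_Xi[OF step(2)] step(3,4)])
      (use step in \<open>auto simp: monic_nonzero_def\<close>)
qed

lemma row_size_mat2: "row_size (mat2 a b c e, D) = a + b" by (simp add: row_size_def)

lemma up_coeff_mat2: "up_coeff x (mat2 a b c e, D) (mat2 a' b' c' e', D') =
  (if a + b = a' + b' + 1 \<and> a + c = a' + c' then
     if a = a' + 1 then pos_count (qnum x c') (if in_row D' then qnum x c' else if in_hook D' then 1 else 0) (if in_hook D' then qnum x c' else 0) D' D
     else if a = a' then pos_count (qnum x (c' + e') - qnum x c')
       (if in_row D' then qnum x (c' + e') - qnum x c' else if in_hook D' then 0 else 1) (if in_hook D' then qnum x (c' + e') - qnum x c' else x ^ c') D' D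
     else 0 else 0)"
  unfolding up_coeff_def case_prod_conv mat2_simps Let_def ..

lemma pos_count_nonzero:
  assumes "pos_count N Nr Nh D' D \<noteq> 0" "in_row D"
  shows "(D = {}) = (D' = {}) \<and> in_col D = in_col D' \<and> Nr \<noteq> 0"
  using assms unfolding pos_count_def by metis

lemma up_coeff_nonzero:
  assumes "up_coeff x (mat2 a b c e, D) (mat2 a' b' c' e', D') \<noteq> 0" "a + b + c + e = d" "a' + b' + c' + e' = d" "in_row D"
  shows "(D = {}) = (D' = {}) \<and> in_col D = in_col D' \<and>
    (a = a' + 1 \<and> b' = b \<and> c' = c + 1 \<and> e' = e \<and> in_hook D' \<or>
     a = a' \<and> b = b' + 1 \<and> c' = c \<and> e' = e + 1 \<and> (in_row D' \<or> \<not> in_hook D'))"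
proof -
  note nz = assms(1)[unfolded up_coeff_mat2]
  have c: "a + b = a' + b' + 1" "a + c = a' + c'" using nz by metis+
  show ?thesis
  proof (cases "a = a' + 1")
    case True
    have "(D = {}) = (D' = {}) \<and> in_col D = in_col D' \<and> (if in_row D' then qnum x c' else if in_hook D' then 1 else 0) \<noteq> 0"
      using nz True c by (intro pos_count_nonzero[OF _ assms(4)]) simp
    moreover have "in_hook D'" if "in_row D'" using that unfolding in_row_def in_hook_def by auto
    moreover have "b' = b \<and> c' = c + 1 \<and> e' = e" using True c assms(2,3) by linarith
    ultimately show ?thesis using True by metis
  next
    case False
    then have a: "a = a'" using nz by metis
    have "(D = {}) = (D' = {}) \<and> in_col D = in_col D' \<and>
       (if in_row D' then qnum x (c' + e') - qnum x c' else if in_hook D' then 0 else 1) \<noteq> 0"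
      using nz a c by (intro pos_count_nonzero[OF _ assms(4)]) simp
    moreover have "b = b' + 1 \<and> c' = c \<and> e' = e + 1" using a c assms(2,3) by linarith
    ultimately show ?thesis using a by metis
  qed
qed

lemma down_coeff_mat2: "down_coeff x (mat2 a b c e, D) (mat2 a' b' c' e', D') =
    (if a + b + 1 = a' + b' \<and> a + c = a' + c' then
       if a = a' then
         pos_count (qnum x b') (if in_row D' then if in_col D' then qnum x b' else qnum x (b' - 1) else 0)
           (if in_hook D' then if in_col D' then qnum x b' else qnum x (b' - 1) else 0) D' D
       else if a + 1 = a' then
         pos_count (qnum x (a' + b') - qnum x b')
              (if \<not> in_row D' then 0 else if D' = {} then qnum x (a' + b') - qnum x b'
               else qnum x (a' + b' - 1) - qnum x (if in_col D' then b' else b' - 1))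
              (if in_hook D' then qnum x (a' + b') - qnum x b' else 0) D' D
       else 0
     else 0)"
  unfolding down_coeff_def case_prod_conv mat2_simps Let_def ..

lemma down_coeff_nonzero:
  assumes "down_coeff x (mat2 a b c e, D) (mat2 a' b' c' e', D') \<noteq> 0" "a + b + c + e = d" "a' + b' + c' + e' = d" "in_row D"
  shows "(D = {}) = (D' = {}) \<and> in_col D = in_col D' \<and> in_row D' \<and>
    (a' = a \<and> b' = b + 1 \<and> c' = c \<and> e = e' + 1 \<or> a' = a + 1 \<and> b' = b \<and> c = c' + 1 \<and> e' = e)"
proof -
  note nz = assms(1)[unfolded down_coeff_mat2]
  have c: "a + b + 1 = a' + b'" "a + c = a' + c'" using nz by metis+
  show ?thesis
  proof (cases "a = a'")
    case True
    have "(D = {}) = (D' = {}) \<and> in_col D = in_col D' \<and>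
        (if in_row D' then if in_col D' then qnum x b' else qnum x (b' - 1) else 0) \<noteq> 0"
      using nz True c by (intro pos_count_nonzero[OF _ assms(4)]) simp
    moreover have "b' = b + 1 \<and> c' = c \<and> e = e' + 1" using True c assms(2,3) by linarith
    ultimately show ?thesis using True by metis
  next
    case False
    then have a: "a + 1 = a'" using nz by metis
    have "(D = {}) = (D' = {}) \<and> in_col D = in_col D' \<and>
       (if \<not> in_row D' then 0 else if D' = {} then qnum x (a' + b') - qnum x b'
               else qnum x (a' + b' - 1) - qnum x (if in_col D' then b' else b' - 1)) \<noteq> 0"
      using nz a c by (intro pos_count_nonzero[OF _ assms(4)]) simp
    moreover have "b' = b \<and> c = c' + 1 \<and> e' = e" using a c assms(2,3) by linarith
    ultimately show ?thesis using a by metis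
  qed
qed

lemma shift_coeff_mat2: "shift_coeff x (mat2 a b c e, D) (A', D') =
    (if A' = mat2 a b c e then
       (if in_row D' then
          if D = {} then 1 else if D = {(1, 1)} then x ^ a - 1
          else if D = {(1, 2)} then x ^ (a + b) - x ^ a else 0
        else if in_hook D' then
          if D = {(2, 1)} then x ^ a
          else if D = {(1, 2), (2, 1)} then x ^ (a + b) - x ^ a else 0
        else if D = {(2, 2)} then x ^ (a + b) else 0) - of_bool (D = D')
     else 0)"
  unfolding shift_coeff_def case_prod_conv mat2_simps by (simp only: eq_commute[of A'])

lemma shift_coeff_from_empty: "shift_coeff x (mat2 a b c e, {}) (A', D') =
    (if A' = mat2 a b c e then of_bool (in_row D') - of_bool (D' = {}) else 0)"
  unfolding shift_coeff_mat2 by (simp add: eq_commute[of "{}"])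

lemma shift_coeff_from_21: "shift_coeff x (mat2 a b c e, {(2, 1)}) (A', D') =
    (if A' = mat2 a b c e then (if in_row D' \<or> \<not> in_hook D' then 0 else x ^ a) - of_bool (D' = {(2, 1)}) else 0)"
proof -
  have "{(2, 1)} \<noteq> {(1::nat, 2::nat), (2, 1)}" "{(2, 1)} \<noteq> {(2::nat, 2::nat)}" "{(2, 1)} \<noteq> {(1::nat, 1::nat)}" "{(2, 1)} \<noteq> {(1::nat, 2::nat)}" "{(2::nat, 1::nat)} \<noteq> {}"
    by (simp_all add: doubleton_eq_iff)
  then show ?thesis unfolding shift_coeff_mat2 eq_commute[of "{(2, 1)}" D'] by (simp del: One_nat_def)
qed

lemma pos_flags [simp]:
  "in_row {}" "in_col {}" "in_hook {}"
  "in_row {(1, 1)}" "in_col {(1, 1)}" "in_hook {(1, 1)}"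
  "in_row {(1, 2)}" "\<not> in_col {(1, 2)}" "in_hook {(1, 2)}"
  "\<not> in_row {(2, 1)}" "in_col {(2, 1)}" "in_hook {(2, 1)}"
  "\<not> in_row {(1, 2), (2, 1)}" "\<not> in_col {(1, 2), (2, 1)}" "in_hook {(1, 2), (2, 1)}"
  "\<not> in_row {(2, 2)}" "\<not> in_col {(2, 2)}" "\<not> in_hook {(2, 2)}"
  unfolding in_row_def in_col_def in_hook_def by (simp_all add: doubleton_eq_iff)

text \<open>One application of \<open>f\<^sub>r\<close>, of \<open>e\<^sub>r\<close> and of \<open>x\<^sub>r\<close>. The last premise lists the labels that can occur
  in the product besides \<open>z0\<close>.\<close>
lemma up_step:
  assumes y: "(mat2 a b c e, D) \<in> reachable d" and D: "in_row D" and z0: "z0 \<in> Xi d" "row_size z0 + 1 = a + b"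
    and monic: "monic_nonzero (up_coeff qvar (mat2 a b c e, D) z0)"
    and others: "\<And>a' b' c' e' D'. (mat2 a' b' c' e', D') \<noteq> z0 \<Longrightarrow> a' + b' + c' + e' = d \<Longrightarrow> admissible a' b' c' e' D' \<Longrightarrow>
      (D = {}) = (D' = {}) \<and> in_col D = in_col D' \<and>
        (a = a' + 1 \<and> b' = b \<and> c' = c + 1 \<and> e' = e \<and> in_hook D' \<or>
         a = a' \<and> b = b' + 1 \<and> c' = c \<and> e' = e + 1 \<and> (in_row D' \<or> \<not> in_hook D')) \<Longrightarrow>
      (mat2 a' b' c' e', D') \<in> reachable d"
  shows "z0 \<in> reachable d"
proof -
  have sum: "a + b + c + e = d" using reachable_Xi[OF y] by (simp add: Xi_mat2)
  then have rs: "row_size z0 + 1 + (c + e) = d" using z0(2) by simp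
  show ?thesis
  proof (rule reachable.step[OF _ y expands_up[OF reachable_Xi[OF y] rs] z0(1)])
    show "(mat2 (row_size z0) 0 1 (c + e), {}) \<in> gens d" unfolding gens_def using rs by blast
    fix z assume z: "z \<noteq> z0" "(if z \<in> Xi d \<and> row_size z = row_size z0 then up_coeff qvar (mat2 a b c e, D) z else 0) \<noteq> 0"
    then have zX: "z \<in> Xi d" and nz: "up_coeff qvar (mat2 a b c e, D) z \<noteq> 0" by (metis)+
    from zX obtain a' b' c' e' D' where z': "z = (mat2 a' b' c' e', D')" "a' + b' + c' + e' = d" "admissible a' b' c' e' D'"
      by (rule Xi_cases)
    show "z \<in> reachable d"
      unfolding z'(1) by (rule others[OF z(1)[unfolded z'(1)] z'(2,3) up_coeff_nonzero[OF nz[unfolded z'(1)] sum z'(2) D]])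
  qed (use z0(1) monic in simp)
qed

lemma down_step:
  assumes y: "(mat2 a b c e, D) \<in> reachable d" and D: "in_row D" and z0: "z0 \<in> Xi d" "row_size z0 = a + b + 1" and e: "0 < e"
    and monic: "monic_nonzero (down_coeff qvar (mat2 a b c e, D) z0)"
    and others: "\<And>a' b' c' e' D'. (mat2 a' b' c' e', D') \<noteq> z0 \<Longrightarrow> a' + b' + c' + e' = d \<Longrightarrow> admissible a' b' c' e' D' \<Longrightarrow>
      (D = {}) = (D' = {}) \<and> in_col D = in_col D' \<and> in_row D' \<and>
        (a' = a \<and> b' = b + 1 \<and> c' = c \<and> e = e' + 1 \<or> a' = a + 1 \<and> b' = b \<and> c = c' + 1 \<and> e' = e) \<Longrightarrow>
      (mat2 a' b' c' e', D') \<in> reachable d"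
  shows "z0 \<in> reachable d"
proof -
  have sum: "a + b + c + e = d" using reachable_Xi[OF y] by (simp add: Xi_mat2)
  then have rs: "a + b + 1 + (c + e - 1) = d" using e by simp
  show ?thesis
  proof (rule reachable.step[OF _ y expands_down[OF reachable_Xi[OF y] rs] z0(1)])
    show "(mat2 (a + b) 1 0 (c + e - 1), {}) \<in> gens d" unfolding gens_def using rs by blast
    fix z assume z: "z \<noteq> z0" "(if z \<in> Xi d \<and> row_size z = a + b + 1 then down_coeff qvar (mat2 a b c e, D) z else 0) \<noteq> 0"
    then have zX: "z \<in> Xi d" and nz: "down_coeff qvar (mat2 a b c e, D) z \<noteq> 0" by (metis)+
    from zX obtain a' b' c' e' D' where z': "z = (mat2 a' b' c' e', D')" "a' + b' + c' + e' = d" "admissible a' b' c' e' D'"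
      by (rule Xi_cases)
    show "z \<in> reachable d"
      unfolding z'(1) by (rule others[OF z(1)[unfolded z'(1)] z'(2,3) down_coeff_nonzero[OF nz[unfolded z'(1)] sum z'(2) D]])
  qed (use z0 monic in simp)
qed

lemma shift_step:
  assumes y: "(mat2 a b c e, D) \<in> reachable d" and ab: "0 < a + b" and z0: "(mat2 a b c e, D0) \<in> Xi d"
    and monic: "monic_nonzero (shift_coeff qvar (mat2 a b c e, D) (mat2 a b c e, D0))"
    and others: "\<And>D'. D' \<noteq> D0 \<Longrightarrow> admissible a b c e D' \<Longrightarrow> shift_coeff qvar (mat2 a b c e, D) (mat2 a b c e, D') \<noteq> 0 \<Longrightarrow>
      (mat2 a b c e, D') \<in> reachable d"
  shows "(mat2 a b c e, D0) \<in> reachable d"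
proof -
  have rs: "a + b + (c + e) = d" using z0 by (simp add: Xi_mat2)
  show ?thesis
  proof (rule reachable.step[OF _ y expands_shift[OF reachable_Xi[OF y] rs ab] z0])
    show "(mat2 (a + b) 0 0 (c + e), {(1, 1)}) \<in> gens d" unfolding gens_def using rs ab by blast
    fix z assume z: "z \<noteq> (mat2 a b c e, D0)"
      "(if z \<in> Xi d \<and> row_size z = a + b then shift_coeff qvar (mat2 a b c e, D) z else 0) \<noteq> 0"
    then have zX: "z \<in> Xi d" and nz: "shift_coeff qvar (mat2 a b c e, D) z \<noteq> 0" by metis+
    obtain A' D' where z': "z = (A', D')" by (cases z)
    have A': "A' = mat2 a b c e" using nz shift_coeff_other[of "mat2 a b c e" A'] unfolding z' by metis
    show "z \<in> reachable d"
      unfolding z' A' by (rule others) (use z(1) zX nz in \<open>simp_all add: z' A' Xi_mat2\<close>)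
  qed (use z0 monic in \<open>simp add: row_size_mat2\<close>)
qed

lemma delta_cases:
  assumes "admissible a b c e D"
  obtains "D = {}" | "D = {(1, 1)}" "0 < a" | "D = {(1, 2)}" "0 < b" | "D = {(2, 1)}" "0 < c"
    | "D = {(1, 2), (2, 1)}" "0 < b" "0 < c" | "D = {(2, 2)}" "0 < e"
proof -
  have "D \<in> deltas" using assms unfolding admissible_def by blast
  then consider "D = {}" | "D = {(1, 1)}" | "D = {(1, 2)}" | "D = {(2, 1)}" | "D = {(1, 2), (2, 1)}" | "D = {(2, 2)}"
    unfolding deltas_def by blast
  then show ?thesis
  proof cases
    case 1 then show ?thesis by (rule that(1))
  next
    case 2 then show ?thesis using that(2) assms by (simp only: admissible_simps)
  next
    case 3 then show ?thesis using that(3) assms by (simp only: admissible_simps)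
  next
    case 4 then show ?thesis using that(4) assms by (simp only: admissible_simps)
  next
    case 5 then show ?thesis using that(5) assms by (simp only: admissible_simps)
  next
    case 6 then show ?thesis using that(6) assms by (simp only: admissible_simps)
  qed
qed

text \<open>With \<open>(a, b, c, e)\<close> for the matrix \<open>mat2 a b c e\<close>: applying \<open>e\<^sub>r\<close> to \<open>(a, b, 0, e + 1)\<close> gives
  \<open>[b + 1] (a, b + 1, 0, e)\<close>, and applying \<open>f\<^sub>r\<close> to \<open>(a + 1, b, c, e)\<close> gives \<open>[c + 1] (a, b, c + 1, e)\<close> plus
  a multiple of \<open>(a + 1, b - 1, c, e + 1)\<close>, which has the same lower left entry \<open>c\<close> as before.\<close>
lemma reachable_empty: "a + b + c + e = d \<Longrightarrow> (mat2 a b c e, {}) \<in> reachable d"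
proof (induction c arbitrary: a b e)
  case 0
  then show ?case
  proof (induction b arbitrary: e)
    case 0
    then show ?case by (intro reachable.gen) (auto simp: gens_def)
  next
    case (Suc b)
    have y: "(mat2 a b 0 (e + 1), {}) \<in> reachable d" using Suc by simp
    show ?case
    proof (rule down_step[OF y])
      show "monic_nonzero (down_coeff qvar (mat2 a b 0 (e + 1), {}) (mat2 a (Suc b) 0 e, {}))"
        using monic_nonzero_qnum[of b] by (simp add: down_coeff_mat2 pos_count_def)
    qed (use Suc.prems in \<open>auto simp: Xi_mat2 row_size_mat2\<close>)
  qed
next
  case (Suc c)
  have y: "(mat2 (a + 1) b c e, {}) \<in> reachable d" using Suc by simp
  show ?case
  proof (rule up_step[OF y])
    show "monic_nonzero (up_coeff qvar (mat2 (a + 1) b c e, {}) (mat2 a b (Suc c) e, {}))"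
      using monic_nonzero_qnum[of c] by (simp add: up_coeff_mat2 pos_count_def)
  qed (use Suc in \<open>auto simp: Xi_mat2 row_size_mat2\<close>)
qed

text \<open>Induction on \<open>b\<close>. For \<open>b = 0\<close> there is no position \<open>(1, 2)\<close>, so \<open>x\<^sub>r\<close> takes \<open>(a, 0, c, e; {})\<close> to
  \<open>(a, 0, c, e; {(1, 1)})\<close>. Applying \<open>e\<^sub>r\<close> to \<open>(a, b, c, e + 1; {(1, 1)})\<close> gives
  \<open>[b + 1] (a, b + 1, c, e; {(1, 1)})\<close> plus a multiple of \<open>(a + 1, b, c - 1, e + 1; {(1, 1)})\<close>.\<close>
lemma reachable_11: "a + b + c + e = d \<Longrightarrow> 0 < a \<Longrightarrow> (mat2 a b c e, {(1, 1)}) \<in> reachable d"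
proof (induction b arbitrary: a c e)
  case 0
  have y: "(mat2 a 0 c e, {}) \<in> reachable d" by (rule reachable_empty) (use 0 in simp)
  show ?case
  proof (rule shift_step[OF y])
    show "(mat2 a 0 c e, {(1, 1)}) \<in> Xi d" "0 < a + 0" using 0 by (simp_all add: Xi_mat2 del: One_nat_def)
    show "monic_nonzero (shift_coeff qvar (mat2 a 0 c e, {}) (mat2 a 0 c e, {(1, 1)}))"
      using monic_nonzero_1 by (simp add: shift_coeff_from_empty del: One_nat_def)
    fix D' assume D': "D' \<noteq> {(1, 1)}" "admissible a 0 c e D'" "shift_coeff qvar (mat2 a 0 c e, {}) (mat2 a 0 c e, D') \<noteq> 0"
    from D'(2) show "(mat2 a 0 c e, D') \<in> reachable d"
      by (cases rule: delta_cases) (use D' in \<open>simp_all add: shift_coeff_from_empty del: One_nat_def\<close>)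
  qed
next
  case (Suc b)
  have y: "(mat2 a b c (e + 1), {(1, 1)}) \<in> reachable d" using Suc by simp
  show ?case
  proof (rule down_step[OF y])
    show "(mat2 a (Suc b) c e, {(1, 1)}) \<in> Xi d" using Suc.prems by (simp add: Xi_mat2 del: One_nat_def)
    show "monic_nonzero (down_coeff qvar (mat2 a b c (e + 1), {(1, 1)}) (mat2 a (Suc b) c e, {(1, 1)}))"
      using monic_nonzero_qnum[of b] by (simp add: down_coeff_mat2 pos_count_def del: One_nat_def)
    fix a' b' c' e' D'
    assume z: "(mat2 a' b' c' e', D') \<noteq> (mat2 a (Suc b) c e, {(1, 1)})" "a' + b' + c' + e' = d" "admissible a' b' c' e' D'"
      and nz: "({(1, 1)} = {}) = (D' = {}) \<and> in_col {(1, 1)} = in_col D' \<and> in_row D' \<and>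
        (a' = a \<and> b' = b + 1 \<and> c' = c \<and> e + 1 = e' + 1 \<or> a' = a + 1 \<and> b' = b \<and> c = c' + 1 \<and> e' = e + 1)"
    have IH: "(mat2 (a + 1) b c' (e + 1), {(1, 1)}) \<in> reachable d" if "c = c' + 1"
      using Suc.IH[of "a + 1" c' "e + 1"] Suc.prems that by (simp del: One_nat_def)
    from z(3) show "(mat2 a' b' c' e', D') \<in> reachable d"
    proof (cases rule: delta_cases)
      case 2
      then show ?thesis using nz z(1) IH by (auto simp del: One_nat_def)
    qed (use nz in \<open>simp_all del: One_nat_def\<close>)
  qed (simp_all add: row_size_mat2 pos_flags[unfolded One_nat_def])
qed

text \<open>The generator \<open>x\<^sub>r\<close> takes \<open>(A; {})\<close> to \<open>(A; {(1, 1)}) + (A; {(1, 2)})\<close>.\<close>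
lemma reachable_12: assumes "a + b + c + e = d" "0 < b" shows "(mat2 a b c e, {(1, 2)}) \<in> reachable d"
proof -
  have y: "(mat2 a b c e, {}) \<in> reachable d" by (rule reachable_empty) (use assms in simp)
  show ?thesis
  proof (rule shift_step[OF y])
    show "(mat2 a b c e, {(1, 2)}) \<in> Xi d" "0 < a + b" using assms by (simp_all add: Xi_mat2 del: One_nat_def)
    show "monic_nonzero (shift_coeff qvar (mat2 a b c e, {}) (mat2 a b c e, {(1, 2)}))"
      using monic_nonzero_1 by (simp add: shift_coeff_from_empty del: One_nat_def)
    fix D' assume D': "D' \<noteq> {(1, 2)}" "admissible a b c e D'" "shift_coeff qvar (mat2 a b c e, {}) (mat2 a b c e, D') \<noteq> 0"
    from D'(2) show "(mat2 a b c e, D') \<in> reachable d"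
      by (cases rule: delta_cases)
        (use D' reachable_11[OF assms(1)] in \<open>simp_all add: shift_coeff_from_empty del: One_nat_def\<close>)
  qed
qed

text \<open>Applying \<open>f\<^sub>r\<close> to \<open>(a + 1, b, c - 1, e; {(1, 1)})\<close> gives \<open>(a, b, c, e; {(2, 1)})\<close> once, because
  the only possible \<open>H\<close> is then \<open>U\<close> with \<open>v\<close> adjoined; all other terms have \<open>\<Delta> = {(1, 1)}\<close>.\<close>
lemma reachable_21: assumes "a + b + c + e = d" "0 < c" shows "(mat2 a b c e, {(2, 1)}) \<in> reachable d"
proof -
  obtain k where k: "c = Suc k" using assms(2) by (cases c) auto
  have y: "(mat2 (a + 1) b k e, {(1, 1)}) \<in> reachable d" by (rule reachable_11) (use assms k in simp_all)
  show ?thesis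
  proof (rule up_step[OF y])
    show "(mat2 a b c e, {(2, 1)}) \<in> Xi d" using assms by (simp add: Xi_mat2)
    show "monic_nonzero (up_coeff qvar (mat2 (a + 1) b k e, {(1, 1)}) (mat2 a b c e, {(2, 1)}))"
      using monic_nonzero_1 k by (simp add: up_coeff_mat2 pos_count_def pos_flags[unfolded One_nat_def])
    fix a' b' c' e' D'
    assume z: "(mat2 a' b' c' e', D') \<noteq> (mat2 a b c e, {(2, 1)})" "a' + b' + c' + e' = d" "admissible a' b' c' e' D'"
      and nz: "({(1, 1)} = {}) = (D' = {}) \<and> in_col {(1, 1)} = in_col D' \<and>
        (a + 1 = a' + 1 \<and> b' = b \<and> c' = k + 1 \<and> e' = e \<and> in_hook D' \<or>
         a + 1 = a' \<and> b = b' + 1 \<and> c' = k \<and> e' = e + 1 \<and> (in_row D' \<or> \<not> in_hook D'))"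
    from z(3) show "(mat2 a' b' c' e', D') \<in> reachable d"
    proof (cases rule: delta_cases)
      case 2
      then show ?thesis using reachable_11[OF z(2)] by (simp del: One_nat_def)
    next
      case 4
      then show ?thesis using nz z(1) k by (auto simp del: One_nat_def)
    qed (use nz in \<open>simp_all del: One_nat_def\<close>)
  qed (simp_all add: row_size_mat2 pos_flags[unfolded One_nat_def])
qed

text \<open>The generator \<open>x\<^sub>r\<close> takes \<open>(A; {(2, 1)})\<close> to a combination of itself and \<open>q\<^sup>a\<close> times
  \<open>(A; {(1, 2), (2, 1)})\<close>.\<close>
lemma reachable_1221: assumes "a + b + c + e = d" "0 < b" "0 < c" shows "(mat2 a b c e, {(1, 2), (2, 1)}) \<in> reachable d"
proof -
  have y: "(mat2 a b c e, {(2, 1)}) \<in> reachable d" by (rule reachable_21) (use assms in simp_all)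
  show ?thesis
  proof (rule shift_step[OF y])
    show "(mat2 a b c e, {(1, 2), (2, 1)}) \<in> Xi d" "0 < a + b" using assms by (simp_all add: Xi_mat2 del: One_nat_def)
    have "shift_coeff qvar (mat2 a b c e, {(2, 1)}) (mat2 a b c e, {(1, 2), (2, 1)}) = qvar ^ a"
      by (simp add: shift_coeff_from_21 doubleton_eq_iff del: One_nat_def)
    then show "monic_nonzero (shift_coeff qvar (mat2 a b c e, {(2, 1)}) (mat2 a b c e, {(1, 2), (2, 1)}))"
      using monic_nonzero_power[of a] by simp
    fix D' assume D': "D' \<noteq> {(1, 2), (2, 1)}" "admissible a b c e D'"
      "shift_coeff qvar (mat2 a b c e, {(2, 1)}) (mat2 a b c e, D') \<noteq> 0"
    from D'(2) show "(mat2 a b c e, D') \<in> reachable d"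
      by (cases rule: delta_cases)
        (use D' reachable_21[OF assms(1)] in \<open>simp_all add: shift_coeff_from_21 doubleton_eq_iff del: One_nat_def\<close>)
  qed
qed

text \<open>Applying \<open>f\<^sub>r\<close> to \<open>(a, b + 1, c, e - 1; {(1, 2)})\<close> gives \<open>(a, b, c, e; {(2, 2)})\<close> once, again with
  \<open>v\<close> adjoined to \<open>U\<close>; the other terms have \<open>\<Delta> = {(1, 2)}\<close> or \<open>\<Delta> = {(1, 2), (2, 1)}\<close>.\<close>
lemma reachable_22: assumes "a + b + c + e = d" "0 < e" shows "(mat2 a b c e, {(2, 2)}) \<in> reachable d"
proof -
  obtain k where k: "e = Suc k" using assms(2) by (cases e) auto
  have y: "(mat2 a (b + 1) c k, {(1, 2)}) \<in> reachable d" by (rule reachable_12) (use assms k in simp_all)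
  show ?thesis
  proof (rule up_step[OF y])
    show "(mat2 a b c e, {(2, 2)}) \<in> Xi d" using assms by (simp add: Xi_mat2)
    show "monic_nonzero (up_coeff qvar (mat2 a (b + 1) c k, {(1, 2)}) (mat2 a b c e, {(2, 2)}))"
      using monic_nonzero_1 k by (simp add: up_coeff_mat2 pos_count_def pos_flags[unfolded One_nat_def])
    fix a' b' c' e' D'
    assume z: "(mat2 a' b' c' e', D') \<noteq> (mat2 a b c e, {(2, 2)})" "a' + b' + c' + e' = d" "admissible a' b' c' e' D'"
      and nz: "({(1, 2)} = {}) = (D' = {}) \<and> in_col {(1, 2)} = in_col D' \<and>
        (a = a' + 1 \<and> b' = b + 1 \<and> c' = c + 1 \<and> e' = k \<and> in_hook D' \<or>
         a = a' \<and> b + 1 = b' + 1 \<and> c' = c \<and> e' = k + 1 \<and> (in_row D' \<or> \<not> in_hook D'))"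
    from z(3) show "(mat2 a' b' c' e', D') \<in> reachable d"
    proof (cases rule: delta_cases)
      case 3
      then show ?thesis using reachable_12[OF z(2)] by (simp del: One_nat_def)
    next
      case 5
      then show ?thesis using reachable_1221[OF z(2)] by (simp del: One_nat_def)
    next
      case 6
      then show ?thesis using nz z(1) k by (auto simp del: One_nat_def)
    qed (use nz in \<open>simp_all del: One_nat_def\<close>)
  qed (simp_all add: row_size_mat2 pos_flags[unfolded One_nat_def])
qed

lemma reachable_all: assumes "z \<in> Xi d" shows "z \<in> reachable d"
proof -
  obtain a b c e D where z: "z = (mat2 a b c e, D)" "a + b + c + e = d" "admissible a b c e D" using assms by (rule Xi_cases)
  from z(3) show ?thesis
  proof (cases rule: delta_cases)
    case 1 then show ?thesis using reachable_empty[OF z(2)] z(1) by simp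
  next
    case 2 then show ?thesis using reachable_11[OF z(2)] z(1) by (simp only:)
  next
    case 3 then show ?thesis using reachable_12[OF z(2)] z(1) by (simp only:)
  next
    case 4 then show ?thesis using reachable_21[OF z(2)] z(1) by (simp only:)
  next
    case 5 then show ?thesis using reachable_1221[OF z(2)] z(1) by (simp only:)
  next
    case 6 then show ?thesis using reachable_22[OF z(2)] z(1) by (simp only:)
  qed
qed

section \<open>The generic algebra\<close>

definition ev :: "int poly \<Rightarrow> ratfun" where
  "ev p = poly (map_poly of_int p) (vv ^ 2)"

lemma ev_0 [simp]: "ev 0 = 0" by (simp add: ev_def)
lemma ev_1 [simp]: "ev 1 = 1" by (simp add: ev_def)

text \<open>The embedding of the polynomials into their fraction field.\<close>
definition embed :: "complex poly \<Rightarrow> ratfun" where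
  "embed f = Fraction_Field.Fract f 1"

lemma embed_eq_iff: "embed f = embed g \<longleftrightarrow> f = g" unfolding embed_def by (simp add: eq_fract)
lemma embed_add: "embed (f + g) = embed f + embed g" unfolding embed_def by simp
lemma embed_mult: "embed (f * g) = embed f * embed g" unfolding embed_def by simp
lemma embed_0: "embed 0 = 0" unfolding embed_def by (simp add: Zero_fract_def)
lemma embed_1: "embed 1 = 1" unfolding embed_def by (simp add: One_fract_def)
lemma embed_power: "embed (f ^ n) = embed f ^ n"
  by (induction n) (simp_all add: embed_1 embed_mult)
lemma embed_sum: "embed (sum f A) = (\<Sum>i\<in>A. embed (f i))"
  by (induction A rule: infinite_finite_induct) (simp_all add: embed_0 embed_add)
lemma embed_of_nat: "embed (of_nat n) = of_nat n"
  by (induction n) (simp_all add: embed_0 embed_1 embed_add)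
lemma embed_minus: "embed (- f) = - embed f" unfolding embed_def by simp
lemma embed_of_int: "embed (of_int n) = of_int n"
  by (cases n rule: int_cases2) (simp_all add: embed_of_nat embed_minus)
lemma vv_embed: "vv = embed [:0, 1:]" unfolding vv_def embed_def ..

lemma vv_nonzero: "vv \<noteq> 0"
  using embed_eq_iff[of "[:0, 1:]" 0] unfolding vv_embed embed_0 by simp

lemma vv_power_inject: "vv ^ m = vv ^ n \<longleftrightarrow> m = n"
proof
  assume "vv ^ m = vv ^ n"
  then have "[:0, 1:] ^ m = ([:0, 1:] ^ n :: complex poly)" unfolding vv_embed embed_power[symmetric] embed_eq_iff .
  then have "degree ([:0, 1:] ^ m :: complex poly) = degree ([:0, 1:] ^ n :: complex poly)" by simp
  then show "m = n" by (simp add: degree_power_eq)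
qed simp

lemma vv_powi_inject:
  assumes "vv powi i = vv powi j" shows "i = j"
proof -
  have *: "i = j" if "i \<le> j" "vv powi i = vv powi j" for i j
  proof -
    define n where "n = nat (j - i)"
    have "j = i + int n" unfolding n_def using that(1) by simp
    then have "vv powi j = vv powi i * vv ^ nat (j - i)"
      using power_int_add[of vv i "int n"] vv_nonzero unfolding n_def[symmetric] by (simp add: power_int_of_nat)
    then have "vv powi i * (vv ^ nat (j - i) - 1) = 0" using that(2) by (simp add: algebra_simps)
    then have "vv ^ nat (j - i) = vv ^ 0" using vv_nonzero by simp
    then have "nat (j - i) = 0" unfolding vv_power_inject .
    then show ?thesis using that(1) by simp
  qed
  show ?thesis using *[of i j] *[of j i] assms by (cases "i \<le> j") simp_all
qed

lemma of_int_ratfun_nonzero: "n \<noteq> 0 \<Longrightarrow> (of_int n :: ratfun) \<noteq> 0"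
  using embed_eq_iff[of "of_int n" 0] unfolding embed_of_int embed_0 by simp

text \<open>The polynomial \<open>p(v\<^sup>2)\<close> in \<open>v\<close> takes the value \<open>p(n\<^sup>2)\<close> at every natural number \<open>n\<close>.\<close>
lemma ev_nonzero: assumes "p \<noteq> 0" shows "ev p \<noteq> 0"
proof
  assume "ev p = 0"
  have deg: "degree (map_poly of_int p :: ratfun poly) = degree p"
    by (rule degree_map_poly) (rule of_int_ratfun_nonzero)
  let ?P = "\<Sum>i\<le>degree p. of_int (Polynomial.coeff p i) * ([:0, 1:] ^ 2) ^ i :: complex poly"
  have "ev p = embed ?P"
    unfolding ev_def poly_altdef deg
    by (simp add: coeff_map_poly embed_sum embed_mult embed_power embed_of_int vv_embed)
  then have "?P = 0" using \<open>ev p = 0\<close> embed_eq_iff[of ?P 0] embed_0 by simp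
  have "poly p (int n ^ 2) = 0" for n
  proof -
    have "of_int (poly p (int n ^ 2)) = poly ?P (of_nat n)"
      unfolding poly_altdef[of p] by (simp add: poly_sum poly_power)
    then have "(of_int (poly p (int n ^ 2)) :: complex) = 0" unfolding \<open>?P = 0\<close> by simp
    then show ?thesis by simp
  qed
  then have "range (\<lambda>n. int n ^ 2) \<subseteq> {x. poly p x = 0}" by auto
  moreover have "infinite (range (\<lambda>n. int n ^ 2))"
    by (rule range_inj_infinite) (auto intro!: injI simp: power_eq_iff_eq_base)
  ultimately show False using poly_roots_finite[OF assms] finite_subset by blast
qed

lemma carrier_MU: "carrier (MU d) = {a. \<forall>z. z \<notin> Xi d \<longrightarrow> a z = 0}" by (simp add: MU_def)

lemma mult_MU: "(a \<otimes>\<^bsub>MU d\<^esub> b) z = (\<Sum>x\<in>Xi d. \<Sum>y\<in>Xi d. a x * b y * ev (struct_poly d x y z))"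
  by (simp add: MU_def ev_def)

lemma add_MU: "a \<oplus>\<^bsub>MU d\<^esub> b = (\<lambda>z. a z + b z)" by (simp add: MU_def)
lemma smult_MU: "c \<odot>\<^bsub>MU d\<^esub> a = (\<lambda>z. c * a z)" by (simp add: MU_def)

lemma struct_poly_outside:
  assumes "x \<in> Xi d" "y \<in> Xi d" "z \<notin> Xi d" shows "struct_poly d x y z = 0"
proof -
  have "left_polynomial d x" using reachable_left_polynomial[OF reachable_all[OF assms(1)]] .
  then obtain c where c: "expands d x y c" using assms(2) unfolding left_polynomial_def by blast
  then show ?thesis using struct_poly_eq[OF c] expandsD(1)[OF c assms(3)] by simp
qed

lemma mult_T_left:
  assumes "x \<in> Xi d"
  shows "(T x \<otimes>\<^bsub>MU d\<^esub> b) z = (\<Sum>y\<in>Xi d. b y * ev (struct_poly d x y z))"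
proof -
  have "(\<Sum>y\<in>Xi d. T x x' * b y * ev (struct_poly d x' y z)) =
     (if x' = x then \<Sum>y\<in>Xi d. b y * ev (struct_poly d x y z) else 0)" for x'
    by (simp add: T_def)
  then show ?thesis unfolding mult_MU using assms finite_Xi by (simp add: sum.delta)
qed

lemma mult_T_T:
  assumes "x \<in> Xi d" "y \<in> Xi d" "expands d x y c"
  shows "T x \<otimes>\<^bsub>MU d\<^esub> T y = (\<lambda>z. ev (c z))"
proof
  fix z
  have "(\<Sum>y'\<in>Xi d. T y y' * ev (struct_poly d x y' z)) = (\<Sum>y'\<in>Xi d. if y' = y then ev (struct_poly d x y z) else 0)"
    by (rule sum.cong[OF refl]) (simp add: T_def)
  then show "(T x \<otimes>\<^bsub>MU d\<^esub> T y) z = ev (c z)"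
    unfolding mult_T_left[OF assms(1)] struct_poly_eq[OF assms(3), symmetric] using assms(2) finite_Xi by (simp add: sum.delta')
qed

abbreviation idem_label :: "nat \<Rightarrow> nat \<Rightarrow> label" where "idem_label d r \<equiv> (mat2 r 0 0 (d - r), {})"

lemma idem_label_Xi: "r \<le> d \<Longrightarrow> idem_label d r \<in> Xi d" by (simp add: Xi_mat2)

lemma diag2_mat2: "diag2 r s = mat2 r 0 0 s"
  by (intro ext) (simp add: diag2_def mat2_def)

lemma one_elt_T: "one_elt d r = T (idem_label d r)" by (simp add: one_elt_def diag2_mat2)

lemma x_elt_T: "x_elt d r = T (mat2 r 0 0 (d - r), {(1, 1)})" by (simp add: x_elt_def diag2_mat2)

lemma e_elt_T: "e_elt d r = T (mat2 r 1 0 (d - r - 1), {})"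
proof -
  have "(\<lambda>i j. diag2 r (d - r - 1) i j + elem2 1 2 i j) = mat2 r 1 0 (d - r - 1)"
    by (intro ext) (auto simp: diag2_def elem2_def mat2_def)
  then show ?thesis unfolding e_elt_def by simp
qed

lemma f_elt_T: "f_elt d r = T (mat2 r 0 1 (d - r - 1), {})"
proof -
  have "(\<lambda>i j. diag2 r (d - r - 1) i j + elem2 2 1 i j) = mat2 r 0 1 (d - r - 1)"
    by (intro ext) (auto simp: diag2_def elem2_def mat2_def)
  then show ?thesis unfolding f_elt_def by simp
qed

lemma mult_idem_left:
  assumes "r \<le> d" "b \<in> carrier (MU d)"
  shows "one_elt d r \<otimes>\<^bsub>MU d\<^esub> b = (\<lambda>z. if row_size z = r then b z else 0)"
proof
  fix z
  have rs: "r + (d - r) = d" using assms(1) by simp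
  have "(one_elt d r \<otimes>\<^bsub>MU d\<^esub> b) z = (\<Sum>y\<in>Xi d. b y * ev (struct_poly d (idem_label d r) y z))"
    unfolding one_elt_T by (rule mult_T_left[OF idem_label_Xi[OF assms(1)]])
  also have "\<dots> = (\<Sum>y\<in>Xi d. if y = z then (if row_size z = r then b z else 0) else 0)"
    by (rule sum.cong[OF refl]) (auto simp: struct_poly_eq[OF expands_idem[OF _ rs]])
  also have "\<dots> = (if row_size z = r then b z else 0)"
  proof -
    have "z \<notin> Xi d \<Longrightarrow> b z = 0" using assms(2) unfolding carrier_MU by blast
    then show ?thesis using finite_Xi by (simp add: sum.delta)
  qed
  finally show "(one_elt d r \<otimes>\<^bsub>MU d\<^esub> b) z = (if row_size z = r then b z else 0)" .
qed

text \<open>Combinations of the idempotents \<open>1\<^sub>r\<close>; they multiply componentwise, and \<open>k\<close> and \<open>1\<close> are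
  among them.\<close>
definition diagonal :: "nat \<Rightarrow> (nat \<Rightarrow> ratfun) \<Rightarrow> label \<Rightarrow> ratfun" where
  "diagonal d f = (\<lambda>z. \<Sum>r\<in>{0..d}. f r * one_elt d r z)"

lemma diagonal_value: "r \<le> d \<Longrightarrow> diagonal d f (idem_label d r) = f r"
proof -
  assume r: "r \<le> d"
  have "diagonal d f (idem_label d r) = (\<Sum>s\<in>{0..d}. if s = r then f r else 0)"
    unfolding diagonal_def by (rule sum.cong[OF refl]) (auto simp: one_elt_T T_def)
  then show ?thesis using r by (simp add: sum.delta)
qed

lemma diagonal_other: "(\<And>r. r \<le> d \<Longrightarrow> z \<noteq> idem_label d r) \<Longrightarrow> diagonal d f z = 0"
  unfolding diagonal_def by (rule sum.neutral) (auto simp: one_elt_T T_def)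

lemma diagonal_cases:
  obtains r where "r \<le> d" "z = idem_label d r" | "\<And>r. r \<le> d \<Longrightarrow> z \<noteq> idem_label d r" by blast

lemma mult_diagonal_left:
  assumes "b \<in> carrier (MU d)"
  shows "diagonal d f \<otimes>\<^bsub>MU d\<^esub> b = (\<lambda>z. \<Sum>r\<in>{0..d}. f r * (if row_size z = r then b z else 0))"
proof
  fix z
  have "(diagonal d f \<otimes>\<^bsub>MU d\<^esub> b) z =
     (\<Sum>x\<in>Xi d. \<Sum>y\<in>Xi d. \<Sum>r\<in>{0..d}. f r * (one_elt d r x * b y * ev (struct_poly d x y z)))"
    unfolding mult_MU diagonal_def by (simp add: sum_distrib_right mult.assoc)
  also have "\<dots> = (\<Sum>x\<in>Xi d. \<Sum>r\<in>{0..d}. \<Sum>y\<in>Xi d. f r * (one_elt d r x * b y * ev (struct_poly d x y z)))"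
    by (rule sum.cong[OF refl], rule sum.swap)
  also have "\<dots> = (\<Sum>r\<in>{0..d}. \<Sum>x\<in>Xi d. \<Sum>y\<in>Xi d. f r * (one_elt d r x * b y * ev (struct_poly d x y z)))"
    by (rule sum.swap)
  also have "\<dots> = (\<Sum>r\<in>{0..d}. f r * (one_elt d r \<otimes>\<^bsub>MU d\<^esub> b) z)"
    unfolding mult_MU sum_distrib_left ..
  also have "\<dots> = (\<Sum>r\<in>{0..d}. f r * (if row_size z = r then b z else 0))"
    by (rule sum.cong[OF refl]) (simp add: mult_idem_left assms)
  finally show "(diagonal d f \<otimes>\<^bsub>MU d\<^esub> b) z = (\<Sum>r\<in>{0..d}. f r * (if row_size z = r then b z else 0))" .
qed

lemma diagonal_carrier: "diagonal d f \<in> carrier (MU d)"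
  unfolding carrier_MU
proof (intro CollectI allI impI)
  fix z assume z: "z \<notin> Xi d"
  show "diagonal d f z = 0" by (rule diagonal_other) (use z idem_label_Xi in metis)
qed

lemma diagonal_mult: "diagonal d f \<otimes>\<^bsub>MU d\<^esub> diagonal d g = diagonal d (\<lambda>r. f r * g r)"
proof
  fix z
  show "(diagonal d f \<otimes>\<^bsub>MU d\<^esub> diagonal d g) z = diagonal d (\<lambda>r. f r * g r) z"
  proof (cases rule: diagonal_cases[of d z])
    case (1 r)
    have "(\<Sum>s\<in>{0..d}. f s * (if row_size z = s then diagonal d g z else 0)) = (\<Sum>s\<in>{0..d}. if s = r then f r * g r else 0)"
      by (rule sum.cong[OF refl]) (auto simp: 1 row_size_mat2 diagonal_value)
    then show ?thesis unfolding mult_diagonal_left[OF diagonal_carrier] using 1 by (simp add: sum.delta diagonal_value)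
  next
    case 2
    have z0: "diagonal d g z = 0" "diagonal d (\<lambda>r. f r * g r) z = 0"
      by (rule diagonal_other, erule 2)+
    show ?thesis unfolding mult_diagonal_left[OF diagonal_carrier] z0 if_cancel mult_zero_right sum.neutral_const ..
  qed
qed

lemma diagonal_add: "diagonal d f z + c * diagonal d g z = diagonal d (\<lambda>r. f r + c * g r) z"
proof -
  have "diagonal d f z + c * diagonal d g z = (\<Sum>r\<in>{0..d}. f r * one_elt d r z + c * (g r * one_elt d r z))"
    unfolding diagonal_def sum_distrib_left sum.distrib ..
  also have "\<dots> = diagonal d (\<lambda>r. f r + c * g r) z"
    unfolding diagonal_def by (rule sum.cong[OF refl]) (simp only: distrib_right mult.assoc)
  finally show ?thesis .
qed

lemma mult_closed:
  assumes "a \<in> carrier (MU d)" "b \<in> carrier (MU d)" shows "a \<otimes>\<^bsub>MU d\<^esub> b \<in> carrier (MU d)"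
  unfolding carrier_MU
proof (intro CollectI allI impI)
  fix z assume "z \<notin> Xi d"
  then show "(a \<otimes>\<^bsub>MU d\<^esub> b) z = 0" 
    unfolding mult_MU by (intro sum.neutral ballI) (simp add: struct_poly_outside)
qed

context
  fixes d :: nat
begin

abbreviation "generators \<equiv> {e_gen d, f_gen d, k_gen d, k_inv_gen d, l_gen d}"
abbreviation "GA \<equiv> generated_algebra (MU d) generators"

lemma GA_add: "a \<in> GA \<Longrightarrow> b \<in> GA \<Longrightarrow> (\<lambda>z. a z + b z) \<in> GA"
  using generated_algebra.add[of a "MU d" generators b] unfolding add_MU .

lemma GA_smult: "a \<in> GA \<Longrightarrow> (\<lambda>z. c * a z) \<in> GA"
  using generated_algebra.smult[of a "MU d" generators c] unfolding smult_MU .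

lemma GA_one: "diagonal d (\<lambda>_. 1) \<in> GA"
  using generated_algebra.one[of "MU d" generators] by (simp add: MU_def diagonal_def)

lemma GA_zero: "(\<lambda>z. 0) \<in> GA"
  using GA_smult[OF GA_one, of 0] by simp

lemma GA_sum: "finite A \<Longrightarrow> (\<And>i. i \<in> A \<Longrightarrow> f i \<in> GA) \<Longrightarrow> (\<lambda>z. \<Sum>i\<in>A. c i * f i z) \<in> GA"
proof (induction A rule: finite_induct)
  case empty then show ?case using GA_zero by simp
next
  case (insert x A)
  have "(\<lambda>z. \<Sum>i\<in>A. c i * f i z) \<in> GA" by (rule insert.IH) (rule insert.prems, rule insertI2)
  then have "(\<lambda>z. c x * f x z + (\<Sum>i\<in>A. c i * f i z)) \<in> GA"
    by (rule GA_add[OF GA_smult[OF insert.prems[OF insertI1]]])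
  then show ?case unfolding sum.insert[OF insert.hyps] .
qed

lemma GA_mult: "a \<in> GA \<Longrightarrow> b \<in> GA \<Longrightarrow> a \<otimes>\<^bsub>MU d\<^esub> b \<in> GA"
  by (rule generated_algebra.mult)

lemma gens_carrier: "generators \<subseteq> carrier (MU d)"
proof -
  have e: "e_elt d r z = 0" if "z \<notin> Xi d" "r \<in> {0..<d}" for r z
    using that unfolding e_elt_T T_def by (auto simp: Xi_mat2)
  have f: "f_elt d r z = 0" if "z \<notin> Xi d" "r \<in> {0..<d}" for r z
    using that unfolding f_elt_T T_def by (auto simp: Xi_mat2)
  have o: "one_elt d r z = 0" if "z \<notin> Xi d" "r \<in> {0..d}" for r z
    using that idem_label_Xi[of r d] unfolding one_elt_T T_def by auto
  have x: "x_elt d r z = 0" if "z \<notin> Xi d" "r \<in> {1..d}" for r z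
    using that unfolding x_elt_T T_def by (auto simp: Xi_mat2 simp del: One_nat_def)
  have "e_gen d z = 0" "f_gen d z = 0" "k_gen d z = 0" "k_inv_gen d z = 0" "l_gen d z = 0" if z: "z \<notin> Xi d" for z
  proof -
    show "e_gen d z = 0" unfolding e_gen_def by (rule sum.neutral) (simp add: e[OF z])
    show "f_gen d z = 0" unfolding f_gen_def by (rule sum.neutral) (simp add: f[OF z])
    show "k_gen d z = 0" unfolding k_gen_def by (rule sum.neutral) (simp add: o[OF z])
    show "k_inv_gen d z = 0" unfolding k_inv_gen_def by (rule sum.neutral) (simp add: o[OF z])
    have "(\<Sum>r\<in>{1..d}. vv powi (- 2 * int r) * (one_elt d r z + x_elt d r z)) = 0"
      by (rule sum.neutral) (simp add: o[OF z] x[OF z])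
    then show "l_gen d z = 0" unfolding l_gen_def by (simp add: o[OF z])
  qed
  then show ?thesis unfolding carrier_MU by blast
qed

lemma GA_carrier: "GA \<subseteq> carrier (MU d)"
proof
  fix a assume "a \<in> GA"
  then show "a \<in> carrier (MU d)"
  proof (induction rule: generated_algebra.induct)
    case (generator a) then show ?case using gens_carrier by blast
  next
    case one
    have "\<one>\<^bsub>MU d\<^esub> = diagonal d (\<lambda>_. 1)" by (simp add: MU_def diagonal_def)
    then show ?case using diagonal_carrier by simp
  next
    case (add a b) then show ?case unfolding carrier_MU add_MU by simp
  next
    case (smult a c) then show ?case unfolding carrier_MU smult_MU by simp
  next
    case (mult a b) then show ?case using mult_closed by blast
  qed
qed

lemma k_diagonal: "k_gen d = diagonal d (\<lambda>r. vv powi (2 * int r - int d))"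
  by (intro ext) (simp add: k_gen_def diagonal_def)

text \<open>The element \<open>k\<close> acts on \<open>1\<^sub>r\<close> by the scalar \<open>v\<^sup>2\<^sup>r\<^sup>-\<^sup>d\<close>. These scalars are distinct, so Lagrange
  interpolation expresses each \<open>1\<^sub>r\<close> as a polynomial in \<open>k\<close>.\<close>
lemma GA_interpolate:
  assumes "finite S"
  shows "diagonal d (\<lambda>r. \<Prod>s\<in>S. vv powi (2 * int r - int d) - vv powi (2 * int s - int d)) \<in> GA"
  using assms
proof (induction S rule: finite_induct)
  case empty then show ?case using GA_one by simp
next
  case (insert s S)
  let ?l = "\<lambda>r. vv powi (2 * int r - int d)"
  let ?g = "\<lambda>r. \<Prod>s\<in>S. ?l r - ?l s"
  have k: "k_gen d \<in> GA" by (rule generated_algebra.generator) simp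
  have "(\<lambda>z. (k_gen d \<otimes>\<^bsub>MU d\<^esub> diagonal d ?g) z + - ?l s * diagonal d ?g z) \<in> GA"
    by (rule GA_add[OF GA_mult[OF k insert.IH] GA_smult[OF insert.IH]])
  also have "(\<lambda>z. (k_gen d \<otimes>\<^bsub>MU d\<^esub> diagonal d ?g) z + - ?l s * diagonal d ?g z) = diagonal d (\<lambda>r. (?l r - ?l s) * ?g r)"
    unfolding k_diagonal diagonal_mult diagonal_add by (simp only: left_diff_distrib mult_minus_left add_uminus_conv_diff)
  finally show ?case unfolding prod.insert[OF insert.hyps] .
qed

lemma GA_idem: assumes r: "r \<le> d" shows "one_elt d r \<in> GA"
proof -
  let ?l = "\<lambda>r. vv powi (2 * int r - int d)"
  let ?p = "\<lambda>t. \<Prod>s\<in>{0..d} - {r}. ?l t - ?l s"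
  have nz: "?p r \<noteq> 0"
  proof -
    have "?l r - ?l s \<noteq> 0" if "s \<noteq> r" for s using vv_powi_inject[of "2 * int r - int d" "2 * int s - int d"] that by auto
    then show ?thesis by (simp add: prod_zero_iff)
  qed
  have z: "?p t = 0" if "t \<le> d" "t \<noteq> r" for t
    using that by (intro prod_zero) auto
  have "(\<lambda>z. inverse (?p r) * diagonal d ?p z) \<in> GA" by (intro GA_smult GA_interpolate) simp
  also have "(\<lambda>z. inverse (?p r) * diagonal d ?p z) = one_elt d r"
  proof
    fix w
    show "inverse (?p r) * diagonal d ?p w = one_elt d r w"
    proof (cases rule: diagonal_cases[of d w])
      case (1 t)
      have "diagonal d ?p w = ?p t" unfolding 1(2) by (rule diagonal_value[OF 1(1)])
      moreover have "one_elt d r w = of_bool (t = r)" unfolding 1(2) one_elt_T T_def by auto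
      ultimately show ?thesis using nz z[OF 1(1)] by (cases "t = r") simp_all
    next
      case 2
      have "diagonal d ?p w = 0" by (rule diagonal_other[OF 2])
      then show ?thesis using 2[OF r] unfolding one_elt_T T_def by simp
    qed
  qed
  finally show ?thesis .
qed

text \<open>Left multiplication by \<open>1\<^sub>r\<close> selects the labels with first row sum \<open>r\<close>. This cuts the
  generators \<open>e\<close>, \<open>f\<close>, \<open>l\<close> into the pieces \<open>e\<^sub>r\<^sub>-\<^sub>1\<close>, \<open>f\<^sub>r\<close>, \<open>1\<^sub>r + x\<^sub>r\<close>.\<close>
lemma GA_row: assumes "r \<le> d" "b \<in> GA" shows "(\<lambda>z. if row_size z = r then b z else 0) \<in> GA"
proof -
  have b: "b \<in> carrier (MU d)" using GA_carrier assms(2) by blast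
  show ?thesis using GA_mult[OF GA_idem[OF assms(1)] assms(2)] unfolding mult_idem_left[OF assms(1) b] .
qed

lemma GA_scaled: assumes "(\<lambda>z. c * a z) \<in> GA" "c \<noteq> 0" shows "a \<in> GA"
proof -
  have "inverse c * (c * x) = x" for x
    unfolding mult.assoc[symmetric] left_inverse[OF assms(2)] mult_1_left ..
  then show ?thesis using GA_smult[OF assms(1), of "inverse c"] by (simp only:)
qed

lemma GA_component:
  assumes r: "r \<le> d" and a: "a \<in> GA" and c: "c \<noteq> 0"
    and row: "\<And>z. row_size z = r \<Longrightarrow> a z = c * b z" and other: "\<And>z. row_size z \<noteq> r \<Longrightarrow> b z = 0"
  shows "b \<in> GA"
proof -
  have "(\<lambda>z. if row_size z = r then a z else 0) = (\<lambda>z. c * b z)" using row other by auto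
  then show ?thesis using GA_scaled[OF _ c, of b] GA_row[OF r a] by simp
qed

lemma GA_e: assumes r: "r < d" shows "e_elt d r \<in> GA"
proof (rule GA_component)
  show "e_gen d \<in> GA" by (rule generated_algebra.generator) simp
  show "r + 1 \<le> d" "vv powi (- int r) \<noteq> 0" using r vv_nonzero by simp_all
  fix z
  show "e_elt d r z = 0" if "row_size z \<noteq> r + 1"
    using that unfolding e_elt_T T_def by (auto simp: row_size_mat2)
  assume z: "row_size z = r + 1"
  have "e_gen d z = (\<Sum>s\<in>{0..<d}. if s = r then vv powi (- int r) * e_elt d r z else 0)"
    unfolding e_gen_def by (rule sum.cong[OF refl]) (use z in \<open>auto simp: e_elt_T T_def row_size_mat2\<close>)
  then show "e_gen d z = vv powi (- int r) * e_elt d r z" using r by (simp add: sum.delta)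
qed

lemma GA_f: assumes r: "r < d" shows "f_elt d r \<in> GA"
proof (rule GA_component)
  show "f_gen d \<in> GA" by (rule generated_algebra.generator) simp
  show "r \<le> d" "vv powi (1 + int r - int d) \<noteq> 0" using r vv_nonzero by simp_all
  fix z
  show "f_elt d r z = 0" if "row_size z \<noteq> r"
    using that unfolding f_elt_T T_def by (auto simp: row_size_mat2)
  assume z: "row_size z = r"
  have "f_gen d z = (\<Sum>s\<in>{0..<d}. if s = r then vv powi (1 + int r - int d) * f_elt d r z else 0)"
    unfolding f_gen_def by (rule sum.cong[OF refl]) (use z in \<open>auto simp: f_elt_T T_def row_size_mat2\<close>)
  then show "f_gen d z = vv powi (1 + int r - int d) * f_elt d r z" using r by (simp add: sum.delta)
qed

lemma GA_x: assumes r: "r \<in> {1..d}" shows "x_elt d r \<in> GA"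
proof -
  let ?c = "vv powi (- 2 * int r)"
  have rd: "r \<le> d" using r by simp
  have "(\<lambda>z. one_elt d r z + x_elt d r z) \<in> GA"
  proof (rule GA_component[OF rd])
    show "l_gen d \<in> GA" by (rule generated_algebra.generator) simp
    show "?c \<noteq> 0" using vv_nonzero by simp
    have rows: "one_elt d s z + x_elt d s z = 0" if "row_size z \<noteq> s" for s z
      using that unfolding one_elt_T x_elt_T T_def by (auto simp: row_size_mat2)
    then show "\<And>z. row_size z \<noteq> r \<Longrightarrow> one_elt d r z + x_elt d r z = 0" .
    fix z assume z: "row_size z = r"
    have o0: "one_elt d 0 z = 0" using z r unfolding one_elt_T T_def by (auto simp: row_size_mat2)
    have "(\<Sum>s\<in>{1..d}. vv powi (- 2 * int s) * (one_elt d s z + x_elt d s z))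
        = (\<Sum>s\<in>{1..d}. if s = r then ?c * (one_elt d r z + x_elt d r z) else 0)"
      by (rule sum.cong[OF refl]) (use rows z in auto)
    then show "l_gen d z = ?c * (one_elt d r z + x_elt d r z)"
      using r o0 unfolding l_gen_def by (simp add: sum.delta)
  qed
  then have "(\<lambda>z. (one_elt d r z + x_elt d r z) + - 1 * one_elt d r z) \<in> GA"
    by (rule GA_add[OF _ GA_smult[OF GA_idem[OF rd]]])
  then show ?thesis by simp
qed

lemma GA_gens: assumes "g \<in> gens d" shows "T g \<in> GA"
proof -
  consider r s where "g = (mat2 r 1 0 s, {})" "r + 1 + s = d" | r s where "g = (mat2 r 0 1 s, {})" "r + 1 + s = d"
    | r s where "g = (mat2 r 0 0 s, {})" "r + s = d" | r s where "g = (mat2 r 0 0 s, {(1, 1)})" "r + s = d" "0 < r"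
    using assms unfolding gens_def by blast
  then show ?thesis
  proof cases
    case (1 r s)
    then have s: "s = d - r - 1" "r < d" by simp_all
    show ?thesis using GA_e[OF s(2)] unfolding e_elt_T 1(1) s(1) .
  next
    case (2 r s)
    then have s: "s = d - r - 1" "r < d" by simp_all
    show ?thesis using GA_f[OF s(2)] unfolding f_elt_T 2(1) s(1) .
  next
    case (3 r s)
    then have s: "s = d - r" "r \<le> d" by simp_all
    show ?thesis using GA_idem[OF s(2)] unfolding one_elt_T 3(1) s(1) .
  next
    case (4 r s)
    then have s: "s = d - r" "r \<in> {1..d}" by simp_all
    show ?thesis using GA_x[OF s(2)] unfolding x_elt_T 4(1) s(1) .
  qed
qed

lemma GA_reachable: assumes "z \<in> reachable d" shows "T z \<in> GA"
  using assms
proof (induction rule: reachable.induct)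
  case (gen g) then show ?case by (rule GA_gens)
next
  case (step g y c z0)
  have c0: "ev (c z0) \<noteq> 0"
    by (rule ev_nonzero) (use step(5) in \<open>auto simp: monic_nonzero_def\<close>)
  let ?w = "T g \<otimes>\<^bsub>MU d\<^esub> T y"
  have w: "?w = (\<lambda>z. ev (c z))"
    using gens_Xi step(1) by (intro mult_T_T[OF _ reachable_Xi[OF step(2)] step(3)]) blast
  let ?A = "{z \<in> Xi d - {z0}. c z \<noteq> 0}"
  have "?w \<in> GA" using GA_gens[OF step(1)] step.IH(1) by (rule GA_mult)
  moreover have "(\<lambda>z. \<Sum>x\<in>?A. ev (c x) * T x z) \<in> GA"
    using finite_Xi step.IH(2) by (intro GA_sum) auto
  ultimately have "(\<lambda>z. ?w z + - 1 * (\<Sum>x\<in>?A. ev (c x) * T x z)) \<in> GA" by (intro GA_add GA_smult)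
  also have "(\<lambda>z. ?w z + - 1 * (\<Sum>x\<in>?A. ev (c x) * T x z)) = (\<lambda>z. ev (c z0) * T z0 z)"
  proof
    fix z
    have "(\<Sum>x\<in>?A. ev (c x) * T x z) = (\<Sum>x\<in>?A. if x = z then ev (c z) else 0)"
      by (rule sum.cong[OF refl]) (simp add: T_def)
    also have "\<dots> = (if z \<in> ?A then ev (c z) else 0)" using finite_Xi by (simp add: sum.delta)
    finally have s: "(\<Sum>x\<in>?A. ev (c x) * T x z) = (if z \<in> ?A then ev (c z) else 0)" .
    show "?w z + - 1 * (\<Sum>x\<in>?A. ev (c x) * T x z) = ev (c z0) * T z0 z"
      unfolding s w using expandsD(1)[OF step(3), of z] by (auto simp: T_def)
  qed
  finally show ?case using c0 by (rule GA_scaled)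
qed

lemma GA_all: "carrier (MU d) \<subseteq> GA"
proof
  fix a assume a: "a \<in> carrier (MU d)"
  have outside: "z \<notin> Xi d \<Longrightarrow> a z = 0" for z using a unfolding carrier_MU by blast
  have "(\<lambda>z. \<Sum>x\<in>Xi d. a x * T x z) \<in> GA"
    using finite_Xi GA_reachable[OF reachable_all] by (intro GA_sum)
  also have "(\<lambda>z. \<Sum>x\<in>Xi d. a x * T x z) = a"
  proof
    fix z
    have "(\<Sum>x\<in>Xi d. a x * T x z) = (\<Sum>x\<in>Xi d. if x = z then a z else 0)"
      by (rule sum.cong[OF refl]) (simp add: T_def)
    then show "(\<Sum>x\<in>Xi d. a x * T x z) = a z" 
      using finite_Xi outside[of z] by (simp add: sum.delta)
  qed
  finally show "a \<in> GA" .
qed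

end

theorem theorem3p5:
  fixes d :: nat
  assumes "0 < d"
  shows "generated_algebra (MU d) {e_gen d, f_gen d, k_gen d, k_inv_gen d, l_gen d} = carrier (MU d)"
  using GA_carrier GA_all by blast

end
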